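(* For any nonzero cardinal $n\le\omega$ and the Polish vector space $X=\mathbb R^n$, the following statements hold: 1. $\mathcal{B}or_X\cap(\mathcal{HT}_X\cup\mathcal{NF}_X)\subseteq\mathcal{HN}_X\cap\mathcal{HM}_X$; 2. $\sigma\overline{\mathcal{HN}}_X\subseteq\mathcal{HN}_X\cap\sigma\overline{\mathcal{HM}}_X\subseteq\sigma\overline{\mathcal{HM}}_X\subseteq\mathcal M_X$; 3. $\mathcal P_X\setminus\mathcal{HT}_X\subseteq\mathcal C_X$; 4. $\mathcal P_X\setminus\mathcal{NF}_X\subseteq\mathcal A_X=\mathcal B_X\subseteq\mathcal C_X$; 5. If $n<\omega$, then $\mathcal{B}or_X\setminus\sigma\overline{\mathcal{HN}}_X\subseteq\mathcal A_X=\mathcal B_X\subseteq\mathcal C_X$; 6. If $n=\omega$, then $\big(\mathcal{B}or_X\cap\mathcal{HT}_X\cap\mathcal{NF}_X\big)\setminus\sigma\overline{\mathcal{HM}}_X\not\subseteq\mathcal C_X$.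
   Context: All vector spaces are over $\mathbb R$; $\mathbb R^n$ carries the product topology. Let $X$ be a Polish vector space, i.e. a nontrivial topological vector space homeomorphic to a separable complete metric space, viewed also as a Polish Abelian group. Let $2^\omega=\{0,1\}^\omega$ be the Cantor cube. - $\mathcal P_X$ is the family of all subsets of $X$, $\mathcal{B}or_X$ the family of Borel subsets of $X$, and $\mathcal M_X$ the family of meager subsets of $X$. - A Borel set $A\subseteq X$ is Haar-null if there is a Borel probability measure $\mu$ on $X$ with $\mu(A+x)=0$ for all $x\in X$. $\mathcal{HN}_X$ is the family of all subsets of Borel Haar-null sets of $X$. - A Borel set $A\subseteq X$ is Haar-meager if there is a continuous map $f:2^\omega\to X$ such that $f^{-1}[A+x]$ is meager in $2^\omega$ for every $x\in X$. $\mathcal{HM}_X$ is the family of all subsets of Borel Haar-meager sets of $X$. - $\sigma\overline{\mathcal{HN}}_X$ (resp. $\sigma\overline{\mathcal{HM}}_X$) is the $\sigma$-ideal generated by closed Haar-null (resp. closed Haar-meager) sets in $X$, i.e. the family of subsets of $X$ that can be covered by countably many closed Haar-null (resp. closed Haar-meager) sets. - A set $T\subseteq 2^\omega$ is thin if for every $k\in\omega$ the restriction to $T$ of the projection $2^\omega\to 2^{\omega\setminus\{k\}}$, $x\mapsto x{\restriction}_{\omega\setminus\{k\}}$, is injective. A set $A\subseteq X$ is Haar-thin if there is a continuous map $f:2^\omega\to X$ such that $f^{-1}[A+x]$ is thin for every $x\in X$. $\mathcal{HT}_X$ is the family of Haar-thin sets in $X$. - A set $A\subseteq X$ is null-finite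 if there is a sequence $(x_k)_{k\in\omega}$ in $X$ converging to zero such that for every $x\in X$ the set $\{k\in\omega: x_k+x\in A\}$ is finite. $\mathcal{NF}_X$ is the family of null-finite sets in $X$. - A function $f:X\to\mathbb R$ is additive if $f(x+y)=f(x)+f(y)$ for all $x,y\in X$. A function $f:D\to\mathbb R$ on a convex set $D\subseteq X$ is mid-convex if $f\big(\frac{x+y}2\big)\le\frac{f(x)+f(y)}2$ for all $x,y\in D$. - $\mathcal A_X$ is the class of all sets $A\subseteq X$ such that any mid-convex function $f:D\to\mathbb R$ defined on an open convex subset $D\supseteq A$ of $X$ is continuous whenever $\sup f[A]<\infty$. - $\mathcal B_X$ is the class of all sets $B\subseteq X$ such that any additive function $f:X\to\mathbb R$ is continuous whenever $\sup f[B]<\infty$. - $\mathcal C_X$ is the class of all sets $C\subseteq X$ such that any additive function $f:X\to\mathbb R$ is continuous whenever $f[C]$ is a bounded subset of $\mathbb R$. *)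

theory Defs
  imports "HOL-Probability.Probability" "HOL-Library.Function_Algebras"
begin

class polish_vector_space = polish_space + real_vector + topological_ab_group_add +
  assumes tendsto_scaleR_Pair:
    "LIM z (nhds a \<times>\<^sub>F nhds b). fst z *\<^sub>R snd z :> nhds (a *\<^sub>R b)"
  and nontrivial: "\<exists>x. x \<noteq> 0"

instance real :: polish_vector_space
proof
  fix a b :: real
  show "LIM z (nhds a \<times>\<^sub>F nhds b). fst z *\<^sub>R snd z :> nhds (a *\<^sub>R b)"
    by (intro tendsto_intros filterlim_fst filterlim_snd)
  show "\<exists>x::real. x \<noteq> 0"
    by (rule exI[of _ 1]) simp
qed

text \<open>
  The space \<open>\<real>\<^sup>n\<close> is the type \<^typ>\<open>'i \<Rightarrow> real\<close> for an index type of cardinality \<open>n\<close>. Its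
  addition and its topology (the product topology) come from the libraries; the pointwise
  scalar multiplication is added here. For a countable index type it is a Polish vector space.
\<close>

instantiation "fun" :: (type, real_vector) real_vector
begin

definition "scaleR_fun c f = (\<lambda>i. c *\<^sub>R f i)"

instance
  by standard (auto simp: scaleR_fun_def fun_eq_iff scaleR_add_right scaleR_add_left)

end

lemma tendsto_fun_componentwise:
  fixes f :: "'a \<Rightarrow> 'i \<Rightarrow> 'b::topological_space"
  shows "(f \<longlongrightarrow> l) F \<longleftrightarrow> (\<forall>i. ((\<lambda>x. f x i) \<longlongrightarrow> l i) F)"
  using limitin_componentwise[of "\<lambda>_::'i. euclidean :: 'b topology" UNIV f l F]
  by (simp add: euclidean_product_topology)

lemma tendsto_fst_component:
  fixes a :: "'i \<Rightarrow> 'b::topological_space"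
  shows "((\<lambda>z. fst z i) \<longlongrightarrow> a i) (nhds a \<times>\<^sub>F G)"
  using filterlim_fst[of "nhds a" G] unfolding tendsto_fun_componentwise by blast

lemma tendsto_snd_component:
  fixes b :: "'i \<Rightarrow> 'b::topological_space"
  shows "((\<lambda>z. snd z i) \<longlongrightarrow> b i) (F \<times>\<^sub>F nhds b)"
  using filterlim_snd[of "nhds b" F] unfolding tendsto_fun_componentwise by blast

instance "fun" :: (type, topological_monoid_add) topological_monoid_add
proof
  fix a b :: "'a \<Rightarrow> 'b"
  show "LIM z (nhds a \<times>\<^sub>F nhds b). fst z + snd z :> nhds (a + b)"
    unfolding tendsto_fun_componentwise plus_fun_apply
    by (intro allI tendsto_add tendsto_fst_component tendsto_snd_component)
qed

instance "fun" :: (type, topological_group_add) topological_group_add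
proof
  fix a :: "'a \<Rightarrow> 'b"
  have "((\<lambda>x. x i) \<longlongrightarrow> a i) (nhds a)" for i
    using filterlim_ident[of "nhds a"] unfolding tendsto_fun_componentwise by blast
  then show "(uminus \<longlongrightarrow> - a) (nhds a)"
    unfolding tendsto_fun_componentwise uminus_apply
    by (intro allI tendsto_minus)
qed

instance "fun" :: (type, topological_ab_group_add) topological_ab_group_add ..

lemma tendsto_scaleR_polish:
  fixes g :: "'c \<Rightarrow> 'b::polish_vector_space"
  assumes "(f \<longlongrightarrow> a) F" "(g \<longlongrightarrow> b) F"
  shows "((\<lambda>x. f x *\<^sub>R g x) \<longlongrightarrow> a *\<^sub>R b) F"
  using filterlim_compose[OF tendsto_scaleR_Pair filterlim_Pair[OF assms]] by simp

instance "fun" :: (countable, polish_vector_space) polish_vector_space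
proof
  fix a :: real and b :: "'a \<Rightarrow> 'b"
  show "LIM z (nhds a \<times>\<^sub>F nhds b). fst z *\<^sub>R snd z :> nhds (a *\<^sub>R b)"
    unfolding tendsto_fun_componentwise scaleR_fun_def
    by (intro allI tendsto_scaleR_polish tendsto_snd_component filterlim_fst)
  obtain x :: 'b where "x \<noteq> 0"
    using nontrivial by blast
  then show "\<exists>f::'a \<Rightarrow> 'b. f \<noteq> 0"
    by (intro exI[of _ "\<lambda>_. x"]) (simp add: fun_eq_iff)
qed

type_synonym cantor = "nat \<Rightarrow> bool"

definition translate :: "'a::plus set \<Rightarrow> 'a \<Rightarrow> 'a set" where
  "translate A x = (\<lambda>a. a + x) ` A"

definition nowhere_dense :: "'a::topological_space set \<Rightarrow> bool" where
  "nowhere_dense A \<longleftrightarrow> interior (closure A) = {}"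

definition meager :: "'a::topological_space set \<Rightarrow> bool" where
  "meager A \<longleftrightarrow> (\<exists>\<K>. countable \<K> \<and> (\<forall>K\<in>\<K>. nowhere_dense K) \<and> A = \<Union>\<K>)"

definition haar_null :: "'a::polish_vector_space set \<Rightarrow> bool" where
  "haar_null A \<longleftrightarrow> A \<in> sets borel \<and>
     (\<exists>\<mu>. prob_space \<mu> \<and> sets \<mu> = sets borel \<and> (\<forall>x. emeasure \<mu> (translate A x) = 0))"

definition haar_meager :: "'a::polish_vector_space set \<Rightarrow> bool" where
  "haar_meager A \<longleftrightarrow> A \<in> sets borel \<and>
     (\<exists>f :: cantor \<Rightarrow> 'a. continuous_on UNIV f \<and> (\<forall>x. meager (f -` translate A x)))"

definition thin :: "cantor set \<Rightarrow> bool" where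
  "thin T \<longleftrightarrow> (\<forall>k. inj_on (\<lambda>x. restrict x (UNIV - {k})) T)"

definition haar_thin :: "'a::polish_vector_space set \<Rightarrow> bool" where
  "haar_thin A \<longleftrightarrow>
     (\<exists>f :: cantor \<Rightarrow> 'a. continuous_on UNIV f \<and> (\<forall>x. thin (f -` translate A x)))"

definition null_finite :: "'a::polish_vector_space set \<Rightarrow> bool" where
  "null_finite A \<longleftrightarrow>
     (\<exists>s :: nat \<Rightarrow> 'a. s \<longlonglongrightarrow> 0 \<and> (\<forall>x. finite {k. s k + x \<in> A}))"

definition mid_convex_on :: "'a::real_vector set \<Rightarrow> ('a \<Rightarrow> real) \<Rightarrow> bool" where
  "mid_convex_on D f \<longleftrightarrow>
     (\<forall>x\<in>D. \<forall>y\<in>D. f ((1/2) *\<^sub>R (x + y)) \<le> (f x + f y) / 2)"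

definition Meager_sets :: "'a::polish_vector_space set set" where
  "Meager_sets = {A. meager A}"

definition HN :: "'a::polish_vector_space set set" where
  "HN = {A. \<exists>B. haar_null B \<and> A \<subseteq> B}"

definition HM :: "'a::polish_vector_space set set" where
  "HM = {A. \<exists>B. haar_meager B \<and> A \<subseteq> B}"

definition sigma_closed_HN :: "'a::polish_vector_space set set" where
  "sigma_closed_HN =
     {A. \<exists>\<K>. countable \<K> \<and> (\<forall>K\<in>\<K>. closed K \<and> haar_null K) \<and> A \<subseteq> \<Union>\<K>}"

definition sigma_closed_HM :: "'a::polish_vector_space set set" where
  "sigma_closed_HM =
     {A. \<exists>\<K>. countable \<K> \<and> (\<forall>K\<in>\<K>. closed K \<and> haar_meager K) \<and> A \<subseteq> \<Union>\<K>}"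

definition HT :: "'a::polish_vector_space set set" where
  "HT = {A. haar_thin A}"

definition NF :: "'a::polish_vector_space set set" where
  "NF = {A. null_finite A}"

text \<open>
  A function on \<open>D\<close> is a total function of which only the values on \<open>D\<close> matter. The conditions
  \<open>sup f[A] < \<infinity>\<close> and ``\<open>f[A]\<close> is bounded'' hold for \<open>A = {}\<close>, as \<^const>\<open>bdd_above\<close> and
  \<^const>\<open>bounded\<close> do.
\<close>

definition class_A :: "'a::polish_vector_space set set" where
  "class_A = {A. \<forall>D f. open D \<and> convex D \<and> A \<subseteq> D \<and> mid_convex_on D f \<and> bdd_above (f ` A)
                  \<longrightarrow> continuous_on D f}"

definition class_B :: "'a::polish_vector_space set set" where
  "class_B = {B. \<forall>f :: 'a \<Rightarrow> real. Modules.additive f \<and> bdd_above (f ` B)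
                  \<longrightarrow> continuous_on UNIV f}"

definition class_C :: "'a::polish_vector_space set set" where
  "class_C = {C. \<forall>f :: 'a \<Rightarrow> real. Modules.additive f \<and> bounded (f ` C)
                  \<longrightarrow> continuous_on UNIV f}"

end

theory Submission
  imports Defs
begin

text \<open>
  A Borel set \<open>E\<close> in the Cantor cube that is non-null for coin tossing, or nonmeager, contains a point
  which stays in \<open>E\<close> under flipping infinitely many of its zeros. Pulling back along the map sending
  a subset of \<open>\<nat>\<close> to the sum of a rapidly vanishing sequence over it yields (1) and Christensen's
  theorem that \<open>A - A\<close> is a neighbourhood of \<open>0\<close> unless the Borel set \<open>A\<close> is Haar-null. The same
  sums along a null sequence on which a discontinuous additive function explodes yield (3) and half
  of (4). For \<open>class_B \<subseteq> class_A\<close>, every additive support of a mid-convex function is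
  continuous, so the function is lower semicontinuous and the Baire and Bernstein--Doetsch theorems
  apply. In finite dimension a Borel set outside \<open>sigma_closed_HN\<close> is a projection of a Polish space on which all
  open pieces have images of positive-measure closure; their sums are then somewhere dense, and a
  category argument puts an open set into a fourfold sum of the set. In infinite dimension a
  linearly independent \<open>G\<^sub>\<delta>\<close> set whose relatively open parts are dense in translates of arbitrarily
  large compact sets is the counterexample.
\<close>

text \<open>Only zeros are flipped, so a flip translates a subset sum by exactly one term of the
  sequence, always with the same sign; a single statement about flips then serves measure and
  category. In finite dimension a Borel set outside \<open>sigma_closed_HN\<close> may itself be
  Haar-null, so Christensen's theorem says nothing about it. Only closures of pieces have positive
  measure, which is why sums of closed sets come first and category has to recover the set itself,
  at the price of four summands. In infinite dimension membership of the example in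
  \<open>HT\<close> and \<open>NF\<close> is never checked directly: sets outside \<open>HT\<close>
  or outside \<open>NF\<close> have already been shown to lie in \<open>class_C\<close>, so it is
  enough that the example avoids \<open>class_C\<close>. Linear independence provides a functional
  that is bounded on the example, and density in translates of compact sets makes this functional
  discontinuous as well as defeating covers by closed Haar-meager sets. The two demands compete:
  coordinates must range over long intervals and still code the point.\<close>

section \<open>Meager sets, Baire category and the Baire property\<close>

lemma nowhere_dense_subset: "nowhere_dense B \<Longrightarrow> A \<subseteq> B \<Longrightarrow> nowhere_dense A"
  unfolding nowhere_dense_def by (metis closure_mono interior_mono subset_empty)

lemma meager_iff_cover:
  "meager A \<longleftrightarrow> (\<exists>\<K>. countable \<K> \<and> (\<forall>K\<in>\<K>. nowhere_dense K) \<and> A \<subseteq> \<Union>\<K>)"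
proof
  assume "\<exists>\<K>. countable \<K> \<and> (\<forall>K\<in>\<K>. nowhere_dense K) \<and> A \<subseteq> \<Union>\<K>"
  then obtain \<K> where "countable \<K>" "\<forall>K\<in>\<K>. nowhere_dense K" "A \<subseteq> \<Union>\<K>" by blast
  then show "meager A" unfolding meager_def
    by (intro exI[of _ "(\<lambda>K. A \<inter> K) ` \<K>"]) (auto intro: nowhere_dense_subset)
qed (auto simp: meager_def)

lemma meager_subset: "meager B \<Longrightarrow> A \<subseteq> B \<Longrightarrow> meager A"
  unfolding meager_iff_cover by (meson subset_trans)

lemma nowhere_dense_imp_meager: "nowhere_dense A \<Longrightarrow> meager A"
  unfolding meager_def by (intro exI[of _ "{A}"]) auto

lemma meager_empty: "meager {}"
  by (rule nowhere_dense_imp_meager) (simp add: nowhere_dense_def)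

lemma meager_UN:
  assumes "countable I" "\<And>i. i \<in> I \<Longrightarrow> meager (A i)"
  shows "meager (\<Union>i\<in>I. A i)"
proof -
  obtain K where K: "countable (K i)" "\<forall>B\<in>K i. nowhere_dense B" "A i = \<Union>(K i)" if "i \<in> I" for i
    using assms(2) unfolding meager_def by metis
  show ?thesis unfolding meager_def
    by (intro exI[of _ "\<Union>i\<in>I. K i"]) (use K assms(1) in auto)
qed

lemma meager_Un: "meager A \<Longrightarrow> meager B \<Longrightarrow> meager (A \<union> B)"
  using meager_UN[of "{A, B}" id] by auto

text \<open>A continuous involution is its own continuous inverse, hence a homeomorphism. The uses
  are bit flips and reflections \<open>z \<mapsto> v - z\<close>.\<close>

lemma nowhere_dense_vimage_involution:
  assumes h: "continuous_on UNIV h" "\<And>x. h (h x) = x" and A: "nowhere_dense A"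
  shows "nowhere_dense (h -` A)"
proof -
  have "closure (h -` A) \<subseteq> h -` closure A"
    by (intro closure_minimal closed_vimage h(1) vimage_mono closure_subset) simp
  moreover have "interior (h -` closure A) = {}"
  proof (rule ccontr)
    let ?O = "interior (h -` closure A)"
    assume "?O \<noteq> {}"
    have "h -` ?O \<subseteq> closure A"
      using interior_subset h(2) by (metis subsetI subsetD vimage_eq)
    moreover have "open (h -` ?O)" using h(1) by (simp add: open_vimage)
    ultimately have "h -` ?O \<subseteq> interior (closure A)" by (rule interior_maximal)
    then have "h -` ?O = {}" using A unfolding nowhere_dense_def by auto
    moreover obtain x where "x \<in> ?O" using \<open>?O \<noteq> {}\<close> by auto
    then have "h x \<in> h -` ?O" using h(2) by simp
    ultimately show False by blast
  qed
  ultimately show ?thesis unfolding nowhere_dense_def by (metis interior_mono subset_empty)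
qed

lemma meager_vimage_involution:
  assumes h: "continuous_on UNIV h" "\<And>x. h (h x) = x" and A: "meager A"
  shows "meager (h -` A)"
proof -
  obtain \<K> where "countable \<K>" "\<forall>K\<in>\<K>. nowhere_dense K" "A = \<Union>\<K>"
    using A unfolding meager_def by blast
  then show ?thesis unfolding meager_iff_cover
    by (intro exI[of _ "(-`) h ` \<K>"]) (auto intro: nowhere_dense_vimage_involution[OF h])
qed

text \<open>Both alternatives occur: complete metric spaces enter through the first, the Cantor cube
  as a compact Hausdorff space through the second.\<close>

lemma Baire_space_nonmeager:
  fixes U :: "'a::topological_space set"
  assumes "completely_metrizable_space (euclidean :: 'a topology)
      \<or> locally_compact_space (euclidean :: 'a topology) \<and> regular_space (euclidean :: 'a topology)"
    and "open U" "U \<noteq> {}"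
  shows "\<not> meager U"
proof
  assume "meager U"
  then obtain \<K> where \<K>: "countable \<K>" "\<forall>K\<in>\<K>. nowhere_dense K" "U = \<Union>\<K>"
    unfolding meager_def by blast
  have "euclidean interior_of \<Union>(closure ` \<K>) = {}"
    by (rule Baire_category_alt[OF assms(1)]) (use \<K> in \<open>auto simp: nowhere_dense_def\<close>)
  moreover have "U \<subseteq> \<Union>(closure ` \<K>)" using \<K>(3) closure_subset by blast
  ultimately show False using assms(2,3) by (metis interior_maximal
    euclidean_interior_of subset_empty)
qed

lemma nonmeager_open:
  fixes U :: "'a::complete_space set"
  shows "open U \<Longrightarrow> U \<noteq> {} \<Longrightarrow> \<not> meager U"
  by (rule Baire_space_nonmeager) (auto simp: completely_metrizable_space_euclidean)

lemma compact_UNIV_cantor: "compact (UNIV :: cantor set)"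
proof -
  have "compact_space (product_topology (\<lambda>_::nat. euclidean :: bool topology) UNIV)"
    unfolding compact_space_product_topology by (simp add: compact_space_def finite_imp_compact)
  then show ?thesis by (simp add: euclidean_product_topology compact_space_def)
qed

lemma nonmeager_open_cantor:
  fixes U :: "cantor set"
  assumes "open U" "U \<noteq> {}"
  shows "\<not> meager U"
proof (rule Baire_space_nonmeager[OF _ assms])
  have "compact_space (euclidean :: cantor topology)"
    using compact_UNIV_cantor by (simp add: compact_space_def)
  moreover have "Hausdorff_space (euclidean :: bool topology)"
    by (simp add: Hausdorff_space_def disjnt_def) (metis hausdorff)
  then have "Hausdorff_space (euclidean :: cantor topology)"
    unfolding euclidean_product_topology[symmetric] Hausdorff_space_product_topology by blast
  ultimately show "completely_metrizable_space (euclidean :: cantor topology)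
      \<or> locally_compact_space (euclidean :: cantor topology) \<and> regular_space (euclidean :: cantor topology)"
    by (simp add: compact_imp_locally_compact_space compact_Hausdorff_imp_regular_space)
qed

text \<open>Sets that are open up to a meager set form a \<sigma>-algebra. For complements,
  \<open>- closure U\<close> takes the place of \<open>U\<close> at the cost of the nowhere dense
  boundary of \<open>U\<close>.\<close>

lemma borel_baire_property:
  fixes E :: "'a::topological_space set"
  assumes "E \<in> sets borel"
  shows "\<exists>U. open U \<and> meager (E - U) \<and> meager (U - E)"
proof -
  have "E \<in> sigma_sets UNIV {S. open S}" using assms by (simp add: sets_borel)
  then show ?thesis
  proof induction
    case (Basic U)
    then show ?case by (intro exI[of _ U]) (simp add: meager_empty)
  next
    case Empty
    then show ?case by (intro exI[of _ "{}"]) (simp add: meager_empty)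
  next
    case (Compl E)
    then obtain U where U: "open U" "meager (E - U)" "meager (U - E)" by blast
    have fr: "nowhere_dense (closure U - U)"
    proof -
      have "interior (closure U - U) = {}"
      proof -
        have "interior (closure U - U) \<inter> U = {}" using interior_subset by blast
        then have "interior (closure U - U) \<inter> closure U = {}"
          by (simp add: open_Int_closure_eq_empty)
        then show ?thesis using interior_subset by blast
      qed
      moreover have "closed (closure U - U)" using U(1) by (simp add: closed_Diff)
      ultimately show ?thesis unfolding nowhere_dense_def by simp
    qed
    show ?case
    proof (intro exI[of _ "- closure U"] conjI)
      show "meager (UNIV - E - - closure U)"
        by (rule meager_subset[OF meager_Un[OF U(3) nowhere_dense_imp_meager[OF fr]]]) auto
      show "meager (- closure U - (UNIV - E))"
        by (rule meager_subset[OF U(2)]) (use closure_subset in auto)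
    qed (simp add: open_Compl)
  next
    case (Union E)
    then obtain U where U: "\<And>i. open (U i)" "\<And>i. meager (E i - U i)" "\<And>i. meager (U i - E i)"
      by metis
    show ?case
    proof (intro exI[of _ "\<Union>i. U i"] conjI)
      show "meager (\<Union>(range E) - (\<Union>i. U i))"
        by (rule meager_subset[OF meager_UN[of UNIV "\<lambda>i. E i - U i"]]) (use U in auto)
      show "meager ((\<Union>i. U i) - \<Union>(range E))"
        by (rule meager_subset[OF meager_UN[of UNIV "\<lambda>i. U i - E i"]]) (use U in auto)
    qed (use U in auto)
  qed
qed

subsection \<open>Cylinders\<close>

definition cylinder :: "cantor \<Rightarrow> nat \<Rightarrow> cantor set" where
  "cylinder a n = {b. \<forall>k<n. b k = a k}"

lemma cylinder_self [simp]: "a \<in> cylinder a n"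
  by (simp add: cylinder_def)

lemma open_coordinate:
  assumes "open U"
  shows "open {x :: 'i \<Rightarrow> 'b::topological_space. x i \<in> U}"
proof -
  have "open ((\<lambda>x. x i) -` U)" by (rule open_vimage[OF assms]) simp
  then show ?thesis by (simp add: vimage_def)
qed

lemma open_cylinder: "open (cylinder a n)"
proof -
  have "cylinder a n = (\<Inter>k\<in>{..<n}. {b. b k \<in> {a k}})" by (auto simp: cylinder_def)
  also have "open \<dots>"
  proof (intro open_INT ballI)
    show "open {b::cantor. b k \<in> {a k}}" for k by (rule open_coordinate, rule discrete_topology_class.open_discrete)
  qed simp
  finally show ?thesis .
qed

lemma open_contains_cube:
  fixes U :: "('i \<Rightarrow> 'b::topological_space) set"
  assumes "open U" "x \<in> U"
  obtains X where "\<And>i. open (X i)" "\<And>i. x i \<in> X i" "finite {i. X i \<noteq> UNIV}"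
    "\<And>y. (\<And>i. y i \<in> X i) \<Longrightarrow> y \<in> U"
proof -
  have "openin (product_topology (\<lambda>_. euclidean) UNIV) U"
    using assms(1) by (simp add: euclidean_product_topology)
  from product_topology_open_contains_basis[OF this assms(2)]
  obtain X where "x \<in> (\<Pi>\<^sub>E i\<in>UNIV. X i)" "\<And>i. openin euclidean (X i)"
     "finite {i. X i \<noteq> topspace euclidean}" "(\<Pi>\<^sub>E i\<in>UNIV. X i) \<subseteq> U" by auto
  then show ?thesis by (intro that[of X]) (auto simp: PiE_iff)
qed

lemma open_contains_cylinder:
  assumes "open U" "a \<in> U"
  obtains n where "cylinder a n \<subseteq> U"
proof -
  obtain X where X: "\<And>i. a i \<in> X i" "finite {i. X i \<noteq> UNIV}"
    "\<And>y. (\<And>i. y i \<in> X i) \<Longrightarrow> y \<in> U" using open_contains_cube[OF assms] by metis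
  obtain n where n: "\<And>i. X i \<noteq> UNIV \<Longrightarrow> i < n"
    using X(2) finite_nat_set_iff_bounded by auto
  have "cylinder a n \<subseteq> U"
  proof
    fix b assume "b \<in> cylinder a n"
    then have "b i \<in> X i" for i using X(1)[of i] n[of i] by (cases "X i = UNIV") (auto simp: cylinder_def)
    then show "b \<in> U" by (rule X(3))
  qed
  then show ?thesis by (rule that)
qed

definition flip :: "nat \<Rightarrow> cantor \<Rightarrow> cantor" where
  "flip n a = a(n := \<not> a n)"

lemma flip_flip [simp]: "flip n (flip n a) = a"
  by (simp add: flip_def fun_eq_iff)

lemma continuous_flip: "continuous_on UNIV (flip n)"
proof (rule continuous_on_coordinatewise_then_product)
  fix i
  have "continuous_on UNIV (\<lambda>a::cantor. if i = n then \<not> a i else a i)"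
    using continuous_on_compose2[of UNIV "\<lambda>b::bool. if i = n then \<not> b else b" UNIV "\<lambda>a. a i"]
    by (auto simp: continuous_on_discrete)
  then show "continuous_on UNIV (\<lambda>a. flip n a i)"
    by (rule continuous_on_eq) (auto simp: flip_def)
qed

text \<open>\<open>E\<close> is comeager in some cylinder \<open>?C\<close>. Flips are
  homeomorphisms, so a generic point of \<open>?C\<close> avoids \<open>?C - E\<close> together with
  all its flips; flips at positions past \<open>N\<close> stay in \<open>?C\<close>, hence land in
  \<open>E\<close>. Sequences with finitely many zeros are meager, so infinitely many of these flips
  act on zeros.\<close>

lemma nonmeager_flip:
  assumes E: "E \<in> sets borel" "\<not> meager E"
  obtains a where "a \<in> E" "\<exists>\<^sub>\<infinity>n. \<not> a n \<and> flip n a \<in> E"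
proof -
  obtain U where U: "open U" "meager (E - U)" "meager (U - E)" using borel_baire_property[OF E(1)] by blast
  have "U \<noteq> {}" using U(2) E(2) by auto
  then obtain c where "c \<in> U" by blast
  then obtain N where c: "cylinder c N \<subseteq> U" using open_contains_cylinder[OF U(1)] by metis
  let ?C = "cylinder c N"
  have m1: "meager (?C - E)" by (rule meager_subset[OF U(3)]) (use c in blast)
  have m2: "meager (\<Union>n. flip n -` (?C - E))"
    by (intro meager_UN meager_vimage_involution[OF continuous_flip] m1) auto
  have nd: "nowhere_dense {a::cantor. \<forall>n\<ge>m. a n}" for m
  proof -
    have "{a::cantor. \<forall>n\<ge>m. a n} = (\<Inter>n\<in>{m..}. {a. a n \<in> {True}})" by auto
    also have "closed \<dots>" 
    proof (intro closed_INT ballI)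
      fix n have "closed ((\<lambda>a::cantor. a n) -` {True})" by (rule closed_vimage) auto
      then show "closed {a::cantor. a n \<in> {True}}" by (simp add: vimage_def)
    qed
    finally have cl: "closed {a::cantor. \<forall>n\<ge>m. a n}" .
    have "interior {a::cantor. \<forall>n\<ge>m. a n} = {}"
    proof (rule ccontr)
      assume "\<not> ?thesis"
      then obtain a where "a \<in> interior {a::cantor. \<forall>n\<ge>m. a n}" by blast
      then obtain k where k: "cylinder a k \<subseteq> interior {a::cantor. \<forall>n\<ge>m. a n}"
        using open_contains_cylinder[OF open_interior] by metis
      have "a(max k m := False) \<in> cylinder a k" by (simp add: cylinder_def)
      then have "a(max k m := False) \<in> {a::cantor. \<forall>n\<ge>m. a n}" using k interior_subset by blast
      then show False by (auto dest!: spec[of _ "max k m"])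
    qed
    then show ?thesis using cl by (simp add: nowhere_dense_def)
  qed
  have m3: "meager (\<Union>m. {a::cantor. \<forall>n\<ge>m. a n})"
    by (intro meager_UN nowhere_dense_imp_meager nd) auto
  have "\<not> meager ?C" by (rule nonmeager_open_cantor[OF open_cylinder]) (metis cylinder_self empty_iff)
  then have "\<not> ?C \<subseteq> (?C - E) \<union> (\<Union>n. flip n -` (?C - E)) \<union> (\<Union>m. {a::cantor. \<forall>n\<ge>m. a n})"
    by (rule contrapos_nn) (rule meager_subset[OF meager_Un[OF meager_Un[OF m1 m2] m3]])
  then obtain a where "a \<in> ?C"
    "a \<notin> (?C - E) \<union> (\<Union>n. flip n -` (?C - E)) \<union> (\<Union>m. {a::cantor. \<forall>n\<ge>m. a n})" by blast
  then have a: "a \<in> ?C" "a \<in> E" "\<And>n. flip n a \<notin> ?C - E" "\<And>m. \<exists>n\<ge>m. \<not> a n" by simp_all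
  have "flip n a \<in> ?C" if "n \<ge> N" for n
    using a(1) that by (auto simp: cylinder_def flip_def)
  then have fl: "flip n a \<in> E" if "n \<ge> N" for n using that a(3) by blast
  have "\<exists>\<^sub>\<infinity>n. \<not> a n \<and> flip n a \<in> E"
    unfolding INFM_nat_le
  proof
    fix m obtain n where "n \<ge> max m N" "\<not> a n" using a(4) by blast
    then show "\<exists>n\<ge>m. \<not> a n \<and> flip n a \<in> E" using fl[of n] by auto
  qed
  then show ?thesis using that a(2) by blast
qed


subsection \<open>Coin tossing\<close>

text \<open>Second countability of the factor makes the Borel algebra of the cube the product
  \<sigma>-algebra.\<close>

instance bool :: second_countable_topology
proof
  show "\<exists>B::bool set set. countable B \<and> open = generate_topology B"
    by (intro exI[of _ "range lessThan \<union> range greaterThan"]) (auto simp: open_bool_def)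
qed

definition coin :: "cantor measure" where
  "coin = PiM UNIV (\<lambda>_. measure_pmf (bernoulli_pmf (1/2)))"

lemma sets_coin: "sets coin = sets borel"
proof -
  have "sets coin = sets (PiM UNIV (\<lambda>_::nat. borel :: bool measure))"
    unfolding coin_def by (rule sets_PiM_cong) (auto simp: sets_borel_eq_count_space)
  then show ?thesis by (simp add: sets_PiM_equal_borel)
qed

lemma space_coin [simp]: "space coin = UNIV"
  by (simp add: coin_def space_PiM)

lemma prob_space_coin: "prob_space coin"
  unfolding coin_def by (rule prob_space_PiM) (rule prob_space_measure_pmf)

interpretation coin: prob_space coin
  by (rule prob_space_coin)

lemma measurable_flip: "flip n \<in> coin \<rightarrow>\<^sub>M coin"
proof -
  have "flip n \<in> borel \<rightarrow>\<^sub>M borel" by (rule borel_measurable_continuous_onI[OF continuous_flip])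
  then show ?thesis using sets_coin measurable_cong_sets by blast
qed

text \<open>A flip negates one factor of the product, and the fair coin is symmetric under
  negation.\<close>

lemma distr_coin_flip: "distr coin coin (flip n) = coin"
proof -
  interpret product_prob_space "\<lambda>_. measure_pmf (bernoulli_pmf (1/2))" "UNIV :: nat set"
    by unfold_locales
  show ?thesis unfolding coin_def
  proof (rule PiM_eq)
  let ?M = "\<lambda>_::nat. measure_pmf (bernoulli_pmf (1/2))"
  let ?P = "Pi\<^sub>M UNIV ?M"
  fix J :: "nat set" and F assume J: "finite J"
  define F' where "F' j = (if j = n then Not -` F j else F j)" for j
  have "emeasure (distr ?P ?P (flip n)) (prod_emb UNIV ?M J (Pi\<^sub>E J F)) =
     emeasure ?P (flip n -` (prod_emb UNIV ?M J (Pi\<^sub>E J F)) \<inter> space ?P)"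
    by (rule emeasure_distr) (use measurable_flip J in \<open>auto simp: coin_def intro!: sets_PiM_I\<close>)
  also have "flip n -` (prod_emb UNIV ?M J (Pi\<^sub>E J F)) \<inter> space ?P = prod_emb UNIV ?M J (Pi\<^sub>E J F')"
    by (auto simp: prod_emb_def space_PiM F'_def flip_def PiE_iff split: if_splits) 
  also have "emeasure ?P \<dots> = (\<Prod>j\<in>J. emeasure (?M j) (F' j))"
    by (rule emeasure_PiM_emb) (use J in auto)
  also have "\<dots> = (\<Prod>j\<in>J. emeasure (?M j) (F j))"
  proof (rule prod.cong[OF refl])
    fix j
    have "bij Not" by (rule bijI') auto
    have eq: "map_pmf Not (bernoulli_pmf (1/2)) = bernoulli_pmf (1/2)"
    proof (rule pmf_eqI)
      fix b
      have "pmf (map_pmf Not (bernoulli_pmf (1/2))) (\<not> \<not> b) = pmf (bernoulli_pmf (1/2)) (\<not> b)"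
        using \<open>bij Not\<close> by (intro pmf_map_inj') (rule bij_is_inj)
      then show "pmf (map_pmf Not (bernoulli_pmf (1/2))) b = pmf (bernoulli_pmf (1/2)) b"
        by (cases b) simp_all
    qed
    have "emeasure (measure_pmf (bernoulli_pmf (1/2))) (Not -` F j) =
      emeasure (measure_pmf (bernoulli_pmf (1/2))) (F j)"
      using emeasure_map_pmf[of Not "bernoulli_pmf (1/2)" "F j"] unfolding eq by simp
    then show "emeasure (?M j) (F' j) = emeasure (?M j) (F j)"
      unfolding F'_def by auto
  qed
  finally show "emeasure (distr ?P ?P (flip n)) (prod_emb UNIV ?M J (Pi\<^sub>E J F)) = (\<Prod>j\<in>J. emeasure (?M j) (F j))" .
qed simp
qed

lemma prob_flip_vimage: "E \<in> sets coin \<Longrightarrow> coin.prob (flip n -` E) = coin.prob E"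
  using measure_distr[OF measurable_flip, of E n] by (simp add: distr_coin_flip)

lemma flip_vimage_sets: "E \<in> sets coin \<Longrightarrow> flip n -` E \<in> sets coin"
  using measurable_sets[OF measurable_flip, of E n] by simp

text \<open>Asymptotic invariance under flips passes from cylinders to all Borel sets by a Dynkin argument.\<close>

lemma prob_Diff_flip_tendsto_0:
  assumes "E \<in> sets coin"
  shows "(\<lambda>n. coin.prob (E - flip n -` E)) \<longlonglongrightarrow> 0"
proof -
  let ?M = "\<lambda>_::nat. measure_pmf (bernoulli_pmf (1/2))"
  have *: "sets coin = sigma_sets UNIV (prod_algebra UNIV ?M)"
    by (simp add: coin_def sets_PiM)
  have sub: "prod_algebra UNIV ?M \<subseteq> Pow UNIV" by auto
  have "E \<in> sigma_sets UNIV (prod_algebra UNIV ?M)" using assms * by simp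
  then show ?thesis
  proof (induction rule: sigma_sets_induct_disjoint[OF Int_stable_prod_algebra sub, consumes 1, case_names basic empty compl union])
    case (basic A)
    then obtain J F where A: "A = prod_emb UNIV ?M J (Pi\<^sub>E J F)" "finite J" by (rule prod_algebraE)
    obtain m where m: "\<And>j. j \<in> J \<Longrightarrow> j < m" using A(2) finite_nat_set_iff_bounded by auto
    have "A - flip n -` A = {}" if "n \<ge> m" for n
    proof -
      have "n \<notin> J" using that m by force
      then show ?thesis
        by (auto simp: A prod_emb_def flip_def PiE_iff)
    qed
    then have "\<forall>\<^sub>F n in sequentially. coin.prob (A - flip n -` A) = 0"
      unfolding eventually_sequentially by (metis measure_empty)
    then show ?case by (rule tendsto_eventually)
  next
    case empty
    show ?case by simp
  next
    case (compl A)
    have A: "A \<in> sets coin" using compl(1) * by simp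
    have "coin.prob ((UNIV - A) - flip n -` (UNIV - A)) = coin.prob (A - flip n -` A)" for n
    proof -
      have "(UNIV - A) - flip n -` (UNIV - A) = flip n -` (A - flip n -` A)"
        by auto
      then show ?thesis
        using prob_flip_vimage[of "A - flip n -` A" n] A flip_vimage_sets[OF A] by auto
    qed
    then show ?case using compl by simp
  next
    case (union A)
    have A: "A i \<in> sets coin" for i using union(2) * by blast
    define a where "a i n = coin.prob (A i - flip n -` A i)" for i n
    have le: "a i n \<le> coin.prob (A i)" for i n
      unfolding a_def by (rule coin.finite_measure_mono) (use A in auto)
    have sm: "summable (\<lambda>i. coin.prob (A i))"
      using coin.finite_measure_UNION[of A] A union(1) by (auto simp: sums_iff)
    \<comment> \<open>Dominated convergence for series: disjointness of the \<open>A i\<close> makes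
      the bounds \<open>coin.prob (A i)\<close> summable.\<close>
    have tt: "(\<lambda>n. \<Sum>i. a i n) \<longlonglongrightarrow> (\<Sum>i::nat. 0)"
    proof (rule tannerys_theorem[THEN conjunct2, THEN conjunct2])
      show "(\<lambda>n. a i n) \<longlonglongrightarrow> 0" for i using union(3) unfolding a_def .
      show "\<forall>\<^sub>F (i, n) in sequentially \<times>\<^sub>F sequentially. norm (a i n) \<le> coin.prob (A i)"
        by (rule always_eventually) (use le in \<open>auto simp: a_def\<close>)
    qed (use sm in auto)
    have sma: "summable (\<lambda>i. a i n)" for n
      by (rule summable_comparison_test'[OF sm, of 0]) (use le in \<open>auto simp: a_def\<close>)
    have "coin.prob ((\<Union>i. A i) - flip n -` (\<Union>i. A i)) \<le> (\<Sum>i. a i n)" for n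
    proof -
      have "coin.prob ((\<Union>i. A i) - flip n -` (\<Union>i. A i)) \<le> coin.prob (\<Union>i. A i - flip n -` A i)"
        by (rule coin.finite_measure_mono) (use A flip_vimage_sets in auto)
      also have "\<dots> \<le> (\<Sum>i. a i n)"
        unfolding a_def by (rule coin.finite_measure_subadditive_countably)
          (use A flip_vimage_sets sma in \<open>auto simp: a_def\<close>)
      finally show ?thesis .
    qed
    then show ?case
      using tendsto_sandwich[of "\<lambda>_. 0" _ sequentially "\<lambda>n. \<Sum>i. a i n" 0] tt by simp
  qed
qed

text \<open>Up to a set of vanishing measure, \<open>E\<close> is covered by \<open>B n\<close> and
  its flip, which have equal measure. Thus \<open>B n\<close> keeps asymptotically at least half the
  measure of \<open>E\<close>, and the limes superior \<open>L\<close> cannot be empty.\<close>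

lemma nonnull_flip:
  assumes E: "E \<in> sets borel" "emeasure coin E \<noteq> 0"
  obtains a where "a \<in> E" "\<exists>\<^sub>\<infinity>n. \<not> a n \<and> flip n a \<in> E"
proof -
  have [measurable]: "E \<in> sets coin" using E sets_coin by simp
  have fE [measurable]: "flip n -` E \<in> sets coin" for n by (rule flip_vimage_sets) simp
  have cyl [measurable]: "{a. \<not> a n} \<in> sets coin" for n
    unfolding sets_coin using open_coordinate[of "{False}" n] by (auto simp: discrete_topology_class.open_discrete)
  define B where "B n = {a \<in> E. \<not> a n \<and> flip n a \<in> E}" for n
  have B: "B n = E \<inter> {a. \<not> a n} \<inter> flip n -` E" for n by (auto simp: B_def)
  have [measurable]: "B n \<in> sets coin" for n unfolding B by simp
  have half: "coin.prob E \<le> 2 * coin.prob (B n) + coin.prob (E - flip n -` E)" for n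
  proof -
    \<comment> \<open>When a point and its flip both lie in \<open>E\<close>, one of the two has a
      zero at \<open>n\<close>.\<close>
    have "E \<subseteq> (B n \<union> flip n -` B n) \<union> (E - flip n -` E)"
      by (auto simp: B_def flip_def)
    then have "coin.prob E \<le> coin.prob ((B n \<union> flip n -` B n) \<union> (E - flip n -` E))"
      by (rule coin.finite_measure_mono) (use flip_vimage_sets in auto)
    also have "\<dots> \<le> coin.prob (B n) + coin.prob (flip n -` B n) + coin.prob (E - flip n -` E)"
      by (intro order_trans[OF measure_Un_le] add_mono measure_Un_le order_refl) (use flip_vimage_sets in auto)
    finally show ?thesis by (simp add: prob_flip_vimage)
  qed
  define L where "L = (\<Inter>m. \<Union>n\<in>{m..}. B n)"
  have "L \<noteq> {}"
  proof
    assume "L = {}"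
    have "(\<lambda>m. coin.prob (\<Union>n\<in>{m..}. B n)) \<longlonglongrightarrow> coin.prob L"
      unfolding L_def by (rule coin.finite_Lim_measure_decseq) (auto simp: decseq_def, force)
    then have lim: "(\<lambda>m. 2 * coin.prob (\<Union>n\<in>{m..}. B n) + coin.prob (E - flip m -` E)) \<longlonglongrightarrow> 2 * 0 + 0"
      using \<open>L = {}\<close> by (intro tendsto_intros prob_Diff_flip_tendsto_0) auto
    have "coin.prob E \<le> 2 * coin.prob (\<Union>n\<in>{m..}. B n) + coin.prob (E - flip m -` E)" for m
      using half[of m] coin.finite_measure_mono[of "B m" "\<Union>n\<in>{m..}. B n"] by fastforce
    then have "coin.prob E \<le> 2 * 0 + 0"
      using LIMSEQ_le_const[OF lim] by blast
    then show False using E(2) by (simp add: coin.emeasure_eq_measure measure_le_0_iff)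
  qed
  then obtain a where "a \<in> L" by blast
  then have "\<exists>\<^sub>\<infinity>n. a \<in> B n" unfolding L_def INFM_nat_le by auto
  then have "\<exists>\<^sub>\<infinity>n. \<not> a n \<and> flip n a \<in> E" "a \<in> E"
    by (auto simp: B_def elim: INFM_mono dest: INFM_EX)
  then show ?thesis using that by blast
qed


subsection \<open>Translates and subset sums\<close>

lemma mem_translate [simp]:
  fixes x y :: "'a::group_add"
  shows "y \<in> translate A x \<longleftrightarrow> y - x \<in> A"
  unfolding translate_def by (auto intro: image_eqI[of _ _ "y - x"])

lemma translate_borel:
  fixes x :: "'a::topological_group_add"
  assumes "A \<in> sets borel"
  shows "translate A x \<in> sets borel"
proof -
  have "(\<lambda>y. y - x) \<in> borel_measurable borel"
    by (intro borel_measurable_continuous_onI continuous_intros)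
  moreover have "translate A x = (\<lambda>y. y - x) -` A \<inter> space borel" by auto
  ultimately show ?thesis using assms measurable_sets by metis
qed

text \<open>The map \<open>f\<close> serves twice: the image of coin tossing under it witnesses
  Haar-nullness, and \<open>f\<close> itself witnesses Haar-meagerness. A preimage of a translate
  that is not small would contain a point with infinitely many surviving flips of zeros, against
  \<open>fin\<close>.\<close>

lemma haar_null_haar_meager_flip:
  fixes f :: "cantor \<Rightarrow> 'a::polish_vector_space"
  assumes A: "A \<in> sets borel" and f: "continuous_on UNIV f"
    and fin: "\<And>x a. f a - x \<in> A \<Longrightarrow> \<forall>\<^sub>\<infinity>n. \<not> a n \<longrightarrow> f (flip n a) - x \<notin> A"
  shows "haar_null A" "haar_meager A"
proof -
  have fm: "f \<in> borel_measurable borel" by (rule borel_measurable_continuous_onI[OF f])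
  have E: "f -` translate A x \<in> sets borel" for x
    using measurable_sets[OF fm translate_borel[OF A]] by simp
  have no: "\<not> (\<exists>\<^sub>\<infinity>n. \<not> a n \<and> flip n a \<in> f -` translate A x)" if "a \<in> f -` translate A x" for a x
    using fin[of a x] that by (auto simp: not_INFM elim: MOST_mono)
  have "emeasure coin (f -` translate A x) = 0" for x
    using nonnull_flip[OF E[of x]] no by blast
  moreover have fm': "f \<in> measurable coin borel" 
    using fm measurable_cong_sets[OF sets_coin refl] by blast
  ultimately have "emeasure (distr coin borel f) (translate A x) = 0" for x
    using emeasure_distr[OF fm' translate_borel[OF A]] by simp
  moreover have "prob_space (distr coin borel f)"
    using fm' by (rule coin.prob_space_distr)
  ultimately show "haar_null A" unfolding haar_null_def using A
    by (metis sets_distr)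
  have "meager (f -` translate A x)" for x
    using nonmeager_flip[OF E[of x]] no by blast
  then show "haar_meager A" unfolding haar_meager_def using A f by blast
qed

text \<open>A point and its flip agree off one coordinate, so a thin set never contains both: not
  even one flip survives.\<close>

lemma borel_haar_thin:
  assumes "A \<in> sets borel" "haar_thin A"
  shows "haar_null A" "haar_meager A"
proof -
  obtain f :: "cantor \<Rightarrow> 'a" where f: "continuous_on UNIV f" "\<And>x. thin (f -` translate A x)"
    using assms(2) unfolding haar_thin_def by blast
  have "f (flip n a) - x \<notin> A" if "f a - x \<in> A" for x a n
  proof
    assume "f (flip n a) - x \<in> A"
    moreover have "inj_on (\<lambda>x. restrict x (UNIV - {n})) (f -` translate A x)"
      using f(2) unfolding thin_def by blast
    moreover have "restrict (flip n a) (UNIV - {n}) = restrict a (UNIV - {n})"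
      by (auto simp: flip_def restrict_def)
    ultimately have "flip n a = a" using that by (auto dest: inj_onD)
    then have "flip n a n = a n" by simp
    then show False by (simp add: flip_def)
  qed
  then show "haar_null A" "haar_meager A"
    by (auto intro!: haar_null_haar_meager_flip[OF assms(1) f(1)] eventuallyI)
qed

definition subset_sum :: "(nat \<Rightarrow> 'i \<Rightarrow> real) \<Rightarrow> cantor \<Rightarrow> 'i \<Rightarrow> real" where
  "subset_sum x a i = (\<Sum>n. of_bool (a n) * x n i)"

lemma continuous_cantor_sum:
  fixes x :: "nat \<Rightarrow> real"
  assumes "summable (\<lambda>n. \<bar>x n\<bar>)"
  shows "continuous_on UNIV (\<lambda>a::cantor. \<Sum>n. of_bool (a n) * x n)"
proof -
  have "uniform_limit UNIV (\<lambda>n (a::cantor). \<Sum>k<n. of_bool (a k) * x k)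
      (\<lambda>a. \<Sum>n. of_bool (a n) * x n) sequentially"
    by (rule Weierstrass_m_test[OF _ assms]) auto
  moreover have "continuous_on UNIV (\<lambda>a::cantor. \<Sum>k<n. of_bool (a k) * x k)" for n
  proof (intro continuous_on_sum continuous_on_mult continuous_on_const)
    show "continuous_on UNIV (\<lambda>a::cantor. of_bool (a k) :: real)" for k
      by (rule continuous_on_compose2[of UNIV "of_bool :: bool \<Rightarrow> real" UNIV "\<lambda>a. a k"])
        (auto simp: continuous_on_discrete)
  qed
  ultimately show ?thesis
    by (intro uniform_limit_theorem[OF always_eventually]) auto
qed

lemma continuous_subset_sum:
  assumes "\<And>i. summable (\<lambda>n. \<bar>x n i\<bar>)"
  shows "continuous_on UNIV (subset_sum x)"
  by (rule continuous_on_coordinatewise_then_product)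
    (use continuous_cantor_sum assms in \<open>simp add: subset_sum_def\<close>)

lemma subset_sum_flip:
  assumes "\<And>i. summable (\<lambda>n. \<bar>x n i\<bar>)" "\<not> a n"
  shows "subset_sum x (flip n a) = subset_sum x a + x n"
proof
  fix i
  have "summable (\<lambda>k. of_bool (a k) * x k i)"
    by (rule summable_comparison_test'[OF assms(1)[of i], of 0]) auto
  moreover have "(\<lambda>k. if k = n then x k i else 0) sums x n i" by (rule sums_single)
  moreover have "(\<lambda>k. of_bool (flip n a k) * x k i) =
      (\<lambda>k. of_bool (a k) * x k i + (if k = n then x k i else 0))"
    using assms(2) by (auto simp: flip_def)
  ultimately show "subset_sum x (flip n a) i = (subset_sum x a + x n) i"
    by (simp add: subset_sum_def suminf_add[symmetric] sums_iff)
qed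

text \<open>A neighbourhood of 0 in the product topology restricts only finitely many coordinates,
  so the \<open>n\<close>-th term is controlled only at coordinates with code at most
  \<open>n\<close>. Every fixed coordinate is still eventually dominated by a geometric
  series.\<close>

definition rapid :: "(nat \<Rightarrow> 'i::countable \<Rightarrow> real) \<Rightarrow> bool" where
  "rapid x \<longleftrightarrow> (\<forall>n i. to_nat i \<le> n \<longrightarrow> \<bar>x n i\<bar> \<le> (1/2)^n)"

lemma rapid_summable: "rapid x \<Longrightarrow> summable (\<lambda>n. \<bar>x n i\<bar>)"
  by (rule summable_comparison_test'[OF summable_geometric[of "1/2"], of "to_nat i"])
    (auto simp: rapid_def)

lemma rapid_tendsto_0:
  assumes "rapid x"
  shows "x \<longlonglongrightarrow> 0"
  unfolding tendsto_fun_componentwise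
proof
  fix i
  show "(\<lambda>n. x n i) \<longlonglongrightarrow> 0 i"
    using summable_LIMSEQ_zero[OF rapid_summable[OF assms, of i]] by (simp add: tendsto_rabs_zero_iff)
qed

definition small_cube :: "nat \<Rightarrow> ('i::countable \<Rightarrow> real) set" where
  "small_cube n = {x. \<forall>i. to_nat i \<le> n \<longrightarrow> \<bar>x i\<bar> < (1/2)^n}"

lemma finite_to_nat_le: "finite {i::'i::countable. to_nat i \<le> n}"
  using finite_vimageI[OF finite_atMost[of n] inj_to_nat[where 'a='i]] by (simp add: vimage_def)

lemma open_small_cube: "open (small_cube n)"
proof -
  have "small_cube n = (\<Inter>i\<in>{i::'a. to_nat i \<le> n}. {x. x i \<in> {y. \<bar>y\<bar> < (1/2)^n}})"
    by (auto simp: small_cube_def)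
  also have "open \<dots>"
  proof (intro open_INT ballI open_coordinate finite_to_nat_le)
    show "open {y::real. \<bar>y\<bar> < (1/2)^n}" by (intro open_Collect_less continuous_intros)
  qed
  finally show ?thesis .
qed

lemma zero_in_small_cube: "0 \<in> small_cube n"
  by (simp add: small_cube_def)

lemma rapid_small_cube: "(\<And>n. x n \<in> small_cube n) \<Longrightarrow> rapid x"
  unfolding rapid_def small_cube_def by (auto intro: less_imp_le)

lemma rapid_subsequence:
  fixes s :: "nat \<Rightarrow> 'i::countable \<Rightarrow> real"
  assumes "s \<longlonglongrightarrow> 0"
  obtains r where "strict_mono r" "rapid (s \<circ> r)"
proof -
  have ev: "\<exists>k>m. s k \<in> small_cube n" for n m
  proof -
    have "\<forall>\<^sub>F k in sequentially. s k \<in> small_cube n"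
      by (rule topological_tendstoD[OF assms open_small_cube zero_in_small_cube])
    then have "\<forall>\<^sub>F k in sequentially. s k \<in> small_cube n \<and> k > m"
      by (intro eventually_conj eventually_gt_at_top)
    then show ?thesis using eventually_happens by fastforce
  qed
  have "\<exists>r. \<forall>n. s (r n) \<in> small_cube n \<and> r n < r (Suc n)"
  proof (rule dependent_nat_choice)
    show "\<exists>x. s x \<in> small_cube 0" using ev by blast
    show "\<exists>y. s y \<in> small_cube (Suc n) \<and> x < y" for x n using ev by blast
  qed
  then obtain r where "\<forall>n. s (r n) \<in> small_cube n \<and> r n < r (Suc n)" by blast
  then have "strict_mono r" "rapid (s \<circ> r)"
    by (auto intro!: rapid_small_cube simp: strict_mono_Suc_iff)
  then show ?thesis by (rule that)
qed

text \<open>Flipping a zero at \<open>n\<close> shifts the subset sum by \<open>s (r n)\<close>, so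
  null-finiteness leaves, for a fixed translate, only finitely many flips that stay in
  \<open>A\<close>.\<close>

lemma borel_null_finite:
  fixes A :: "('i::countable \<Rightarrow> real) set"
  assumes "A \<in> sets borel" "null_finite A"
  shows "haar_null A" "haar_meager A"
proof -
  obtain s where s: "s \<longlonglongrightarrow> 0" "\<And>x. finite {k. s k + x \<in> A}"
    using assms(2) unfolding null_finite_def by blast
  obtain r where r: "strict_mono r" "rapid (s \<circ> r)" using rapid_subsequence[OF s(1)] .
  let ?f = "subset_sum (s \<circ> r)"
  have sm: "summable (\<lambda>n. \<bar>(s \<circ> r) n i\<bar>)" for i by (rule rapid_summable[OF r(2)])
  have cf: "continuous_on UNIV ?f" by (rule continuous_subset_sum) (rule sm)
  have "\<forall>\<^sub>\<infinity>n. \<not> a n \<longrightarrow> ?f (flip n a) - x \<notin> A" for a x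
  proof -
    have "finite (r -` {k. s k + (?f a - x) \<in> A})"
      by (rule finite_vimageI[OF s(2)]) (use r(1) in \<open>rule strict_mono_imp_inj_on\<close>)
    then have "finite {n. \<not> (\<not> a n \<longrightarrow> ?f (flip n a) - x \<notin> A)}"
      by (rule rev_finite_subset) (auto simp: subset_sum_flip[of "s \<circ> r", OF sm] algebra_simps)
    then show ?thesis by (simp add: MOST_iff_cofinite)
  qed
  then show "haar_null A" "haar_meager A"
    by (auto intro!: haar_null_haar_meager_flip[OF assms(1) cf])
qed

text \<open>Otherwise some null sequence avoids the difference set. Along the subset sums of a rapid
  subsequence, no flip of a zero can then remain in the same translate of \<open>A\<close>, and
  \<open>A\<close> would be Haar-null.\<close>

lemma not_haar_null_differences:
  fixes A :: "('i::countable \<Rightarrow> real) set"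
  assumes "A \<in> sets borel" "\<not> haar_null A"
  shows "0 \<in> interior {b - a |a b. a \<in> A \<and> b \<in> A}"
proof (rule ccontr)
  let ?D = "{b - a |a b. a \<in> A \<and> b \<in> A}"
  assume "0 \<notin> interior ?D"
  then have "0 \<in> closure (- ?D)" by (simp add: closure_complement)
  then obtain s where s: "\<And>n. s n \<notin> ?D" "s \<longlonglongrightarrow> 0" unfolding closure_sequential by auto
  obtain r where r: "strict_mono r" "rapid (s \<circ> r)" using rapid_subsequence[OF s(2)] .
  let ?f = "subset_sum (s \<circ> r)"
  have sm: "summable (\<lambda>n. \<bar>(s \<circ> r) n i\<bar>)" for i by (rule rapid_summable[OF r(2)])
  have cf: "continuous_on UNIV ?f" by (rule continuous_subset_sum) (rule sm)
  have "?f (flip n a) - x \<notin> A" if "?f a - x \<in> A" "\<not> a n" for a x n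
  proof
    assume "?f (flip n a) - x \<in> A"
    moreover have "(?f (flip n a) - x) - (?f a - x) = s (r n)"
      using that(2) by (simp add: subset_sum_flip[of "s \<circ> r", OF sm])
    ultimately show False using s(1)[of "r n"] that(1) by (metis (mono_tags, lifting) mem_Collect_eq)
  qed
  then have "haar_null A"
    by (auto intro!: haar_null_haar_meager_flip[OF assms(1) cf] eventuallyI)
  then show False using assms(2) by simp
qed


subsection \<open>Mid-convex functions\<close>

lemma continuous_on_scaleR_polish:
  fixes g :: "'c::topological_space \<Rightarrow> 'a::polish_vector_space"
  assumes "continuous_on S g"
  shows "continuous_on S (\<lambda>x. c *\<^sub>R g x)"
  unfolding continuous_on_def
proof
  fix x assume "x \<in> S"
  then have "(g \<longlongrightarrow> g x) (at x within S)" using assms unfolding continuous_on_def by blast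
  then show "((\<lambda>x. c *\<^sub>R g x) \<longlongrightarrow> c *\<^sub>R g x) (at x within S)"
    by (rule tendsto_scaleR_polish[OF tendsto_const])
qed

lemma mid_convex_on_dyadic:
  assumes f: "mid_convex_on D f" and D: "convex D" and "a \<in> D" "b \<in> D"
  shows "f ((1 - (1/2)^k) *\<^sub>R a + (1/2)^k *\<^sub>R b) \<le> (1 - (1/2)^k) * f a + (1/2)^k * f b"
proof (induction k)
  case (Suc k)
  let ?c = "(1 - (1/2)^k) *\<^sub>R a + (1/2)^k *\<^sub>R b"
  have "?c \<in> D"
    by (rule convexD[OF D assms(3,4)]) (auto simp: power_le_one)
  then have "f ((1/2) *\<^sub>R (a + ?c)) \<le> (f a + f ?c) / 2"
    using f assms(3) unfolding mid_convex_on_def by blast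
  also have "\<dots> \<le> (1 - (1/2)^Suc k) * f a + (1/2)^Suc k * f b"
    using Suc by (simp add: field_simps)
  also have "(1/2) *\<^sub>R (a + ?c) = ((1/2) + (1/2) * (1 - (1/2)^k)) *\<^sub>R a + (1/2 * (1/2)^k) *\<^sub>R b"
    by (simp only: scaleR_add_right scaleR_add_left scaleR_scaleR add.assoc)
  also have "(1/2) + (1/2) * (1 - (1/2::real)^k) = 1 - (1/2)^Suc k" by (simp add: field_simps)
  finally show ?case by simp
qed simp

text \<open>The point \<open>y\<close> is a dyadic convex combination of \<open>w\<close> and a
  point of \<open>D\<close> slightly beyond \<open>y\<close>. Moving \<open>w\<close> within
  \<open>W\<close> sweeps out a neighbourhood of \<open>y\<close>, on which the dyadic inequality
  bounds \<open>f\<close>.\<close>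

lemma mid_convex_on_locally_bdd:
  fixes D :: "'a::polish_vector_space set"
  assumes f: "mid_convex_on D f" and D: "convex D" "open D"
    and W: "open W" "W \<noteq> {}" "W \<subseteq> D" "\<And>x. x \<in> W \<Longrightarrow> f x \<le> N" and y: "y \<in> D"
  obtains V N' where "open V" "0 \<in> V" "\<And>v. v \<in> V \<Longrightarrow> y + v \<in> D \<and> f (y + v) \<le> N'"
proof -
  obtain w where w: "w \<in> W" using W(2) by blast
  \<comment> \<open>\<open>z k\<close> solves
    \<open>y = (1 - (1/2)^k) *\<^sub>R z k + (1/2)^k *\<^sub>R w\<close>. It tends to
    \<open>y\<close>, so it lies in the open set \<open>D\<close> for large
    \<open>k\<close>.\<close>
  define z where "z k = y + ((1/2)^k / (1 - (1/2)^k)) *\<^sub>R (y - w)" for k :: nat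
  have "(\<lambda>k::nat. (1/2)^k / (1 - (1/2)^k) :: real) \<longlonglongrightarrow> 0 / (1 - 0)"
    by (intro tendsto_intros LIMSEQ_power_zero) auto
  then have "z \<longlonglongrightarrow> y + 0 *\<^sub>R (y - w)"
    unfolding z_def by (intro tendsto_add tendsto_const tendsto_scaleR_polish) simp
  then have "\<forall>\<^sub>F k in sequentially. z k \<in> D"
    using topological_tendstoD[OF _ D(2)] y by simp
  then have "\<forall>\<^sub>F k in sequentially. z k \<in> D \<and> k > 0"
    by (intro eventually_conj eventually_gt_at_top)
  then obtain k where k: "z k \<in> D" "k > 0" using eventually_happens by fastforce
  let ?e = "(1/2)^k :: real"
  have e: "0 < ?e" "?e < 1" using k(2) by (auto simp: power_less_one_iff)
  define V where "V = {v. w + (2^k) *\<^sub>R v \<in> W}"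
  have yv: "y + v = (1 - ?e) *\<^sub>R z k + ?e *\<^sub>R (w + (2^k) *\<^sub>R v)" for v
  proof -
    have "(1 - ?e) *\<^sub>R z k = (1 - ?e) *\<^sub>R y + ?e *\<^sub>R (y - w)"
      using e by (simp add: z_def scaleR_add_right)
    then show ?thesis
      by (simp add: algebra_simps power_one_over)
  qed
  show ?thesis
  proof (rule that[of V "(1 - ?e) * f (z k) + ?e * N"])
    have "open ((\<lambda>v. w + (2^k) *\<^sub>R v) -` W)"
      by (intro open_vimage W(1) continuous_on_add continuous_on_const
          continuous_on_scaleR_polish continuous_on_id)
    then show "open V" by (simp add: V_def vimage_def)
    show "0 \<in> V" using w by (simp add: V_def)
    fix v assume "v \<in> V"
    then have v: "w + (2^k) *\<^sub>R v \<in> W" by (simp add: V_def)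
    then have "w + (2^k) *\<^sub>R v \<in> D" using W(3) by blast
    then have "y + v \<in> D" "f (y + v) \<le> (1 - ?e) * f (z k) + ?e * f (w + (2^k) *\<^sub>R v)"
      unfolding yv using e by (auto intro!: convexD[OF D(1) k(1)] mid_convex_on_dyadic[OF f D(1) k(1)])
    moreover have "?e * f (w + (2^k) *\<^sub>R v) \<le> ?e * N"
      using W(4)[OF v] e by (simp add: mult_left_mono)
    ultimately show "y + v \<in> D \<and> f (y + v) \<le> (1 - ?e) * f (z k) + ?e * N" by linarith
  qed
qed

text \<open>The bound on \<open>W\<close> yields a bound \<open>N'\<close> near \<open>y\<close>.
  Contracting by \<open>(1/2)^k\<close> leaves an excess over \<open>f y\<close> of at most
  \<open>(1/2)^k * (N' - f y)\<close>, and mid-convexity applied to \<open>y + h\<close> and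
  \<open>y - h\<close> turns this upper estimate into a lower one.\<close>

theorem Bernstein_Doetsch:
  fixes D :: "'a::polish_vector_space set"
  assumes f: "mid_convex_on D f" and D: "convex D" "open D"
    and W: "open W" "W \<noteq> {}" "W \<subseteq> D" "\<And>x. x \<in> W \<Longrightarrow> f x \<le> N"
  shows "continuous_on D f"
proof (rule continuous_at_imp_continuous_on, rule ballI)
  fix y assume y: "y \<in> D"
  obtain V N' where V: "open V" "0 \<in> V" "\<And>v. v \<in> V \<Longrightarrow> y + v \<in> D \<and> f (y + v) \<le> N'"
    using mid_convex_on_locally_bdd[OF f D W y] by metis
  show "isCont f y"
    unfolding continuous_at
  proof (rule tendstoI)
    fix e :: real assume "e > 0"
    have "(\<lambda>k. (1/2)^k * (N' - f y)) \<longlonglongrightarrow> 0 * (N' - f y)"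
      by (intro tendsto_intros LIMSEQ_power_zero) auto
    then have "\<forall>\<^sub>F k in sequentially. (1/2)^k * (N' - f y) < e"
      using \<open>e > 0\<close> by (simp add: order_tendstoD)
    then obtain k where k: "(1/2)^k * (N' - f y) < e" using eventually_happens by fastforce
    let ?e = "(1/2)^k :: real"
    \<comment> \<open>The lower estimate at \<open>x\<close> uses the upper estimate at its mirror
      image in \<open>y\<close>, so both displacements must be admissible.\<close>
    define S where "S = (\<lambda>x. (2^k) *\<^sub>R (x - y)) -` V \<inter> (\<lambda>x. (2^k) *\<^sub>R (y - x)) -` V"
    have "open S" unfolding S_def
      by (intro open_Int open_vimage V(1) continuous_on_diff continuous_on_const
          continuous_on_scaleR_polish continuous_on_id)
    moreover have "y \<in> S" using V(2) by (simp add: S_def)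
    moreover have "dist (f x) (f y) < e" if "x \<in> S" for x
    proof -
      have up: "f (y + h) - f y \<le> ?e * (N' - f y)" "y + h \<in> D" if "(2^k) *\<^sub>R h \<in> V" for h
      proof -
        have *: "y + h = (1 - ?e) *\<^sub>R y + ?e *\<^sub>R (y + (2^k) *\<^sub>R h)"
          by (simp add: algebra_simps power_one_over)
        have "f (y + h) \<le> (1 - ?e) * f y + ?e * f (y + (2^k) *\<^sub>R h)"
          unfolding * by (rule mid_convex_on_dyadic[OF f D(1) y]) (use V(3)[OF that] in auto)
        moreover have "?e * f (y + (2^k) *\<^sub>R h) \<le> ?e * N'"
          using V(3)[OF that] by (simp add: mult_left_mono)
        ultimately have "f (y + h) \<le> (1 - ?e) * f y + ?e * N'" by linarith
        also have "\<dots> = f y + ?e * (N' - f y)" by (simp add: algebra_simps)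
        finally show "f (y + h) - f y \<le> ?e * (N' - f y)" by simp
        show "y + h \<in> D" unfolding *
          by (rule convexD[OF D(1) y]) (use V(3)[OF that] in \<open>auto simp: power_le_one\<close>)
      qed
      let ?h = "x - y"
      have "(2^k) *\<^sub>R ?h \<in> V" "(2^k) *\<^sub>R (- ?h) \<in> V" using that by (auto simp: S_def)
      note u = up[OF this(1)] up[OF this(2)]
      have "f ((1/2) *\<^sub>R ((y + ?h) + (y + - ?h))) \<le> (f (y + ?h) + f (y + - ?h)) / 2"
        using f u(2,4) unfolding mid_convex_on_def by blast
      moreover have "(1/2) *\<^sub>R ((y + ?h) + (y + - ?h)) = y"
      proof -
        have "(y + ?h) + (y + - ?h) = 2 *\<^sub>R y" by (simp add: scaleR_2)
        then show ?thesis by simp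
      qed
      ultimately show ?thesis using u(1,3) k by (simp add: dist_real_def abs_less_iff)
    qed
    ultimately show "\<forall>\<^sub>F x in at y. dist (f x) (f y) < e"
      unfolding eventually_at_topological by blast
  qed
qed

subsection \<open>Additive functions\<close>

lemma additive_half:
  assumes "Modules.additive (f :: 'a::real_vector \<Rightarrow> real)"
  shows "f ((1/2) *\<^sub>R x) = f x / 2"
proof -
  have "f ((1/2) *\<^sub>R x + (1/2) *\<^sub>R x) = f ((1/2) *\<^sub>R x) + f ((1/2) *\<^sub>R x)"
    by (rule additive.add[OF assms])
  then show ?thesis by (simp add: scaleR_add_left[symmetric])
qed

lemma additive_mid_convex: "Modules.additive f \<Longrightarrow> mid_convex_on D f"
  unfolding mid_convex_on_def by (simp add: additive_half additive.add add_divide_distrib)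

lemma additive_bdd_above_continuous:
  fixes f :: "'a::polish_vector_space \<Rightarrow> real"
  assumes "Modules.additive f" "open W" "W \<noteq> {}" "\<And>x. x \<in> W \<Longrightarrow> f x \<le> N"
  shows "continuous_on UNIV f"
  by (rule Bernstein_Doetsch[OF additive_mid_convex[OF assms(1)] convex_UNIV open_UNIV assms(2,3) subset_UNIV])
    (use assms(4) in auto)

text \<open>By Bernstein--Doetsch a discontinuous additive function is unbounded above on every
  nonempty open set, in particular on each small cube.\<close>

lemma discontinuous_additive_rapid:
  fixes f :: "('i::countable \<Rightarrow> real) \<Rightarrow> real"
  assumes "Modules.additive f" "\<not> continuous_on UNIV f"
  obtains x where "rapid x" "\<And>n. f (x n) > c n"
proof -
  have "\<exists>x\<in>small_cube n. f x > c n" for n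
    using additive_bdd_above_continuous[OF assms(1) open_small_cube[of n], of "c n"] assms(2)
      zero_in_small_cube by (metis empty_iff not_le)
  then obtain x where "\<And>n. x n \<in> small_cube n" "\<And>n. f (x n) > c n" by metis
  then show ?thesis using that rapid_small_cube by blast
qed

text \<open>Two points of the cube that differ only at \<open>k\<close> have subset sums differing
  by \<open>x k\<close>, where \<open>f\<close> exceeds \<open>2 * M\<close>, the largest possible
  spread of \<open>f\<close> on \<open>A\<close>. Hence no translate of \<open>A\<close> receives
  both.\<close>

lemma not_haar_thin_class_C:
  fixes A :: "('i::countable \<Rightarrow> real) set"
  assumes "\<not> haar_thin A"
  shows "A \<in> class_C"
proof -
  have False if f: "Modules.additive f" "bounded (f ` A)" "\<not> continuous_on UNIV f"
    for f :: "('i \<Rightarrow> real) \<Rightarrow> real"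
  proof -
    obtain M where M: "\<And>a. a \<in> A \<Longrightarrow> \<bar>f a\<bar> \<le> M" using f(2) unfolding bounded_iff by auto
    obtain x where x: "rapid x" "\<And>n. f (x n) > 2 * M"
      using discontinuous_additive_rapid[OF f(1,3), of "\<lambda>_. 2 * M"] by blast
    let ?g = "subset_sum x"
    have flip: False if "?g a - y \<in> A" "?g (flip k a) - y \<in> A" "\<not> a k" for a k y
    proof -
      have "x k = (?g (flip k a) - y) - (?g a - y)"
        using that(3) by (simp add: subset_sum_flip[OF rapid_summable[OF x(1)]])
      then have "f (x k) = f (?g (flip k a) - y) - f (?g a - y)"
        by (simp only: additive.diff[OF f(1)])
      then show False using M[OF that(1)] M[OF that(2)] x(2)[of k] by linarith
    qed
    have "thin (?g -` translate A y)" for y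
      unfolding thin_def
    proof (intro allI inj_onI)
      fix k a b assume ab: "a \<in> ?g -` translate A y" "b \<in> ?g -` translate A y"
        and eq: "restrict a (UNIV - {k}) = restrict b (UNIV - {k})"
      have same: "a j = b j" if "j \<noteq> k" for j
        using fun_cong[OF eq, of j] that by simp
      show "a = b"
      proof (rule ccontr)
        assume "a \<noteq> b"
        then obtain j where "a j \<noteq> b j" by blast
        then have "a k \<noteq> b k" using same[of j] by metis
        \<comment> \<open>Either of the two points may be the one with the zero at \<open>k\<close>,
          so both directions are kept.\<close>
        then have "b = flip k a" "a = flip k b" using same by (auto simp: flip_def fun_eq_iff)
        then show False using flip[of a y k] flip[of b y k] ab \<open>a k \<noteq> b k\<close> by auto
      qed
    qed
    then have "haar_thin A" unfolding haar_thin_def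
      using continuous_subset_sum[of x, OF rapid_summable[OF x(1)]] by blast
    then show False using assms by blast
  qed
  then show ?thesis unfolding class_C_def by blast
qed

text \<open>Here the values \<open>f (x n)\<close> must tend to infinity and not merely exceed one
  bound, because the translation by \<open>y\<close> shifts \<open>f\<close> by an arbitrary
  constant.\<close>

lemma not_null_finite_class_B:
  fixes A :: "('i::countable \<Rightarrow> real) set"
  assumes "\<not> null_finite A"
  shows "A \<in> class_B"
proof -
  have False if f: "Modules.additive f" "bdd_above (f ` A)" "\<not> continuous_on UNIV f"
    for f :: "('i \<Rightarrow> real) \<Rightarrow> real"
  proof -
    obtain M where M: "\<And>a. a \<in> A \<Longrightarrow> f a \<le> M" using f(2) unfolding bdd_above_def by auto
    obtain x where x: "rapid x" "\<And>n. f (x n) > real n"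
      using discontinuous_additive_rapid[OF f(1,3), of real] by blast
    have "finite {k. x k + y \<in> A}" for y
    proof (rule finite_subset)
      show "{k. x k + y \<in> A} \<subseteq> {..nat \<lceil>M - f y\<rceil>}"
      proof
        fix k assume "k \<in> {k. x k + y \<in> A}"
        then have "f (x k) + f y \<le> M" using M[of "x k + y"] by (simp add: additive.add[OF f(1)])
        then have "real k \<le> M - f y" using x(2)[of k] by linarith
        then show "k \<in> {..nat \<lceil>M - f y\<rceil>}" by (simp add: le_nat_iff) linarith
      qed
    qed simp
    then show False using assms rapid_tendsto_0[OF x(1)] unfolding null_finite_def by blast
  qed
  then show ?thesis unfolding class_B_def by blast
qed

lemma class_B_subset_class_C: "class_B \<subseteq> class_C"
  by (auto simp: class_B_def class_C_def bounded_imp_bdd_above)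

lemma class_A_subset_class_B: "class_A \<subseteq> class_B"
proof
  fix A :: "'a set" assume "A \<in> class_A"
  then have "continuous_on UNIV f" if "Modules.additive f" "bdd_above (f ` A)" for f :: "'a \<Rightarrow> real"
    using that additive_mid_convex[OF that(1), of UNIV] by (simp add: class_A_def)
  then show "A \<in> class_B" unfolding class_B_def by blast
qed


subsection \<open>Additive supports\<close>

definition subadditive :: "('a::real_vector \<Rightarrow> real) \<Rightarrow> bool" where
  "subadditive p \<longleftrightarrow> (\<forall>x y. p (x + y) \<le> p x + p y)"

lemma subadditiveD: "subadditive p \<Longrightarrow> p (x + y) \<le> p x + p y"
  by (simp add: subadditive_def)

lemma subadditive_zero: "subadditive p \<Longrightarrow> 0 \<le> p 0"
  using subadditiveD[of p 0 0] by simp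

lemma subadditive_lower: "subadditive p \<Longrightarrow> - p (- x) \<le> p x"
  using subadditiveD[of p x "- x"] subadditive_zero[of p] by simp

lemma subadditive_multiple:
  assumes "subadditive q" "q 0 = 0"
  shows "q (real n *\<^sub>R x) \<le> real n * q x"
proof (induction n)
  case (Suc n)
  have "q (real (Suc n) *\<^sub>R x) = q (real n *\<^sub>R x + x)" by (simp add: algebra_simps)
  also have "\<dots> \<le> q (real n *\<^sub>R x) + q x" by (rule subadditiveD[OF assms(1)])
  finally show ?case using Suc by (simp add: algebra_simps)
qed (use assms in simp)

text \<open>Doubling fixes \<open>q\<close> on multiples by powers of 2. The lower bound comes from
  splitting \<open>2^n\<close> into \<open>n\<close> and \<open>2^n - n\<close> and spending the
  upper bound on the second part.\<close>

lemma subadditive_doubling_multiple: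
  assumes q: "subadditive q" and d: "\<And>x. q (2 *\<^sub>R x) = 2 * q x"
  shows "q (real n *\<^sub>R x) = real n * q x"
proof (rule antisym)
  have q0: "q 0 = 0" using d[of 0] by simp
  show "q (real n *\<^sub>R x) \<le> real n * q x" by (rule subadditive_multiple[OF q q0])
  have pow: "q ((2^k) *\<^sub>R x) = 2^k * q x" for k
  proof (induction k)
    case (Suc k)
    then show ?case using d[of "(2^k) *\<^sub>R x"] by simp
  qed simp
  have n: "n \<le> 2^n" by (simp add: less_imp_le)
  have "(2^n) *\<^sub>R x = real n *\<^sub>R x + real (2^n - n) *\<^sub>R x"
    using n by (simp add: of_nat_diff flip: scaleR_add_left)
  then have "2^n * q x \<le> q (real n *\<^sub>R x) + q (real (2^n - n) *\<^sub>R x)"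
    using subadditiveD[OF q] pow[of n] by metis
  also have "q (real (2^n - n) *\<^sub>R x) \<le> real (2^n - n) * q x"
    by (rule subadditive_multiple[OF q q0])
  finally show "real n * q x \<le> q (real n *\<^sub>R x)"
    using n by (simp add: of_nat_diff algebra_simps)
qed

text \<open>
  A minimal subadditive function below \<open>p\<close> is additive: minimality forces it to coincide with
  \<open>q (2 x) / 2\<close> and then with \<open>inf\<^sub>m (q (x + m y) - m q y)\<close>.
\<close>

lemma subadditive_dominates_additive:
  fixes p :: "'a::real_vector \<Rightarrow> real"
  assumes p: "subadditive p"
  obtains a where "Modules.additive a" "\<And>x. a x \<le> p x"
proof -
  let ?S = "{q. subadditive q \<and> q \<le> p}"
  \<comment> \<open>The order is reversed, so that the maximal element given by Zorn's lemma is a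
    minimal function.\<close>
  let ?R = "\<lambda>q r :: 'a \<Rightarrow> real. r \<le> q"
  \<comment> \<open>This bound depends on \<open>p\<close> alone and keeps pointwise infima along
    chains finite.\<close>
  have low: "- p (- x) \<le> q x" if "q \<in> ?S" for q x
    using subadditive_lower[of q x] that by (auto simp: le_fun_def intro: order_trans[of _ "- q (- x)"])
  have "\<exists>m\<in>?S. \<forall>q\<in>?S. ?R m q \<longrightarrow> q = m"
  proof (rule predicate_Zorn)
    show "partial_order_on ?S (relation_of ?R ?S)"
      by (rule partial_order_on_relation_ofI) auto
    fix C assume C: "C \<in> Chains (relation_of ?R ?S)"
    have CS: "C \<subseteq> ?S" using C by (auto simp: Chains_def relation_of_def)
    have ch: "q \<le> r \<or> r \<le> q" if "q \<in> C" "r \<in> C" for q r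
      using C that by (auto simp: Chains_def relation_of_def)
    show "\<exists>u\<in>?S. \<forall>q\<in>C. ?R q u"
    proof (cases "C = {}")
      case True
      then show ?thesis using p by (intro bexI[of _ p]) auto
    next
      case False
      define u where "u x = (INF q\<in>C. q x)" for x
      have bdd: "bdd_below ((\<lambda>q. q x) ` C)" for x
        by (rule bdd_belowI2[of _ "- p (- x)"]) (use CS low in blast)
      have uq: "u x \<le> q x" if "q \<in> C" for q x
        unfolding u_def by (rule cINF_lower[OF bdd that])
      have "u (x + y) \<le> u x + u y" for x y
      proof -
        have "u (x + y) - q x \<le> u y" if q: "q \<in> C" for q
          unfolding u_def[of y]
        proof (rule cINF_greatest[OF False])
          fix r assume r: "r \<in> C"
          \<comment> \<open>Members of a chain are comparable, so the smaller of \<open>q\<close>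
            and \<open>r\<close> serves both arguments and its own subadditivity suffices.\<close>
          obtain s where s: "s \<in> C" "s \<le> q" "s \<le> r" using ch[OF q r] q r by blast
          have "u (x + y) \<le> s (x + y)" by (rule uq[OF s(1)])
          also have "\<dots> \<le> s x + s y" using s(1) CS by (intro subadditiveD) auto
          also have "\<dots> \<le> q x + r y" using s(2,3) by (intro add_mono) (auto simp: le_fun_def)
          finally show "u (x + y) - q x \<le> r y" by simp
        qed
        then have "u (x + y) - u y \<le> q x" if "q \<in> C" for q using that by (simp add: algebra_simps)
        then have "u (x + y) - u y \<le> u x" unfolding u_def[of x] by (rule cINF_greatest[OF False])
        then show ?thesis by simp
      qed
      then have "subadditive u" by (simp add: subadditive_def)
      moreover have "u \<le> p"
      proof (rule le_funI)
        fix x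
        obtain q where "q \<in> C" using False by blast
        then show "u x \<le> p x" using uq[of q x] CS by (auto simp: le_fun_def intro: order_trans)
      qed
      ultimately show ?thesis using uq by (intro bexI[of _ u]) (auto simp: le_fun_def)
    qed
  qed
  then obtain q where q: "subadditive q" "q \<le> p"
    and min: "\<And>r. subadditive r \<Longrightarrow> r \<le> q \<Longrightarrow> r = q" using order_trans by blast
  have dbl: "q (2 *\<^sub>R x) = 2 * q x" for x
  proof -
    have "(\<lambda>x. q (2 *\<^sub>R x) / 2) = q"
    proof (rule min)
      show "subadditive (\<lambda>x. q (2 *\<^sub>R x) / 2)"
        unfolding subadditive_def using subadditiveD[OF q(1)]
        by (auto simp: scaleR_add_right simp flip: add_divide_distrib intro!: divide_right_mono)
      show "(\<lambda>x. q (2 *\<^sub>R x) / 2) \<le> q"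
        using subadditiveD[OF q(1)] by (auto simp: le_fun_def scaleR_2) (smt (verit) field_sum_of_halves)
    qed
    then have "q (2 *\<^sub>R x) / 2 = q x" by (rule fun_cong)
    then show ?thesis by simp
  qed
  note mult = subadditive_doubling_multiple[OF q(1) dbl]
  have "q x + q y \<le> q (x + y)" for x y
  proof -
    define r where "r x = (INF m. q (x + real m *\<^sub>R y) - real m * q y)" for x
    have lb: "- q (- x) \<le> q (x + real m *\<^sub>R y) - real m * q y" for x and m :: nat
      using subadditiveD[OF q(1), of "x + real m *\<^sub>R y" "- x"] mult[of m y] by simp
    have bdd: "bdd_below (range (\<lambda>m::nat. q (x + real m *\<^sub>R y) - real m * q y))" for x
      by (rule bdd_belowI2[OF lb])
    have rm: "r x \<le> q (x + real m *\<^sub>R y) - real m * q y" for x m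
      unfolding r_def by (rule cINF_lower[OF bdd UNIV_I])
    have "r = q"
    proof (rule min)
      have "r (x + z) \<le> r x + r z" for x z
      proof -
        have "r (x + z) - (q (x + real m *\<^sub>R y) - real m * q y) \<le> r z" for m
          unfolding r_def[of z]
        proof (rule cINF_greatest)
          fix n
          have "r (x + z) \<le> q (x + z + real (m + n) *\<^sub>R y) - real (m + n) * q y" by (rule rm)
          also have "x + z + real (m + n) *\<^sub>R y = (x + real m *\<^sub>R y) + (z + real n *\<^sub>R y)"
            by (simp add: algebra_simps)
          also have "q \<dots> - real (m + n) * q y \<le>
              q (x + real m *\<^sub>R y) + q (z + real n *\<^sub>R y) - real (m + n) * q y"
            using subadditiveD[OF q(1)] by (intro diff_right_mono)
          finally show "r (x + z) - (q (x + real m *\<^sub>R y) - real m * q y)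
              \<le> q (z + real n *\<^sub>R y) - real n * q y" by (simp add: algebra_simps)
        qed simp
        then have "r (x + z) - r z \<le> q (x + real m *\<^sub>R y) - real m * q y" for m
          by (metis add.commute diff_le_eq)
        then have "r (x + z) - r z \<le> r x" unfolding r_def[of x] by (intro cINF_greatest) auto
        then show ?thesis by simp
      qed
      then show "subadditive r" by (simp add: subadditive_def)
      show "r \<le> q" using rm[of _ 0] by (auto simp: le_fun_def)
    qed
    \<comment> \<open>The term \<open>m = 1\<close> of the infimum gives
      \<open>r x \<le> q (x + y) - q y\<close>, while \<open>r x = q x\<close>.\<close>
    then show ?thesis using rm[of x 1] by simp
  qed
  then have "q (x + y) = q x + q y" for x y using subadditiveD[OF q(1), of x y] by (simp add: antisym)
  then have "Modules.additive q" by unfold_locales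
  then show ?thesis using that[of q] q(2) by (simp add: le_fun_def)
qed

text \<open>The sublinear function dominating the support is the directional derivative along dyadic steps.\<close>

lemma mid_convex_additive_support:
  fixes D :: "'a::polish_vector_space set"
  assumes f: "mid_convex_on D f" and D: "convex D" "open D" and x: "x \<in> D"
  obtains a where "Modules.additive a" "\<And>v. x + v \<in> D \<Longrightarrow> a v \<le> f (x + v) - f x"
proof -
  define F where "F v k = 2^k * (f (x + ((1/2)^k) *\<^sub>R v) - f x)" for v and k :: nat
  have ev: "\<forall>\<^sub>F k in sequentially. x + ((1/2)^k) *\<^sub>R v \<in> D" for v
  proof -
    have "(\<lambda>k. x + ((1/2)^k) *\<^sub>R v) \<longlonglongrightarrow> x + 0 *\<^sub>R v"
      by (intro tendsto_add tendsto_const tendsto_scaleR_polish LIMSEQ_power_zero) auto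
    then show ?thesis using topological_tendstoD[OF _ D(2)] x by simp
  qed
  have half: "x + ((1/2)^Suc k) *\<^sub>R v = (1/2) *\<^sub>R (x + (x + ((1/2)^k) *\<^sub>R v))" for v k
  proof -
    have "(1/2) *\<^sub>R (x + (x + ((1/2)^k) *\<^sub>R v)) = (1/2) *\<^sub>R (2 *\<^sub>R x) + (1/2) *\<^sub>R ((1/2)^k) *\<^sub>R v"
      by (simp only: scaleR_add_right[symmetric] scaleR_2 add.assoc)
    then show ?thesis by simp
  qed
  \<comment> \<open>Mid-convexity between \<open>x\<close> and the current point makes the
    difference quotients decrease.\<close>
  have dec: "x + ((1/2)^Suc k) *\<^sub>R v \<in> D" "F v (Suc k) \<le> F v k"
    if "x + ((1/2)^k) *\<^sub>R v \<in> D" for v k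
  proof -
    let ?w = "x + ((1/2)^k) *\<^sub>R v"
    have "(1/2) *\<^sub>R x + (1/2) *\<^sub>R ?w \<in> D" by (rule convexD[OF D(1) x that]) auto
    then show "x + ((1/2)^Suc k) *\<^sub>R v \<in> D" unfolding half by (simp add: scaleR_add_right)
    have "f ((1/2) *\<^sub>R (x + ?w)) \<le> (f x + f ?w) / 2"
      using f x that unfolding mid_convex_on_def by blast
    then have "f (x + ((1/2)^Suc k) *\<^sub>R v) - f x \<le> (f ?w - f x) / 2"
      unfolding half by simp
    then have "2^Suc k * (f (x + ((1/2)^Suc k) *\<^sub>R v) - f x) \<le> 2^Suc k * ((f ?w - f x) / 2)"
      by (rule mult_left_mono) simp
    then show "F v (Suc k) \<le> F v k" by (simp add: F_def)
  qed
  have mono: "x + ((1/2)^(k + j)) *\<^sub>R v \<in> D \<and> F v (k + j) \<le> F v k"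
    if "x + ((1/2)^k) *\<^sub>R v \<in> D" for v k j
  proof (induction j)
    case (Suc j)
    then show ?case using dec[of "k + j" v] by (auto intro: order_trans)
  qed (use that in simp)
  \<comment> \<open>Mid-convexity across the midpoint \<open>x\<close> bounds the quotients of
    \<open>v\<close> below by the negated quotients of \<open>- v\<close>; this is what makes them
    converge.\<close>
  have nonneg: "0 \<le> F v k + F (- v) k"
    if "x + ((1/2)^k) *\<^sub>R v \<in> D" "x + ((1/2)^k) *\<^sub>R (- v) \<in> D" for v k
  proof -
    let ?w = "x + ((1/2)^k) *\<^sub>R v" and ?w' = "x + ((1/2)^k) *\<^sub>R (- v)"
    have "f ((1/2) *\<^sub>R (?w + ?w')) \<le> (f ?w + f ?w') / 2"
      using f that unfolding mid_convex_on_def by blast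
    moreover have "?w + ?w' = 2 *\<^sub>R x" by (simp add: scaleR_2)
    ultimately have "0 \<le> (f ?w - f x) + (f ?w' - f x)" by simp
    then have "0 \<le> 2^k * ((f ?w - f x) + (f ?w' - f x))" by (intro mult_nonneg_nonneg) auto
    then show ?thesis unfolding F_def distrib_left .
  qed
  have conv: "convergent (F v)" for v
  proof -
    obtain k where k: "x + ((1/2)^k) *\<^sub>R v \<in> D" "x + ((1/2)^k) *\<^sub>R (- v) \<in> D"
      using eventually_happens[OF eventually_conj[OF ev[of v] ev[of "- v"]]] by fastforce
    have "decseq (\<lambda>j. F v (k + j))"
      by (rule decseq_SucI) (use mono[OF k(1)] dec(2) in auto)
    moreover have "- F (- v) k \<le> F v (k + j)" for j
      using mono[OF k(1), of j] mono[OF k(2), of j] nonneg[of "k + j" v] by linarith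
    ultimately obtain L where "(\<lambda>j. F v (k + j)) \<longlonglongrightarrow> L" by (metis decseq_convergent)
    then show ?thesis using LIMSEQ_offset[of "F v" k L] by (auto simp: convergent_def add.commute)
  qed
  define p where "p v = lim (F v)" for v
  have lim: "F v \<longlonglongrightarrow> p v" for v
    unfolding p_def using conv by (simp add: convergent_LIMSEQ_iff)
  have "p (v + w) \<le> p v + p w" for v w
  \<comment> \<open>The left index is shifted because the midpoint of the stage \<open>k\<close>
    points for \<open>v\<close> and \<open>w\<close> is the stage \<open>Suc k\<close> point for
    \<open>v + w\<close>.\<close>
  proof (rule LIMSEQ_le[OF LIMSEQ_Suc[OF lim[of "v + w"]] tendsto_add[OF lim[of v] lim[of w]]])
    obtain K where K: "\<And>k. k \<ge> K \<Longrightarrow> x + ((1/2)^k) *\<^sub>R v \<in> D \<and> x + ((1/2)^k) *\<^sub>R w \<in> D"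
      using eventually_conj[OF ev[of v] ev[of w]] unfolding eventually_sequentially by blast
    have "F (v + w) (Suc k) \<le> F v k + F w k" if "k \<ge> K" for k
    proof -
      let ?v = "x + ((1/2)^k) *\<^sub>R v" and ?w = "x + ((1/2)^k) *\<^sub>R w"
      have le: "f ((1/2) *\<^sub>R (?v + ?w)) \<le> (f ?v + f ?w) / 2"
        using f K[OF that] unfolding mid_convex_on_def by blast
      have mid: "(1/2) *\<^sub>R (?v + ?w) = x + ((1/2)^Suc k) *\<^sub>R (v + w)"
      proof -
        have eq: "?v + ?w = 2 *\<^sub>R x + ((1/2)^k) *\<^sub>R (v + w)" by (simp add: scaleR_2 scaleR_add_right)
        show ?thesis unfolding eq scaleR_add_right[of "1/2"] by simp
      qed
      have "f (x + ((1/2)^Suc k) *\<^sub>R (v + w)) - f x \<le> ((f ?v - f x) + (f ?w - f x)) / 2"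
        using le unfolding mid by argo
      then have "2^Suc k * (f (x + ((1/2)^Suc k) *\<^sub>R (v + w)) - f x)
          \<le> 2^Suc k * (((f ?v - f x) + (f ?w - f x)) / 2)"
        by (rule mult_left_mono) simp
      also have "\<dots> = 2^k * ((f ?v - f x) + (f ?w - f x))" by simp
      finally show ?thesis unfolding F_def distrib_left .
    qed
    then show "\<exists>N. \<forall>n\<ge>N. F (v + w) (Suc n) \<le> F v n + F w n" by blast
  qed
  then have "subadditive p" by (simp add: subadditive_def)
  then obtain a where a: "Modules.additive a" "\<And>v. a v \<le> p v"
    using subadditive_dominates_additive by metis
  have "p v \<le> f (x + v) - f x" if "x + v \<in> D" for v
  proof (rule LIMSEQ_le_const2[OF lim])
    have "F v n \<le> F v 0" for n using mono[of 0 v n] that by simp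
    then show "\<exists>N. \<forall>n\<ge>N. F v n \<le> f (x + v) - f x" by (auto simp: F_def)
  qed
  then show ?thesis using that[OF a(1)] a(2) order_trans by blast
qed

lemma class_B_subset_class_A: "(class_B :: 'a::polish_vector_space set set) \<subseteq> class_A"
proof
  fix T :: "'a set" assume T: "T \<in> class_B"
  have "continuous_on D f"
    if D: "open D" "convex D" "T \<subseteq> D" and f: "mid_convex_on D f" "bdd_above (f ` T)" for D and f :: "'a \<Rightarrow> real"
  proof (cases "D = {}")
    case False
    obtain M where M: "\<And>t. t \<in> T \<Longrightarrow> f t \<le> M" using f(2) unfolding bdd_above_def by auto
    have "\<exists>a. continuous_on UNIV a \<and> a 0 = (0::real) \<and> (\<forall>y\<in>D. f x + a (y - x) \<le> f y)" if x: "x \<in> D" for x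
    proof -
      obtain a where a: "Modules.additive a" "\<And>v. x + v \<in> D \<Longrightarrow> a v \<le> f (x + v) - f x"
        using mid_convex_additive_support[OF f(1) D(2,1) x] by metis
      have sup: "f x + a (y - x) \<le> f y" if "y \<in> D" for y using a(2)[of "y - x"] that by simp
      \<comment> \<open>The bound of \<open>f\<close> on \<open>T\<close> passes to the support, so
        membership of \<open>T\<close> in \<open>class_B\<close> applies to
        \<open>a\<close>.\<close>
      have "a t \<le> M - f x + a x" if "t \<in> T" for t
        using sup[of t] M[OF that] D(3) that additive.diff[OF a(1), of t x] by fastforce
      then have "bdd_above (a ` T)" by (rule bdd_aboveI2)
      then have "continuous_on UNIV a" using T a(1) by (simp add: class_B_def)
      then show ?thesis using sup additive.zero[OF a(1)] by blast
    qed
    then obtain a where a: "\<And>x. x \<in> D \<Longrightarrow> continuous_on UNIV (a x)" "\<And>x. x \<in> D \<Longrightarrow> a x 0 = (0::real)"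
      "\<And>x y. x \<in> D \<Longrightarrow> y \<in> D \<Longrightarrow> f x + a x (y - x) \<le> f y" by metis
    \<comment> \<open>Within \<open>D\<close> this is the sublevel set of \<open>f\<close> at
      \<open>N\<close>. Written through the supports it is closed in the whole space.\<close>
    define C where "C N = (\<Inter>x\<in>D. {y. f x + a x (y - x) \<le> real N})" for N
    have clC: "closed (C N)" for N
      unfolding C_def
    proof (intro closed_INT ballI closed_Collect_le continuous_intros)
      fix x assume "x \<in> D"
      then show "continuous_on UNIV (\<lambda>y. a x (y - x))"
        by (intro continuous_on_compose2[OF a(1)] continuous_intros) auto
    qed
    have Cle: "f y \<le> real N" if "y \<in> C N" "y \<in> D" for y N
      using that a(2)[OF that(2)] unfolding C_def by auto
    have "y \<in> C (nat \<lceil>f y\<rceil>)" if "y \<in> D" for y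
      unfolding C_def using a(3)[OF _ that] by (auto intro: order_trans[OF _ real_nat_ceiling_ge])
    then have "D \<subseteq> (\<Union>N. D \<inter> C N)" by blast
    then have "\<exists>N. \<not> nowhere_dense (D \<inter> C N)"
      using nonmeager_open[OF D(1) False] meager_subset[OF meager_UN[of UNIV "\<lambda>N. D \<inter> C N"]]
        nowhere_dense_imp_meager by blast
    then obtain N where N: "interior (closure (D \<inter> C N)) \<noteq> {}" unfolding nowhere_dense_def by blast
    let ?W = "interior (closure (D \<inter> C N)) \<inter> D"
    have "interior (closure (D \<inter> C N)) \<inter> (D \<inter> C N) \<noteq> {}"
      using N interior_subset open_Int_closure_eq_empty[OF open_interior] by blast
    then have "?W \<noteq> {}" by blast
    moreover have "f x \<le> real N" if "x \<in> ?W" for x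
    proof -
      have "closure (D \<inter> C N) \<subseteq> C N" by (rule closure_minimal[OF _ clC]) blast
      then show ?thesis using that Cle interior_subset by blast
    qed
    ultimately show ?thesis
      using Bernstein_Doetsch[OF f(1) D(2,1), of ?W "real N"] D(1) by blast
  qed simp
  then show "T \<in> class_A" unfolding class_A_def by blast
qed


subsection \<open>Countable unions of Haar-null sets\<close>

lemma haar_null_empty: "haar_null ({} :: 'a::polish_vector_space set)"
  unfolding haar_null_def translate_def
  using prob_space_return[of "0::'a" borel] by (intro conjI exI[of _ "return borel 0"]) auto

text \<open>Countably many translates of the small cube cover the space, so \<open>\<mu>\<close>
  charges one of them; conditioning on it and translating it to 0 keeps every translate of
  \<open>A\<close> null. Witnesses this concentrated can be summed as a convergent series.\<close>

lemma haar_null_localized: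
  fixes A :: "('i::countable \<Rightarrow> real) set"
  assumes "haar_null A"
  obtains \<nu> where "prob_space \<nu>" "sets \<nu> = sets borel" "\<And>x. emeasure \<nu> (translate A x) = 0"
    "emeasure \<nu> (- small_cube n) = 0"
proof -
  obtain \<mu> where A: "A \<in> sets borel" and \<mu>: "prob_space \<mu>" "sets \<mu> = sets borel"
    "\<And>x. emeasure \<mu> (translate A x) = 0" using assms unfolding haar_null_def by blast
  interpret prob_space \<mu> by fact
  have sp: "space \<mu> = UNIV" using sets_eq_imp_space_eq[OF \<mu>(2)] by simp
  let ?U = "\<lambda>c :: 'i \<Rightarrow> real. (\<lambda>y. y - c) -` small_cube n"
  have oU: "open (?U c)" for c
    by (intro open_vimage open_small_cube continuous_intros)
  obtain \<U> where \<U>: "\<U> \<subseteq> range ?U" "countable \<U>" "\<Union>\<U> = \<Union>(range ?U)"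
    using Lindelof[of "range ?U"] oU by blast
  have "y \<in> ?U y" for y by (simp add: zero_in_small_cube)
  then have "\<Union>\<U> = UNIV" using \<U>(3) by blast
  then have "\<exists>V\<in>\<U>. emeasure \<mu> V \<noteq> 0"
  proof -
    have "emeasure \<mu> (\<Union>\<U>) = 0" if "\<And>V. V \<in> \<U> \<Longrightarrow> V \<in> null_sets \<mu>"
      using null_sets_UN'[OF \<U>(2), of "\<lambda>V. V"] that by auto
    moreover have "V \<in> null_sets \<mu>" if "V \<in> \<U>" "emeasure \<mu> V = 0" for V
      using that \<U>(1) oU \<mu>(2) by (intro null_setsI) auto
    ultimately show ?thesis using \<open>\<Union>\<U> = UNIV\<close> emeasure_space_1 sp by fastforce
  qed
  then obtain c where c: "emeasure \<mu> (?U c) \<noteq> 0" using \<U>(1) by blast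
  have Us: "?U c \<in> sets \<mu>" using oU \<mu>(2) by simp
  define \<nu> where "\<nu> = distr (uniform_measure \<mu> (?U c)) borel (\<lambda>y. y - c)"
  have "(\<lambda>y. y - c) \<in> borel_measurable borel"
    by (intro borel_measurable_continuous_onI continuous_intros)
  then have m: "(\<lambda>y. y - c) \<in> uniform_measure \<mu> (?U c) \<rightarrow>\<^sub>M borel"
    using \<mu>(2) by (simp cong: measurable_cong_sets)
  have em: "emeasure \<nu> S = emeasure \<mu> (?U c \<inter> (\<lambda>y. y - c) -` S) / emeasure \<mu> (?U c)"
    if "S \<in> sets borel" for S
  proof -
    have "(\<lambda>y. y - c) -` S \<in> sets \<mu>"
      using measurable_sets[OF m that] \<mu>(2) sp by simp
    then show ?thesis unfolding \<nu>_def
      by (subst emeasure_distr[OF m that]) (simp add: sp emeasure_uniform_measure[OF Us])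
  qed
  show ?thesis
  proof (rule that[of \<nu>])
    show "prob_space \<nu>" unfolding \<nu>_def
      by (intro prob_space.prob_space_distr[OF _ m] prob_space_uniform_measure c) simp
    show "sets \<nu> = sets borel" by (simp add: \<nu>_def)
    show "emeasure \<nu> (translate A x) = 0" for x
    proof -
      have "?U c \<inter> (\<lambda>y. y - c) -` translate A x \<subseteq> translate A (c + x)"
        by (auto simp: algebra_simps)
      moreover have "translate A (c + x) \<in> null_sets \<mu>"
        using \<mu>(2,3) translate_borel[OF A] by (intro null_setsI) auto
      ultimately have "emeasure \<mu> (?U c \<inter> (\<lambda>y. y - c) -` translate A x) = 0"
        by (metis emeasure_mono le_zero_eq null_setsD1 null_setsD2)
      then show ?thesis using em[OF translate_borel[OF A]] by simp
    qed
    have "?U c \<inter> (\<lambda>y. y - c) -` (- small_cube n) = {}" by auto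
    moreover have "- small_cube n \<in> sets (borel :: ('i \<Rightarrow> real) measure)"
      using open_small_cube by (intro borel_closed) (simp add: closed_def)
    ultimately show "emeasure \<nu> (- small_cube n) = 0" using em by simp
  qed
qed

text \<open>
  The witness is the law of a random series whose \<open>k\<close>-th term is a witness for \<open>A k\<close> concentrated
  near \<open>0\<close>. Freezing all terms but the \<open>k\<close>-th one shows that it charges no translate of \<open>A k\<close>.
\<close>

lemma haar_null_UN:
  fixes A :: "nat \<Rightarrow> ('i::countable \<Rightarrow> real) set"
  assumes A: "\<And>k. haar_null (A k)"
  shows "haar_null (\<Union>k. A k)"
proof -
  have "\<exists>\<nu>. prob_space \<nu> \<and> sets \<nu> = sets borel \<and> (\<forall>x. emeasure \<nu> (translate (A k) x) = 0)
    \<and> emeasure \<nu> (- small_cube k) = 0" for k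
    using haar_null_localized[OF A[of k], of k] by metis
  then obtain \<nu> where \<nu>: "\<And>k. prob_space (\<nu> k)" "\<And>k. sets (\<nu> k) = sets borel"
    "\<And>k x. emeasure (\<nu> k) (translate (A k) x) = 0" "\<And>k. emeasure (\<nu> k) (- small_cube k) = 0"
    by metis
  have sp [simp]: "space (\<nu> k) = UNIV" for k using sets_eq_imp_space_eq[OF \<nu>(2)] by simp
  have Ab: "A k \<in> sets borel" for k using A haar_null_def by blast
  \<comment> \<open>Truncation makes the series converge for every sample, not only almost surely.
    It alters nothing that \<open>\<nu> k\<close> charges.\<close>
  define c where "c k y = (if y \<in> small_cube k then y else 0)" for k and y :: "'i \<Rightarrow> real"
  have ccube: "c k y \<in> small_cube k" for k y by (simp add: c_def zero_in_small_cube)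
  have comp [measurable]: "(\<lambda>y. y i) \<in> borel_measurable borel" for i :: 'i
    by (intro borel_measurable_continuous_onI) simp
  have [measurable]: "(small_cube k :: ('i \<Rightarrow> real) set) \<in> sets borel" for k
    by (rule borel_open[OF open_small_cube])
  have cm [measurable]: "(\<lambda>y. c k y i) \<in> borel_measurable borel" for k i
    unfolding c_def by (simp add: if_distrib[of "\<lambda>f. f i"] cong: if_cong) measurable
  define S where "S w i = (\<Sum>k. c k (w k) i)" for w i
  have rap: "rapid (\<lambda>k. c k (w k))" for w by (rule rapid_small_cube) (rule ccube)
  have sm: "summable (\<lambda>k. c k (w k) i)" for w i
  proof -
    have "summable (\<lambda>k. \<bar>c k (w k) i\<bar>)" using rap[of w] by (rule rapid_summable)
    then show ?thesis by (rule summable_rabs_cancel)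
  qed
  define P where "P = PiM UNIV \<nu>"
  have pP: "prob_space P" unfolding P_def by (rule prob_space_PiM) (rule \<nu>(1))
  interpret P: prob_space P by (rule pP)
  have Sm: "S \<in> P \<rightarrow>\<^sub>M borel"
  proof (rule measurable_coordinatewise_then_product)
    fix i
    have "(\<lambda>w. c k (w k) i) \<in> borel_measurable P" for k
    proof -
      have "(\<lambda>w. w k) \<in> P \<rightarrow>\<^sub>M \<nu> k" unfolding P_def by (rule measurable_component_singleton) simp
      then have "(\<lambda>w. w k) \<in> P \<rightarrow>\<^sub>M borel" using measurable_cong_sets[OF refl \<nu>(2)] by blast
      then show ?thesis by (rule measurable_compose[OF _ cm])
    qed
    then show "(\<lambda>w. S w i) \<in> borel_measurable P"
      unfolding S_def by (rule borel_measurable_suminf)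
  qed
  have upd: "S (w(k := y)) = S (w(k := 0)) + c k y" for w k y
  proof
    fix i
    have "(\<lambda>j. if j = k then c k y i else 0) sums c k y i" by (rule sums_single)
    then have "(\<lambda>j. c j ((w(k := 0)) j) i + (if j = k then c k y i else 0)) sums (S (w(k := 0)) i + c k y i)"
      unfolding S_def by (intro sums_add summable_sums sm)
    moreover have "(\<lambda>j. c j ((w(k := 0)) j) i + (if j = k then c k y i else 0)) = (\<lambda>j. c j ((w(k := y)) j) i)"
      by (auto simp: c_def)
    ultimately show "S (w(k := y)) i = (S (w(k := 0)) + c k y) i"
      unfolding S_def by (simp add: sums_iff)
  qed
  have null: "emeasure P (S -` translate (A k) x) = 0" for k x
  proof -
    let ?Q = "PiM (UNIV - {k}) \<nu>"
    interpret nk: prob_space "\<nu> k" by (rule \<nu>(1))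
    interpret Q: prob_space ?Q by (rule prob_space_PiM) (rule \<nu>(1))
    interpret pr: pair_sigma_finite "\<nu> k" ?Q ..
    have PQ: "distr (\<nu> k \<Otimes>\<^sub>M ?Q) P (\<lambda>(y, w). w(k := y)) = P"
      using distr_pair_PiM_eq_PiM[of "UNIV - {k}" \<nu> k] \<nu>(1) by (simp add: P_def insert_UNIV)
    have mu: "(\<lambda>(y, w). w(k := y)) \<in> \<nu> k \<Otimes>\<^sub>M ?Q \<rightarrow>\<^sub>M P"
      unfolding P_def split_beta' by (rule measurable_fun_upd[of UNIV "UNIV - {k}"]) auto
    let ?T = "S -` translate (A k) x"
    have T: "?T \<in> sets P"
      using measurable_sets[OF Sm translate_borel[OF Ab]] by (simp add: P_def space_PiM)
    have T': "(\<lambda>(y, w). w(k := y)) -` ?T \<inter> space (\<nu> k \<Otimes>\<^sub>M ?Q) \<in> sets (\<nu> k \<Otimes>\<^sub>M ?Q)"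
      by (rule measurable_sets[OF mu T])
    have "emeasure P ?T = emeasure (\<nu> k \<Otimes>\<^sub>M ?Q) ((\<lambda>(y, w). w(k := y)) -` ?T \<inter> space (\<nu> k \<Otimes>\<^sub>M ?Q))"
      using emeasure_distr[OF mu T] PQ by simp
    also have "\<dots> = (\<integral>\<^sup>+ w. emeasure (\<nu> k) ((\<lambda>y. (y, w)) -` ((\<lambda>(y, w). w(k := y)) -` ?T \<inter> space (\<nu> k \<Otimes>\<^sub>M ?Q))) \<partial>?Q)"
      by (rule pr.emeasure_pair_measure_alt2[OF T'])
    also have "\<dots> = (\<integral>\<^sup>+ w. 0 \<partial>?Q)"
    proof (rule nn_integral_cong)
      fix w assume "w \<in> space ?Q"
      let ?B = "(\<lambda>y. (y, w)) -` ((\<lambda>(y, w). w(k := y)) -` ?T \<inter> space (\<nu> k \<Otimes>\<^sub>M ?Q))"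
      let ?z = "x - S (w(k := 0))"
      \<comment> \<open>The second set absorbs the points that \<open>c k\<close> truncates.\<close>
      have "?B \<subseteq> translate (A k) ?z \<union> - small_cube k"
      proof
        fix y assume "y \<in> ?B"
        then have "S (w(k := y)) - x \<in> A k" by simp
        then have "c k y - ?z \<in> A k" unfolding upd[of w k y] by (simp add: algebra_simps)
        then show "y \<in> translate (A k) ?z \<union> - small_cube k" by (auto simp: c_def split: if_splits)
      qed
      moreover have "translate (A k) ?z \<union> - small_cube k \<in> null_sets (\<nu> k)"
        using \<nu>(3,4) translate_borel[OF Ab] by (intro null_sets.Un null_setsI) (auto simp: \<nu>(2))
      ultimately show "emeasure (\<nu> k) ?B = 0"
        by (metis emeasure_mono le_zero_eq null_setsD1 null_setsD2)
    qed
    finally show ?thesis by simp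
  qed
  show ?thesis unfolding haar_null_def
  proof (intro conjI exI[of _ "distr P borel S"] allI)
    show "(\<Union>k. A k) \<in> sets borel" using Ab by auto
    show "prob_space (distr P borel S)" by (rule P.prob_space_distr[OF Sm])
    fix x
    have spP: "space P = UNIV" by (simp add: P_def space_PiM)
    have "S -` translate (\<Union>k. A k) x = (\<Union>k. S -` translate (A k) x)" by auto
    moreover have "(\<Union>k. S -` translate (A k) x) \<in> null_sets P"
      using null measurable_sets[OF Sm translate_borel[OF Ab]] spP by (intro null_sets_UN null_setsI) auto
    ultimately show "emeasure (distr P borel S) (translate (\<Union>k. A k) x) = 0"
      using emeasure_distr[OF Sm translate_borel[of "\<Union>k. A k" x]] Ab spP by auto
  qed simp
qed

lemma sigma_closed_HN_subset_HN: "(sigma_closed_HN :: ('i::countable \<Rightarrow> real) set set) \<subseteq> HN"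
proof
  fix A :: "('i \<Rightarrow> real) set" assume "A \<in> sigma_closed_HN"
  then obtain \<K> where \<K>: "countable \<K>" "\<And>K. K \<in> \<K> \<Longrightarrow> haar_null K" "A \<subseteq> \<Union>\<K>"
    unfolding sigma_closed_HN_def by blast
  \<comment> \<open>Inserting the empty set keeps the enumerated family nonempty.\<close>
  let ?K = "\<lambda>n. from_nat_into (insert {} \<K>) n"
  have "?K n \<in> insert {} \<K>" for n by (rule from_nat_into) simp
  moreover have "haar_null K" if "K \<in> insert {} \<K>" for K using that \<K>(2) haar_null_empty by auto
  ultimately have "haar_null (?K n)" for n by metis
  then have "haar_null (\<Union>n. ?K n)" by (rule haar_null_UN)
  moreover have "(\<Union>n. ?K n) = \<Union>\<K>"
    using range_from_nat_into[of "insert {} \<K>"] \<K>(1) by simp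
  ultimately show "A \<in> HN" unfolding HN_def using \<K>(3) by auto
qed


subsection \<open>Closed Haar-null sets are Haar-meager\<close>

text \<open>The parities of the floors of \<open>2 ^ Suc n * x\<close> are the binary digits, and
  the first \<open>n\<close> of them sum to the floor of \<open>2 ^ n * x\<close> divided by
  \<open>2 ^ n\<close>. The bound \<open>x < 1\<close> starts the induction.\<close>

lemma binary_expansion:
  fixes x :: real
  assumes "0 \<le> x" "x < 1"
  obtains a :: cantor where "(\<Sum>n. of_bool (a n) * (1/2) ^ Suc n) = x"
proof -
  define a :: cantor where "a n = odd \<lfloor>2 ^ Suc n * x\<rfloor>" for n
  have fl: "\<lfloor>2 ^ Suc n * x\<rfloor> = 2 * \<lfloor>2 ^ n * x\<rfloor> + of_bool (a n)" for n
  proof -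
    have "\<lfloor>2 ^ n * x\<rfloor> = \<lfloor>2 ^ Suc n * x\<rfloor> div 2"
      using floor_divide_real_eq_div[of 2 "2 ^ Suc n * x"] by simp
    moreover have "m = 2 * (m div 2) + of_bool (odd m)" for m :: int by (cases "even m") (auto elim: oddE)
    ultimately show ?thesis unfolding a_def by metis
  qed
  have ps: "(\<Sum>k<n. of_bool (a k) * (1/2) ^ Suc k) = real_of_int \<lfloor>2 ^ n * x\<rfloor> / 2 ^ n" for n
  proof (induction n)
    case 0
    then show ?case using assms by (simp add: floor_eq_iff)
  next
    case (Suc n)
    then show ?case unfolding fl by (simp add: field_simps)
  qed
  have "(\<lambda>n. real_of_int \<lfloor>2 ^ n * x\<rfloor> / 2 ^ n) \<longlonglongrightarrow> x"
  proof (rule tendsto_sandwich[OF _ _ _ tendsto_const])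
    show "\<forall>\<^sub>F n in sequentially. x - (1/2) ^ n \<le> real_of_int \<lfloor>2 ^ n * x\<rfloor> / 2 ^ n"
    proof (rule always_eventually, rule allI)
      fix n :: nat
      have "2 ^ n * x - 1 \<le> real_of_int \<lfloor>2 ^ n * x\<rfloor>" by linarith
      then have "(2 ^ n * x - 1) / 2 ^ n \<le> real_of_int \<lfloor>2 ^ n * x\<rfloor> / 2 ^ n"
        by (rule divide_right_mono) simp
      moreover have "(2 ^ n * x - 1) / 2 ^ n = x - (1/2) ^ n"
        by (simp add: diff_divide_distrib power_one_over)
      ultimately show "x - (1/2) ^ n \<le> real_of_int \<lfloor>2 ^ n * x\<rfloor> / 2 ^ n" by simp
    qed
    show "\<forall>\<^sub>F n in sequentially. real_of_int \<lfloor>2 ^ n * x\<rfloor> / 2 ^ n \<le> x"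
      by (rule always_eventually) (simp add: field_simps)
    have "(\<lambda>n. x - (1/2) ^ n) \<longlonglongrightarrow> x - 0"
      by (intro tendsto_intros LIMSEQ_power_zero) auto
    then show "(\<lambda>n. x - (1/2) ^ n) \<longlonglongrightarrow> x" by simp
  qed
  then have "(\<lambda>n. of_bool (a n) * (1/2) ^ Suc n) sums x"
    unfolding sums_def ps .
  then show ?thesis using that[of a] by (simp add: sums_iff)
qed

text \<open>\<open>prod_encode\<close> splits the bits into one sequence per coordinate; each is
  read as a binary expansion and stretched from the unit interval to the interval from
  \<open>- M i\<close> to \<open>M i\<close>.\<close>

lemma cantor_onto_cube:
  fixes M :: "'i::countable \<Rightarrow> real"
  assumes "\<And>i. 0 < M i"
  obtains \<psi> :: "cantor \<Rightarrow> 'i \<Rightarrow> real" where "continuous_on UNIV \<psi>" "{y. \<forall>i. \<bar>y i\<bar> < M i} \<subseteq> range \<psi>"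
proof -
  define \<beta> :: "cantor \<Rightarrow> real" where "\<beta> a = (\<Sum>n. of_bool (a n) * (1/2) ^ Suc n)" for a
  have "summable (\<lambda>n. \<bar>(1/2::real) ^ Suc n\<bar>)"
    using summable_geometric[of "1/2::real"] by (simp add: summable_mult)
  then have \<beta>: "continuous_on UNIV \<beta>" unfolding \<beta>_def by (rule continuous_cantor_sum)
  define \<psi> where "\<psi> a i = M i * (2 * \<beta> (\<lambda>j. a (prod_encode (to_nat i, j))) - 1)" for a and i :: 'i
  show ?thesis
  proof (rule that[of \<psi>])
    show "continuous_on UNIV \<psi>"
    proof (rule continuous_on_coordinatewise_then_product)
      fix i :: 'i
      have "continuous_on UNIV (\<lambda>a::cantor. \<lambda>j. a (prod_encode (to_nat i, j)))"
        by (rule continuous_on_coordinatewise_then_product) simp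
      then have "continuous_on UNIV (\<lambda>a. \<beta> (\<lambda>j. a (prod_encode (to_nat i, j))))"
        by (rule continuous_on_compose2[OF \<beta>]) simp
      then show "continuous_on UNIV (\<lambda>a. \<psi> a i)"
        unfolding \<psi>_def by (intro continuous_intros)
    qed
    show "{y. \<forall>i. \<bar>y i\<bar> < M i} \<subseteq> range \<psi>"
    proof
      fix y assume y: "y \<in> {y. \<forall>i. \<bar>y i\<bar> < M i}"
      have "\<exists>b. \<beta> b = (y i / M i + 1) / 2" for i
      proof -
        have "\<bar>y i\<bar> < M i" using y by blast
        then have "- M i < y i" "y i < M i" by linarith+
        then have "0 \<le> (y i / M i + 1) / 2" "(y i / M i + 1) / 2 < 1"
          using assms[of i] by (auto simp: field_simps)
        then show ?thesis using binary_expansion unfolding \<beta>_def by metis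
      qed
      then obtain b where b: "\<And>i. \<beta> (b i) = (y i / M i + 1) / 2" by metis
      define a :: cantor where "a n = b (from_nat (fst (prod_decode n))) (snd (prod_decode n))" for n
      have "\<psi> a = y"
      proof
        fix i
        have "(\<lambda>j. a (prod_encode (to_nat i, j))) = b i" by (simp add: a_def)
        moreover have "2 * \<beta> (b i) - 1 = y i / M i" using b[of i] by simp
        ultimately show "\<psi> a i = y i" using assms[of i] by (simp add: \<psi>_def)
      qed
      then show "y \<in> range \<psi>" by blast
    qed
  qed
qed

lemma cylinder_cong: "(\<And>k. k < n \<Longrightarrow> a k = b k) \<Longrightarrow> cylinder a n = cylinder b n"
  by (auto simp: cylinder_def)

lemma cylinder_Suc: "cylinder a n = cylinder (a(n := True)) (Suc n) \<union> cylinder (a(n := False)) (Suc n)"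
  by (auto simp: cylinder_def less_Suc_eq)

lemma closed_cylinder: "closed (cylinder a n)"
proof -
  have "cylinder a n = (\<Inter>k\<in>{..<n}. (\<lambda>b. b k) -` {a k})" by (auto simp: cylinder_def)
  also have "closed \<dots>"
  proof (intro closed_INT ballI)
    show "closed ((\<lambda>b::cantor. b k) -` {a k})" for k by (rule closed_vimage) auto
  qed
  finally show ?thesis .
qed

lemma countable_cylinders: "countable {cylinder a n |a n. True}"
proof -
  have "{cylinder a n |a n. True} \<subseteq> range (\<lambda>l. {b. \<forall>k<length l. b k = l ! k})"
  proof
    fix C assume "C \<in> {cylinder a n |a n. True}"
    then obtain a n where "C = cylinder a n" by blast
    then have "C = {b. \<forall>k<length (map a [0..<n]). b k = map a [0..<n] ! k}"
      by (simp add: cylinder_def)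
    then show "C \<in> range (\<lambda>l. {b. \<forall>k<length l. b k = l ! k})" by blast
  qed
  then show ?thesis by (rule countable_subset) simp
qed

lemma continuous_cantor_coordinates:
  assumes "\<And>k a b. a \<in> cylinder b (Suc k) \<Longrightarrow> g a k = g b k"
  shows "continuous_on UNIV (g :: cantor \<Rightarrow> cantor)"
proof (rule continuous_on_coordinatewise_then_product)
  fix k
  have "open ((\<lambda>a. g a k) -` B)" for B
  proof (subst open_subopen, intro ballI)
    fix a assume "a \<in> (\<lambda>a. g a k) -` B"
    then have "cylinder a (Suc k) \<subseteq> (\<lambda>a. g a k) -` B" using assms by auto
    then show "\<exists>T. open T \<and> a \<in> T \<and> T \<subseteq> (\<lambda>a. g a k) -` B"
      by (intro exI[of _ "cylinder a (Suc k)"] conjI open_cylinder cylinder_self)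
  qed
  then show "continuous_on UNIV (\<lambda>a. g a k)" by (simp add: continuous_on_open_vimage)
qed

text \<open>
  If \<open>P\<close> describes a pruned tree of prefixes, \<open>g\<close> follows its argument whenever this stays inside the
  tree and takes the other branch otherwise; it maps every cylinder onto a cylinder of the tree.
\<close>

lemma pruned_tree_retraction:
  fixes P :: "cantor set \<Rightarrow> bool"
  assumes P0: "P UNIV"
    and P: "\<And>a n. P (cylinder a n) \<Longrightarrow> P (cylinder (a(n := True)) (Suc n)) \<or> P (cylinder (a(n := False)) (Suc n))"
  obtains g :: "cantor \<Rightarrow> cantor" where "continuous_on UNIV g" "\<And>a n. P (cylinder (g a) n)"
    "\<And>a b n. b \<in> cylinder (g a) n \<Longrightarrow> (\<And>m. P (cylinder b m)) \<Longrightarrow> \<exists>a'\<in>cylinder a n. g a' = b"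
proof -
  \<comment> \<open>\<open>G a n\<close> holds the first \<open>n\<close> bits chosen so far; its
    later entries are placeholders.\<close>
  define G :: "cantor \<Rightarrow> nat \<Rightarrow> cantor" where
    "G a = rec_nat (\<lambda>_. False) (\<lambda>n c. c(n := (if P (cylinder (c(n := a n)) (Suc n)) then a n else \<not> a n)))" for a
  have G_Suc: "G a (Suc n) = (G a n)(n := (if P (cylinder ((G a n)(n := a n)) (Suc n)) then a n else \<not> a n))" for a n
    by (simp add: G_def)
  define g where "g a n = G a (Suc n) n" for a n
  have Gg: "k < m \<Longrightarrow> G a m k = g a k" for a m k
  proof (induction m)
    case (Suc m)
    then show ?case by (cases "k = m") (simp_all add: g_def G_Suc)
  qed simp
  have cyl: "cylinder (G a n) n = cylinder (g a) n" for a n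
    by (rule cylinder_cong) (rule Gg)
  have g_step: "g a n = (if P (cylinder ((g a)(n := a n)) (Suc n)) then a n else \<not> a n)" for a n
  proof -
    have "cylinder ((G a n)(n := a n)) (Suc n) = cylinder ((g a)(n := a n)) (Suc n)"
      by (rule cylinder_cong) (auto simp: Gg less_Suc_eq)
    then show ?thesis by (simp add: g_def G_Suc)
  qed
  have g_pos: "P (cylinder (g a) n)" for a n
  proof (induction n)
    case 0
    then show ?case using P0 by (simp add: cylinder_def)
  next
    case (Suc n)
    have "(g a)(n := g a n) = g a" by simp
    then show ?case using P[OF Suc] g_step[of a n]
      by (cases "a n"; cases "P (cylinder ((g a)(n := a n)) (Suc n))") auto
  qed
  have g_prefix: "g a k = g b k" if "a \<in> cylinder b (Suc k)" for a b k
  proof -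
    have "\<forall>j\<le>k. g a j = g b j" if "a \<in> cylinder b (Suc k)" for k using that
    proof (induction k)
      case 0
      have "cylinder ((g a)(0 := a 0)) (Suc 0) = cylinder ((g b)(0 := b 0)) (Suc 0)"
        by (rule cylinder_cong) (use 0 in \<open>simp add: cylinder_def\<close>)
      then show ?case using g_step[of a 0] g_step[of b 0] 0 by (simp add: cylinder_def)
    next
      case (Suc k)
      then have IH: "\<forall>j\<le>k. g a j = g b j" by (simp add: cylinder_def)
      have "a (Suc k) = b (Suc k)" using Suc(2) by (simp add: cylinder_def)
      moreover have "cylinder ((g a)(Suc k := a (Suc k))) (Suc (Suc k)) = cylinder ((g b)(Suc k := b (Suc k))) (Suc (Suc k))"
        by (rule cylinder_cong) (use IH calculation in \<open>auto simp: less_Suc_eq_le le_Suc_eq\<close>)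
      ultimately show ?case using g_step[of a "Suc k"] g_step[of b "Suc k"] IH by (auto simp: le_Suc_eq)
    qed
    then show ?thesis using that by blast
  qed
  show ?thesis
  proof (rule that[of g])
    show "continuous_on UNIV g" by (rule continuous_cantor_coordinates) (rule g_prefix)
    show "P (cylinder (g a) n)" for a n by (rule g_pos)
    fix a b n assume b: "b \<in> cylinder (g a) n" and Pb: "\<And>m. P (cylinder b m)"
    \<comment> \<open>From \<open>n\<close> on, \<open>a'\<close> proposes the bits of
      \<open>b\<close>, which are always accepted because every prefix of \<open>b\<close> lies in
      the tree.\<close>
    define a' where "a' k = (if k < n then a k else b k)" for k
    have a': "a' \<in> cylinder a n" by (simp add: cylinder_def a'_def)
    have "g a' k = b k" for k
    proof (induction k rule: less_induct)
      case (less k)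
      show ?case
      proof (cases "k < n")
        case True
        then have "a' \<in> cylinder a (Suc k)" by (simp add: cylinder_def a'_def)
        then have "g a' k = g a k" by (rule g_prefix)
        then show ?thesis using b True by (simp add: cylinder_def)
      next
        case False
        then have a'k: "a' k = b k" by (simp add: a'_def)
        have "cylinder ((g a')(k := a' k)) (Suc k) = cylinder b (Suc k)"
        proof (rule cylinder_cong)
          fix j assume "j < Suc k"
          then show "((g a')(k := a' k)) j = b j" using less[of j] a'k by (cases "j = k") auto
        qed
        then show ?thesis using g_step[of a' k] Pb[of "Suc k"] a'k by simp
      qed
    qed
    then show "\<exists>a'\<in>cylinder a n. g a' = b" using a' by blast
  qed
qed

lemma closed_translate:
  fixes A :: "'a::topological_group_add set"
  assumes "closed A"
  shows "closed (translate A x)"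
proof -
  have "translate A x = (\<lambda>y. y - x) -` A" by auto
  then show ?thesis by (simp only:) (intro closed_vimage assms continuous_intros)
qed

text \<open>The cube is mapped continuously onto a superset of a compact set of positive measure.
  After pruning the cylinders with null image, the image of every cylinder is, up to a null set, one
  of positive measure. Translates of \<open>A\<close> are null, so their preimages contain no
  cylinder; being closed, these preimages are nowhere dense.\<close>

lemma closed_haar_null_haar_meager:
  fixes A :: "('i::countable \<Rightarrow> real) set"
  assumes cl: "closed A" and null: "haar_null A"
  shows "haar_meager A"
proof -
  obtain \<mu> where \<mu>: "prob_space \<mu>" "sets \<mu> = sets borel" "\<And>x. emeasure \<mu> (translate A x) = 0"
    using null unfolding haar_null_def by blast
  interpret prob_space \<mu> by fact
  have sp: "space \<mu> = UNIV" using sets_eq_imp_space_eq[OF \<mu>(2)] by simp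
  have "emeasure \<mu> UNIV = (SUP K\<in>{K. K \<subseteq> UNIV \<and> compact K}. emeasure \<mu> K)"
    by (rule inner_regular) (use \<mu>(2) sp emeasure_space_1 in auto)
  then have "\<exists>K. compact K \<and> emeasure \<mu> K \<noteq> 0"
    using emeasure_space_1 sp by (metis (mono_tags, lifting) SUP_bot_conv(1) bot_ennreal mem_Collect_eq zero_neq_one)
  then obtain K where K: "compact K" "emeasure \<mu> K \<noteq> 0" by blast
  have "\<exists>M>0. \<forall>y\<in>K. \<bar>y i\<bar> < M" for i
  proof -
    have "compact ((\<lambda>y. y i) ` K)"
      by (rule compact_continuous_image[OF _ K(1)]) (rule continuous_on_subset[OF continuous_on_product_coordinates], simp)
    then obtain B where "\<And>y. y \<in> K \<Longrightarrow> \<bar>y i\<bar> \<le> B"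
      using compact_imp_bounded bounded_iff by (metis image_eqI real_norm_def)
    then show ?thesis by (intro exI[of _ "\<bar>B\<bar> + 1"]) fastforce
  qed
  then have "\<forall>i. \<exists>M. 0 < M \<and> (\<forall>y\<in>K. \<bar>y i\<bar> < M)" by simp
  from choice[OF this] obtain M where "\<forall>i. 0 < M i \<and> (\<forall>y\<in>K. \<bar>y i\<bar> < M i)" ..
  then have M: "\<And>i. 0 < M i" "\<And>i y. y \<in> K \<Longrightarrow> \<bar>y i\<bar> < M i" by simp_all
  obtain \<psi> :: "cantor \<Rightarrow> 'i \<Rightarrow> real" where \<psi>: "continuous_on UNIV \<psi>" "{y. \<forall>i. \<bar>y i\<bar> < M i} \<subseteq> range \<psi>"
    by (rule cantor_onto_cube[of M, OF M(1)])
  have cyl_borel: "\<psi> ` cylinder a n \<in> sets \<mu>" for a n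
  proof -
    have "compact (cylinder a n)"
      using compact_Int_closed[OF compact_UNIV_cantor closed_cylinder] by simp
    then have "compact (\<psi> ` cylinder a n)"
      by (rule compact_continuous_image[OF continuous_on_subset[OF \<psi>(1)], rotated]) simp
    then show ?thesis using \<mu>(2) by (simp add: compact_imp_closed)
  qed
  define P where "P C \<longleftrightarrow> emeasure \<mu> (\<psi> ` C) \<noteq> 0" for C
  obtain g where g: "continuous_on UNIV g" "\<And>a n. P (cylinder (g a) n)"
    "\<And>a b n. b \<in> cylinder (g a) n \<Longrightarrow> (\<And>m. P (cylinder b m)) \<Longrightarrow> \<exists>a'\<in>cylinder a n. g a' = b"
  proof (rule pruned_tree_retraction[of P])
    have "K \<subseteq> range \<psi>" using \<psi>(2) M(2) by blast
    moreover have "range \<psi> \<in> sets \<mu>" using cyl_borel[of _ 0] by (simp add: cylinder_def)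
    ultimately show "P UNIV" unfolding P_def using K(2) by (metis emeasure_mono le_zero_eq)
    fix a n assume "P (cylinder a n)"
    show "P (cylinder (a(n := True)) (Suc n)) \<or> P (cylinder (a(n := False)) (Suc n))"
    proof (rule ccontr)
      assume "\<not> ?thesis"
      then have "\<psi> ` cylinder (a(n := True)) (Suc n) \<union> \<psi> ` cylinder (a(n := False)) (Suc n) \<in> null_sets \<mu>"
        using cyl_borel by (intro null_sets.Un null_setsI) (auto simp: P_def)
      then show False using \<open>P (cylinder a n)\<close> cylinder_Suc[of a n]
        by (simp add: P_def image_Un null_setsD1)
    qed
  qed blast
  \<comment> \<open>There are only countably many cylinders, so the images of all pruned ones
    together remain null.\<close>
  define N where "N = (\<Union>C\<in>{C. (\<exists>a n. C = cylinder a n) \<and> \<not> P C}. \<psi> ` C)"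
  have N: "N \<in> null_sets \<mu>" unfolding N_def
  proof (rule null_sets_UN')
    show "countable {C. (\<exists>a n. C = cylinder a n) \<and> \<not> P C}"
      by (rule countable_subset[OF _ countable_cylinders]) blast
    show "\<psi> ` C \<in> null_sets \<mu>" if "C \<in> {C. (\<exists>a n. C = cylinder a n) \<and> \<not> P C}" for C
      using that cyl_borel by (intro null_setsI) (auto simp: P_def)
  qed
  have cont: "continuous_on UNIV (\<lambda>a. \<psi> (g a))"
    by (rule continuous_on_compose2[OF \<psi>(1) g(1)]) simp
  have "meager ((\<lambda>a. \<psi> (g a)) -` translate A x)" for x
  proof (rule nowhere_dense_imp_meager, unfold nowhere_dense_def)
    let ?E = "(\<lambda>a. \<psi> (g a)) -` translate A x"
    have "closed ?E" by (intro closed_vimage closed_translate cl cont)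
    moreover have "interior ?E = {}"
    proof (rule ccontr)
      assume "interior ?E \<noteq> {}"
      then obtain a where "a \<in> interior ?E" by blast
      then obtain n where "cylinder a n \<subseteq> interior ?E"
        using open_contains_cylinder[OF open_interior] by metis
      then have n: "cylinder a n \<subseteq> ?E" using interior_subset by blast
      \<comment> \<open>A branch inside the tree is attained by \<open>g\<close> on the cylinder of
        \<open>a\<close>; a branch that leaves the tree has its image in \<open>N\<close>.\<close>
      have "\<psi> ` cylinder (g a) n \<subseteq> translate A x \<union> N"
      proof
        fix y assume "y \<in> \<psi> ` cylinder (g a) n"
        then obtain b where b: "b \<in> cylinder (g a) n" "y = \<psi> b" by blast
        show "y \<in> translate A x \<union> N"
        proof (cases "\<forall>m. P (cylinder b m)")
          case True
          then obtain a' where "a' \<in> cylinder a n" "g a' = b" using g(3)[OF b(1)] by blast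
          then show ?thesis using n b(2) by auto
        next
          case False
          then obtain m where "\<not> P (cylinder b m)" by blast
          then have "y \<in> N" unfolding N_def using b(2) cylinder_self[of b m] by blast
          then show ?thesis by blast
        qed
      qed
      moreover have "translate A x \<union> N \<in> null_sets \<mu>"
        using \<mu>(2,3) closed_translate[OF cl] N by (intro null_sets.Un null_setsI) auto
      ultimately have "emeasure \<mu> (\<psi> ` cylinder (g a) n) = 0"
        by (metis emeasure_mono le_zero_eq null_setsD1 null_setsD2)
      then show False using g(2)[of a n] by (simp add: P_def)
    qed
    ultimately show "interior (closure ?E) = {}" by simp
  qed
  moreover have "A \<in> sets borel" using cl by (rule borel_closed)
  ultimately show ?thesis unfolding haar_meager_def using cont by blast
qed

text \<open>Translating an interior point of \<open>K\<close> onto \<open>f a0\<close> would give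
  the preimage of that translate a nonempty open subset of the cube, which is not meager.\<close>

lemma closed_haar_meager_nowhere_dense:
  fixes K :: "'a::polish_vector_space set"
  assumes "closed K" "haar_meager K"
  shows "nowhere_dense K"
proof -
  obtain f :: "cantor \<Rightarrow> 'a" where f: "continuous_on UNIV f" "\<And>x. meager (f -` translate K x)"
    using assms(2) unfolding haar_meager_def by blast
  have "interior K = {}"
  proof (rule ccontr)
    assume "interior K \<noteq> {}"
    then obtain p where p: "p \<in> interior K" by blast
    fix a0 :: cantor
    let ?x = "f a0 - p"
    let ?O = "(\<lambda>a. f a - ?x) -` interior K"
    have "open ?O" by (intro open_vimage open_interior continuous_intros f(1))
    moreover have "a0 \<in> ?O" using p by simp
    moreover have "meager ?O"
      by (rule meager_subset[OF f(2)[of ?x]]) (use interior_subset[of K] in auto)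
    ultimately show False using nonmeager_open_cantor by blast
  qed
  then show ?thesis using assms(1) by (simp add: nowhere_dense_def)
qed

lemma sigma_closed_HN_subset_sigma_closed_HM:
  "(sigma_closed_HN :: ('i::countable \<Rightarrow> real) set set) \<subseteq> sigma_closed_HM"
proof
  fix A :: "('i \<Rightarrow> real) set" assume "A \<in> sigma_closed_HN"
  then obtain \<K> where "countable \<K>" "\<forall>K\<in>\<K>. closed K \<and> haar_null K" "A \<subseteq> \<Union>\<K>"
    by (auto simp: sigma_closed_HN_def)
  then show "A \<in> sigma_closed_HM"
    by (auto simp: sigma_closed_HM_def closed_haar_null_haar_meager intro!: exI[of _ \<K>])
qed

lemma sigma_closed_HM_subset_Meager:
  "(sigma_closed_HM :: 'a::polish_vector_space set set) \<subseteq> Meager_sets"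
proof
  fix A :: "'a set" assume "A \<in> sigma_closed_HM"
  then obtain \<K> where "countable \<K>" "\<forall>K\<in>\<K>. closed K \<and> haar_meager K" "A \<subseteq> \<Union>\<K>"
    by (auto simp: sigma_closed_HM_def)
  then show "A \<in> Meager_sets"
    by (auto simp: Meager_sets_def meager_iff_cover closed_haar_meager_nowhere_dense intro!: exI[of _ \<K>])
qed


subsection \<open>Borel sets as projections of closed sets\<close>

text \<open>In Polish spaces these are the analytic sets. \<open>nat \<Rightarrow> real\<close>
  takes the part of Baire space: it is complete and second countable, as the category argument on
  the projected set requires.\<close>

definition closed_projection :: "'a::topological_space set \<Rightarrow> bool" where
  "closed_projection A \<longleftrightarrow> (\<exists>C :: ('a \<times> (nat \<Rightarrow> real)) set. closed C \<and> A = fst ` C)"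

lemma closed_imp_closed_projection: "closed A \<Longrightarrow> closed_projection A"
  unfolding closed_projection_def
  by (intro exI[of _ "A \<times> UNIV"]) (auto simp: closed_Times)

lemma closed_projection_UN:
  fixes A :: "nat \<Rightarrow> 'a::topological_space set"
  assumes "\<And>n. closed_projection (A n)"
  shows "closed_projection (\<Union>n. A n)"
proof -
  have "\<forall>n. \<exists>C :: ('a \<times> (nat \<Rightarrow> real)) set. closed C \<and> A n = fst ` C"
    using assms by (simp add: closed_projection_def)
  from choice[OF this] obtain C :: "nat \<Rightarrow> ('a \<times> (nat \<Rightarrow> real)) set"
    where "\<forall>n. closed (C n) \<and> A n = fst ` C n" ..
  then have C: "\<And>n. closed (C n)" "\<And>n. A n = fst ` C n" by simp_all
  let ?s = "\<lambda>z :: 'a \<times> (nat \<Rightarrow> real). (fst z, \<lambda>j. snd z (Suc j))"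
  \<comment> \<open>Coordinate 0 of the witness is a natural number naming one of the sets, and the
    shifted rest is a witness for that set. Imposing \<open>C n\<close> only when coordinate 0 is
    less than 1 away from \<open>n\<close> is a closed condition.\<close>
  define D where "D = (\<lambda>z. snd z 0) -` (\<int> :: real set) \<inter> {z. 0 \<le> snd z 0} \<inter>
    (\<Inter>n. {z. 1 \<le> \<bar>snd z 0 - real n\<bar>} \<union> ?s -` C n)"
  have snd: "continuous_on UNIV (\<lambda>z :: 'a \<times> (nat \<Rightarrow> real). snd z j)" for j
    by (rule continuous_on_product_then_coordinatewise) (intro continuous_intros)
  have "continuous_on UNIV ?s"
    by (intro continuous_on_Pair continuous_on_coordinatewise_then_product snd continuous_on_fst continuous_on_id)
  then have "closed D" unfolding D_def
    by (intro closed_Int closed_INT closed_Un ballI closed_vimage closed_Collect_le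
        continuous_intros snd C(1) closed_Ints)
  moreover have "(\<Union>n. A n) = fst ` D"
  proof (intro equalityI subsetI)
    fix x assume "x \<in> (\<Union>n. A n)"
    then obtain n where "x \<in> A n" by blast
    then obtain y where y: "(x, y) \<in> C n" using C(2) by force
    have "(x, case_nat (real n) y) \<in> D"
    proof -
      have "1 \<le> \<bar>real n - real m\<bar>" if "m \<noteq> n" for m using that by linarith
      then show ?thesis using y by (auto simp: D_def) metis
    qed
    then show "x \<in> fst ` D" by force
  next
    fix x assume "x \<in> fst ` D"
    then obtain y where y: "(x, y) \<in> D" by auto
    then obtain k :: int where k: "y 0 = of_int k" "0 \<le> k" by (auto simp: D_def elim!: Ints_cases)
    then have "y 0 = real (nat k)" by simp
    then have "(x, \<lambda>j. y (Suc j)) \<in> C (nat k)" using y by (auto simp: D_def dest!: spec[of _ "nat k"])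
    then show "x \<in> (\<Union>n. A n)" using C(2) by force
  qed
  ultimately show ?thesis unfolding closed_projection_def by blast
qed

lemma closed_projection_INT:
  fixes A :: "nat \<Rightarrow> 'a::topological_space set"
  assumes "\<And>n. closed_projection (A n)"
  shows "closed_projection (\<Inter>n. A n)"
proof -
  have "\<forall>n. \<exists>C :: ('a \<times> (nat \<Rightarrow> real)) set. closed C \<and> A n = fst ` C"
    using assms by (simp add: closed_projection_def)
  from choice[OF this] obtain C :: "nat \<Rightarrow> ('a \<times> (nat \<Rightarrow> real)) set"
    where "\<forall>n. closed (C n) \<and> A n = fst ` C n" ..
  then have C: "\<And>n. closed (C n)" "\<And>n. A n = fst ` C n" by simp_all
  \<comment> \<open>A single sequence stores one witness for every \<open>n\<close>, interleaved by
    \<open>prod_encode\<close>.\<close>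
  let ?s = "\<lambda>n (z :: 'a \<times> (nat \<Rightarrow> real)). (fst z, \<lambda>j. snd z (prod_encode (n, j)))"
  define D where "D = (\<Inter>n. ?s n -` C n)"
  have snd: "continuous_on UNIV (\<lambda>z :: 'a \<times> (nat \<Rightarrow> real). snd z j)" for j
    by (rule continuous_on_product_then_coordinatewise) (intro continuous_intros)
  have "continuous_on UNIV (?s n)" for n
    by (intro continuous_on_Pair continuous_on_coordinatewise_then_product snd continuous_on_fst continuous_on_id)
  then have "closed D" unfolding D_def
    by (intro closed_INT ballI closed_vimage C(1))
  moreover have "(\<Inter>n. A n) = fst ` D"
  proof (intro equalityI subsetI)
    fix x assume x: "x \<in> (\<Inter>n. A n)"
    have "\<forall>n. \<exists>y. (x, y) \<in> C n"
    proof
      fix n have "x \<in> fst ` C n" using x C(2) by blast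
      then show "\<exists>y. (x, y) \<in> C n" by force
    qed
    from choice[OF this] obtain y where y: "\<forall>n. (x, y n) \<in> C n" ..
    have "(x, \<lambda>m. y (fst (prod_decode m)) (snd (prod_decode m))) \<in> D"
      using y by (simp add: D_def)
    then show "x \<in> fst ` D" by force
  next
    fix x assume "x \<in> fst ` D"
    then obtain y where "(x, y) \<in> D" by auto
    then have "(x, \<lambda>j. y (prod_encode (n, j))) \<in> C n" for n by (simp add: D_def)
    then have "x \<in> A n" for n unfolding C(2) by force
    then show "x \<in> (\<Inter>n. A n)" by blast
  qed
  ultimately show ?thesis unfolding closed_projection_def by blast
qed

lemma open_imp_closed_projection:
  fixes U :: "'a::metric_space set"
  assumes "open U"
  shows "closed_projection U"
\<comment> \<open>The distance to the empty set is 0 by convention, which would spoil the formula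
  below.\<close>
proof (cases "U = UNIV")
  case True
  then show ?thesis by (simp add: closed_imp_closed_projection)
next
  case False
  have "U = (\<Union>n. {x. 1 / real (Suc n) \<le> infdist x (- U)})"
  proof (intro equalityI subsetI)
    fix x assume "x \<in> U"
    then have "0 < infdist x (- U)"
      using infdist_pos_not_in_closed[of "- U" x] assms False by auto
    then obtain n where "inverse (real (Suc n)) < infdist x (- U)" using reals_Archimedean by blast
    then have "1 / real (Suc n) \<le> infdist x (- U)" by (simp add: inverse_eq_divide)
    then show "x \<in> (\<Union>n. {x. 1 / real (Suc n) \<le> infdist x (- U)})" by blast
  next
    fix x assume "x \<in> (\<Union>n. {x. 1 / real (Suc n) \<le> infdist x (- U)})"
    then obtain n where n: "1 / real (Suc n) \<le> infdist x (- U)" by blast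
    have "0 < 1 / real (Suc n)" by simp
    then have "0 < infdist x (- U)" using n by linarith
    then show "x \<in> U" using infdist_zero[of x "- U"] by fastforce
  qed
  moreover have "closed_projection {x. 1 / real (Suc n) \<le> infdist x (- U)}" for n
    by (intro closed_imp_closed_projection closed_Collect_le continuous_intros)
  then have "closed_projection (\<Union>n. {x. 1 / real (Suc n) \<le> infdist x (- U)})"
    by (rule closed_projection_UN)
  ultimately show ?thesis by simp
qed

text \<open>Projections of closed sets need not be closed under complement, so the induction carries
  each set together with its complement.\<close>

lemma borel_imp_closed_projection:
  fixes A :: "'a::metric_space set"
  assumes "A \<in> sets borel"
  shows "closed_projection A"
proof -
  have "A \<in> sigma_sets UNIV {S. open S}" using assms by (simp add: sets_borel)
  then have "closed_projection A \<and> closed_projection (- A)"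
  proof induction
    case (Basic U)
    then show ?case by (auto intro: open_imp_closed_projection closed_imp_closed_projection)
  next
    case Empty
    then show ?case by (auto intro: closed_imp_closed_projection)
  next
    case (Compl E)
    then show ?case by (simp add: Compl_eq_Diff_UNIV[symmetric])
  next
    case (Union E)
    then show ?case
      using closed_projection_UN[of E] closed_projection_INT[of "\<lambda>n. - E n"] by simp
  qed
  then show ?thesis ..
qed

subsection \<open>Images that are somewhere dense on every open piece\<close>

text \<open>A Cantor--Bendixson argument relative to the \<sigma>-ideal \<open>\<S>\<close>: all
  basic open sets over which the image is small are removed. They are countably many, so what is
  lost has small image, and a remaining piece with small image would have been removed too.\<close>

lemma positive_kernel:
  fixes C :: "'q::second_countable_topology set" and h :: "'q \<Rightarrow> 'a"
  assumes C: "closed C" "h ` C \<notin> \<S>"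
    and sub: "\<And>A B. B \<in> \<S> \<Longrightarrow> A \<subseteq> B \<Longrightarrow> A \<in> \<S>"
    and UN: "\<And>\<A>. countable \<A> \<Longrightarrow> \<A> \<subseteq> \<S> \<Longrightarrow> \<Union>\<A> \<in> \<S>"
  obtains P where "closed P" "P \<subseteq> C" "P \<noteq> {}"
    "\<And>Y. open Y \<Longrightarrow> Y \<inter> P \<noteq> {} \<Longrightarrow> h ` (Y \<inter> P) \<notin> \<S>"
proof -
  obtain B :: "'q set set" where B: "countable B" "topological_basis B"
    using ex_countable_basis by blast
  define R where "R = {b \<in> B. h ` (b \<inter> C) \<in> \<S>}"
  have cR: "countable ((\<lambda>b. h ` (b \<inter> C)) ` R)" unfolding R_def using B(1) by simp
  have RS: "(\<lambda>b. h ` (b \<inter> C)) ` R \<subseteq> \<S>" by (auto simp: R_def)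
  define P where "P = C - \<Union>R"
  have "open (\<Union>R)" using topological_basis_open[OF B(2)] by (auto simp: R_def)
  then have cP: "closed P" unfolding P_def by (rule closed_Diff[OF C(1)])
  have pos: "h ` (Y \<inter> P) \<notin> \<S>" if Y: "open Y" "Y \<inter> P \<noteq> {}" for Y
  proof
    assume S: "h ` (Y \<inter> P) \<in> \<S>"
    obtain p where p: "p \<in> Y" "p \<in> P" using Y(2) by blast
    obtain b where b: "b \<in> B" "p \<in> b" "b \<subseteq> Y" by (rule topological_basisE[OF B(2) Y(1) p(1)])
    have "\<Union>(insert (h ` (Y \<inter> P)) ((\<lambda>b. h ` (b \<inter> C)) ` R)) \<in> \<S>"
      using S RS cR by (intro UN) auto
    moreover have "h ` (b \<inter> C) \<subseteq> \<Union>(insert (h ` (Y \<inter> P)) ((\<lambda>b. h ` (b \<inter> C)) ` R))"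
      using b(3) by (auto simp: P_def)
    ultimately have "h ` (b \<inter> C) \<in> \<S>" by (rule sub)
    then have "b \<in> R" using b(1) by (simp add: R_def)
    then show False using p(2) b(2) by (auto simp: P_def)
  qed
  have "P \<noteq> {}"
  proof
    assume "P = {}"
    then have "h ` C \<subseteq> \<Union>((\<lambda>b. h ` (b \<inter> C)) ` R)" by (auto simp: P_def)
    then show False using sub[OF UN[OF cR RS]] C(2) by blast
  qed
  then show ?thesis using that[of P] cP pos by (auto simp: P_def)
qed

text \<open>Up to a nowhere dense set \<open>N Y n\<close>, the open set \<open>I Y\<close> is
  covered by the sets \<open>I b\<close> of basic pieces \<open>b\<close> of \<open>Y\<close> with
  diameter at most \<open>(1/2)^n\<close>. A point outside all these exceptions selects nested
  pieces of vanishing diameter, and completeness with continuity turns them into a preimage.\<close>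

lemma somewhere_dense_image_comeager:
  fixes Q :: "'q::{complete_space, second_countable_topology} set" and h :: "'q \<Rightarrow> 'a::metric_space"
  assumes Q: "closed Q" and h: "continuous_on Q h"
    and dense: "\<And>Y. open Y \<Longrightarrow> Y \<inter> Q \<noteq> {} \<Longrightarrow> interior (closure (h ` (Y \<inter> Q))) \<noteq> {}"
  shows "meager (interior (closure (h ` Q)) - h ` Q)"
proof -
  obtain B :: "'q set set" where B: "countable B" "topological_basis B"
    using ex_countable_basis by blast
  define I where "I Y = interior (closure (h ` (Y \<inter> Q)))" for Y
  define child where "child Y n = {b \<in> B. b \<subseteq> Y \<and> (\<forall>p\<in>b. \<forall>q\<in>b. dist p q \<le> (1/2)^n)}" for Y and n :: nat
  define N where "N Y n = I Y - \<Union>(I ` child Y n)" for Y n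
  have refine: "\<exists>b\<in>child Y n. I b \<inter> T \<noteq> {}"
    if Y: "open Y" and T: "open T" "T \<noteq> {}" "T \<subseteq> I Y" for Y T n
  proof -
    have "T \<subseteq> closure (h ` (Y \<inter> Q))" using T(3) interior_subset unfolding I_def by (rule subset_trans)
    then have "T \<inter> h ` (Y \<inter> Q) \<noteq> {}" using open_Int_closure_eq_empty[OF T(1)] T(2) by blast
    then obtain q where q: "q \<in> Y" "q \<in> Q" "h q \<in> T" by blast
    obtain V where V: "open V" "V \<inter> Q = h -` T \<inter> Q"
      using h T(1) unfolding continuous_on_open_invariant by blast
    let ?r = "(1/2)^n / 2 :: real"
    have "open (V \<inter> Y \<inter> ball q ?r)" "q \<in> V \<inter> Y \<inter> ball q ?r" using V Y q by auto
    then obtain b where b: "b \<in> B" "q \<in> b" "b \<subseteq> V \<inter> Y \<inter> ball q ?r"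
      by (rule topological_basisE[OF B(2)])
    have "dist p p' \<le> (1/2)^n" if "p \<in> b" "p' \<in> b" for p p'
    proof -
      have "dist q p < ?r" "dist q p' < ?r" using that b(3) by (auto simp: subset_eq)
      then show ?thesis using dist_triangle3[of p p' q] by linarith
    qed
    then have ch: "b \<in> child Y n" using b by (auto simp: child_def)
    have "open b" using topological_basis_open[OF B(2) b(1)] .
    then have "I b \<noteq> {}" unfolding I_def using b(2) q(2) by (intro dense) auto
    have "h ` (b \<inter> Q) \<subseteq> T" using b(3) V(2) by blast
    then have "I b \<subseteq> closure T" unfolding I_def using interior_subset closure_mono by (metis subset_trans)
    then have "I b \<inter> T \<noteq> {}"
      using \<open>I b \<noteq> {}\<close> open_Int_closure_eq_empty[of "I b" T] by (auto simp: I_def)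
    then show ?thesis using ch by blast
  qed
  have nd: "nowhere_dense (N Y n)" if oY: "open Y" for Y n
    unfolding nowhere_dense_def
  proof (rule ccontr)
    let ?T = "interior (closure (N Y n))" and ?W = "\<Union>(I ` child Y n)"
    assume T: "?T \<noteq> {}"
    have oW: "open ?W" and oI: "open (I Y)" by (auto simp: I_def)
    have "?T \<inter> N Y n \<noteq> {}"
      using T open_Int_closure_eq_empty[OF open_interior, of "closure (N Y n)" "N Y n"] interior_subset by blast
    then have "?T \<inter> I Y \<noteq> {}" by (auto simp: N_def)
    then obtain b where "b \<in> child Y n" "I b \<inter> (?T \<inter> I Y) \<noteq> {}"
      using refine[OF oY, of "?T \<inter> I Y" n] oI by auto
    then have ne: "(?T \<inter> I Y \<inter> ?W) \<inter> closure (N Y n) \<noteq> {}" using interior_subset by blast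
    have "open (?T \<inter> I Y \<inter> ?W)" using oW oI by (intro open_Int open_interior)
    from open_Int_closure_eq_empty[OF this, of "N Y n"] ne
    show False by (auto simp: N_def)
  qed
  \<comment> \<open>\<open>UNIV\<close> starts the descent and is adjoined because the basis need
    not contain it.\<close>
  have "interior (closure (h ` Q)) - h ` Q \<subseteq> (\<Union>(Y, n)\<in>insert UNIV B \<times> UNIV. N Y n)"
  proof (rule subsetI, rule ccontr)
    fix z assume z: "z \<in> interior (closure (h ` Q)) - h ` Q"
      and notN: "z \<notin> (\<Union>(Y, n)\<in>insert UNIV B \<times> UNIV. N Y n)"
    have step: "\<exists>b. (b \<in> insert UNIV B \<and> z \<in> I b) \<and> b \<in> child Y n"
      if Y: "Y \<in> insert UNIV B \<and> z \<in> I Y" for Y n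
    proof -
      have "z \<notin> N Y n" using notN Y by blast
      then obtain b where "b \<in> child Y n" "z \<in> I b" using Y by (auto simp: N_def)
      then show ?thesis by (auto simp: child_def)
    qed
    have "\<exists>f. \<forall>n. (f n \<in> insert UNIV B \<and> z \<in> I (f n)) \<and> f (Suc n) \<in> child (f n) n"
    proof (rule dependent_nat_choice)
      show "\<exists>x. x \<in> insert UNIV B \<and> z \<in> I x" using z by (intro exI[of _ UNIV]) (simp add: I_def)
      show "\<exists>y. (y \<in> insert UNIV B \<and> z \<in> I y) \<and> y \<in> child x n" if "x \<in> insert UNIV B \<and> z \<in> I x" for x n
        using step[OF that] .
    qed
    then obtain f where f: "\<And>n. z \<in> I (f n)" "\<And>n. f (Suc n) \<in> child (f n) n" by blast
    have "\<forall>n. \<exists>q. q \<in> f n \<and> q \<in> Q \<and> dist (h q) z < (1/2)^n"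
    proof
      fix n
      have "z \<in> closure (h ` (f n \<inter> Q))" using f(1)[of n] interior_subset unfolding I_def by blast
      then obtain y where "y \<in> h ` (f n \<inter> Q)" "dist y z < (1/2)^n"
        unfolding closure_approachable by (metis zero_less_divide_1_iff zero_less_numeral zero_less_power)
      then show "\<exists>q. q \<in> f n \<and> q \<in> Q \<and> dist (h q) z < (1/2)^n" by blast
    qed
    from choice[OF this] obtain q where "\<forall>n. q n \<in> f n \<and> q n \<in> Q \<and> dist (h (q n)) z < (1/2)^n" ..
    then have q: "q n \<in> f n" "q n \<in> Q" "dist (h (q n)) z < (1/2)^n" for n by simp_all
    have "f (Suc n) \<subseteq> f n" for n using f(2)[of n] by (simp add: child_def)
    then have mono: "f m \<subseteq> f n" if "n \<le> m" for m n using that by (rule lift_Suc_antimono_le)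
    have small: "dist x y \<le> (1/2)^n" if "x \<in> f (Suc n)" "y \<in> f (Suc n)" for x y n
      using f(2)[of n] that by (simp add: child_def)
    have "Cauchy q"
    proof (rule metric_CauchyI)
      fix e :: real assume "0 < e"
      then obtain n where n: "(1/2)^n < e" using real_arch_pow_inv[of e "1/2"] by auto
      have "dist (q m) (q k) < e" if "m \<ge> Suc n" "k \<ge> Suc n" for m k
        using small[of "q m" n "q k"] mono[OF that(1)] mono[OF that(2)] q(1) n by fastforce
      then show "\<exists>M. \<forall>m\<ge>M. \<forall>n\<ge>M. dist (q m) (q n) < e" by blast
    qed
    then obtain l where l: "q \<longlonglongrightarrow> l" by (auto simp: Cauchy_convergent_iff convergent_def)
    \<comment> \<open>The limit may fall outside the pieces \<open>f n\<close>, which need not be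
      closed; membership in \<open>Q\<close> is enough.\<close>
    have lQ: "l \<in> Q" using closed_sequentially[OF Q q(2) l] .
    have "(\<lambda>n. h (q n)) \<longlonglongrightarrow> h l"
      using continuous_on_tendsto_compose[OF h l lQ] q(2) by simp
    moreover have "(\<lambda>n. h (q n)) \<longlonglongrightarrow> z"
    proof (rule tendsto_dist_iff[THEN iffD2], rule tendsto_sandwich[OF _ _ tendsto_const LIMSEQ_power_zero])
      show "\<forall>\<^sub>F n in sequentially. dist (h (q n)) z \<le> (1/2)^n"
        by (rule always_eventually) (use q(3) less_imp_le in blast)
    qed auto
    ultimately have "h l = z" by (rule LIMSEQ_unique)
    then show False using z lQ by blast
  qed
  moreover have "meager (\<Union>(Y, n)\<in>insert UNIV B \<times> UNIV. N Y n)"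
  proof (rule meager_UN)
    show "countable (insert UNIV B \<times> (UNIV :: nat set))" using B(1) by simp
    show "meager (case i of (Y, n) \<Rightarrow> N Y n)" if "i \<in> insert UNIV B \<times> UNIV" for i
    proof -
      have "open (fst i)" using that topological_basis_open[OF B(2)] by auto
      then show ?thesis by (simp add: split_beta nowhere_dense_imp_meager nd)
    qed
  qed
  ultimately show ?thesis by (rule meager_subset[rotated])
qed


subsection \<open>Lebesgue measure and sums of closed sets\<close>

definition lebesgue_fun :: "('i::countable \<Rightarrow> real) measure" where
  "lebesgue_fun = PiM UNIV (\<lambda>_. lborel)"

lemma sets_lebesgue_fun: "sets (lebesgue_fun :: ('i::countable \<Rightarrow> real) measure) = sets borel"
proof -
  have "sets (lebesgue_fun :: ('i \<Rightarrow> real) measure) = sets (PiM UNIV (\<lambda>_::'i. borel :: real measure))"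
    unfolding lebesgue_fun_def by (rule sets_PiM_cong) auto
  then show ?thesis by (simp add: sets_PiM_equal_borel)
qed

lemma space_lebesgue_fun [simp]: "space lebesgue_fun = UNIV"
  by (simp add: lebesgue_fun_def space_PiM)

lemma sigma_finite_lebesgue_fun:
  assumes "finite (UNIV :: 'i::countable set)"
  shows "sigma_finite_measure (lebesgue_fun :: ('i \<Rightarrow> real) measure)"
proof -
  interpret finite_product_sigma_finite "\<lambda>_::'i. lborel :: real measure" UNIV
    by unfold_locales (rule assms)
  show ?thesis unfolding lebesgue_fun_def by (rule sigma_finite_measure_axioms)
qed

lemma emeasure_lebesgue_fun_translate:
  fixes A :: "('i::countable \<Rightarrow> real) set"
  assumes "finite (UNIV :: 'i set)" "A \<in> sets borel"
  shows "emeasure lebesgue_fun (translate A x) = emeasure lebesgue_fun A"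
proof -
  interpret product_sigma_finite "\<lambda>_::'i. lborel :: real measure" by unfold_locales
  let ?L = "lebesgue_fun :: ('i \<Rightarrow> real) measure"
  have m: "(\<lambda>y. y - x) \<in> ?L \<rightarrow>\<^sub>M ?L"
  proof -
    have "(\<lambda>y. y - x) \<in> borel_measurable borel"
      by (intro borel_measurable_continuous_onI continuous_intros)
    then show ?thesis using measurable_cong_sets[OF sets_lebesgue_fun sets_lebesgue_fun] by blast
  qed
  have "distr ?L ?L (\<lambda>y. y - x) = PiM UNIV (\<lambda>_. lborel)"
  proof (rule PiM_eqI[OF assms(1)])
    show "sets (distr ?L ?L (\<lambda>y. y - x)) = sets (PiM UNIV (\<lambda>_. lborel))"
      by (simp add: lebesgue_fun_def)
    fix B :: "'i \<Rightarrow> real set" assume "\<And>i. i \<in> UNIV \<Longrightarrow> B i \<in> sets lborel"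
    then have B: "B i \<in> sets borel" for i by simp
    have tr: "(\<lambda>t. t - x i) -` B i \<in> sets borel" for i
      using measurable_sets[of "\<lambda>t. t - x i" borel borel, OF _ B[of i]] by simp
    have "emeasure (distr ?L ?L (\<lambda>y. y - x)) (Pi\<^sub>E UNIV B) = emeasure ?L ((\<lambda>y. y - x) -` Pi\<^sub>E UNIV B)"
      using emeasure_distr[OF m, of "Pi\<^sub>E UNIV B"] B assms(1)
      by (simp add: lebesgue_fun_def sets_PiM_I_finite space_PiM)
    also have "(\<lambda>y. y - x) -` Pi\<^sub>E UNIV B = Pi\<^sub>E UNIV (\<lambda>i. (\<lambda>t. t - x i) -` B i)"
      by (auto simp: PiE_iff)
    also have "emeasure ?L \<dots> = (\<Prod>i\<in>UNIV. emeasure lborel ((\<lambda>t. t - x i) -` B i))"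
      unfolding lebesgue_fun_def by (rule emeasure_PiM[OF assms(1)]) (use tr in simp)
    also have "\<dots> = (\<Prod>i\<in>UNIV. emeasure lborel (B i))"
    proof (rule prod.cong[OF refl])
      fix i
      have "emeasure lborel (B i) = emeasure (distr lborel borel ((+) (- x i))) (B i)"
        by (simp add: lborel_distr_plus)
      also have "\<dots> = emeasure lborel ((\<lambda>t. t - x i) -` B i)"
        using B[of i] by (subst emeasure_distr) (auto simp: vimage_def)
      finally show "emeasure lborel ((\<lambda>t. t - x i) -` B i) = emeasure lborel (B i)" ..
    qed
    finally show "emeasure (distr ?L ?L (\<lambda>y. y - x)) (Pi\<^sub>E UNIV B) = (\<Prod>i\<in>UNIV. emeasure lborel (B i))" .
  qed
  then have eq: "distr ?L ?L (\<lambda>y. y - x) = ?L" by (simp add: lebesgue_fun_def)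
  have "emeasure ?L A = emeasure (distr ?L ?L (\<lambda>y. y - x)) A" by (simp add: eq)
  also have "\<dots> = emeasure ?L ((\<lambda>y. y - x) -` A)"
    using emeasure_distr[OF m, of A] assms(2) by (simp add: sets_lebesgue_fun)
  also have "(\<lambda>y. y - x) -` A = translate A x" by auto
  finally show ?thesis ..
qed

lemma closed_in_pair_lebesgue_fun:
  fixes E :: "(('i::countable \<Rightarrow> real) \<times> ('i \<Rightarrow> real)) set"
  assumes "closed E" "sets \<mu> = sets borel"
  shows "E \<in> sets (\<mu> \<Otimes>\<^sub>M lebesgue_fun)"
proof -
  have "sets (\<mu> \<Otimes>\<^sub>M lebesgue_fun) = sets (borel \<Otimes>\<^sub>M (borel :: ('i \<Rightarrow> real) measure))"
    by (rule sets_pair_measure_cong[OF assms(2) sets_lebesgue_fun])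
  also have "\<dots> = sets borel" unfolding borel_prod ..
  finally show ?thesis using assms(1) by simp
qed

text \<open>The witness is the uniform distribution on the unit cube.\<close>

lemma lebesgue_null_imp_haar_null:
  fixes A :: "('i::countable \<Rightarrow> real) set"
  assumes fin: "finite (UNIV :: 'i set)" and A: "A \<in> sets borel" "emeasure lebesgue_fun A = 0"
  shows "haar_null A"
proof -
  interpret product_sigma_finite "\<lambda>_::'i. lborel :: real measure" by unfold_locales
  let ?L = "lebesgue_fun :: ('i \<Rightarrow> real) measure"
  let ?C = "Pi\<^sub>E (UNIV :: 'i set) (\<lambda>_. {0..1::real})"
  have C: "?C \<in> sets ?L" unfolding lebesgue_fun_def by (rule sets_PiM_I_finite[OF fin]) simp
  have one: "emeasure ?L ?C = 1" unfolding lebesgue_fun_def by (subst emeasure_PiM[OF fin]) auto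
  have "prob_space (uniform_measure ?L ?C)"
    by (rule prob_space_uniform_measure) (simp_all add: one)
  moreover have "emeasure (uniform_measure ?L ?C) (translate A x) = 0" for x
  proof -
    have T: "translate A x \<in> null_sets ?L"
      using A translate_borel[OF A(1)] emeasure_lebesgue_fun_translate[OF fin A(1)] sets_lebesgue_fun
      by (intro null_setsI) auto
    have "emeasure ?L (?C \<inter> translate A x) = 0"
      using null_set_Int1[OF T C] by (simp add: null_setsD1 Int_commute)
    then show ?thesis
      using emeasure_uniform_measure[OF C, of "translate A x"] T by (simp add: null_setsD2)
  qed
  moreover have "sets (uniform_measure ?L ?C) = sets borel" by (simp add: sets_lebesgue_fun)
  ultimately show ?thesis unfolding haar_null_def using A(1) by blast
qed

text \<open>Fubini for the pairs whose sum lies in \<open>K\<close>: sections in one direction are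
  translates of \<open>K\<close> and \<open>\<mu>\<close>-null, sections in the other are translates
  of \<open>K\<close> with the full Lebesgue measure of \<open>K\<close>.\<close>

lemma closed_haar_null_imp_lebesgue_null:
  fixes K :: "('i::countable \<Rightarrow> real) set"
  assumes fin: "finite (UNIV :: 'i set)" and K: "closed K" "haar_null K"
  shows "emeasure lebesgue_fun K = 0"
proof -
  let ?L = "lebesgue_fun :: ('i \<Rightarrow> real) measure"
  obtain \<mu> where \<mu>: "prob_space \<mu>" "sets \<mu> = sets borel" "\<And>x. emeasure \<mu> (translate K x) = 0"
    using K(2) unfolding haar_null_def by blast
  interpret M: prob_space \<mu> by fact
  interpret L: sigma_finite_measure ?L by (rule sigma_finite_lebesgue_fun[OF fin])
  interpret P: pair_sigma_finite \<mu> ?L ..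
  have Kb: "K \<in> sets borel" using K(1) by simp
  define E where "E = (\<lambda>z :: ('i \<Rightarrow> real) \<times> ('i \<Rightarrow> real). fst z + snd z) -` K"
  have "closed E" unfolding E_def by (intro closed_vimage K(1) continuous_intros)
  then have E: "E \<in> sets (\<mu> \<Otimes>\<^sub>M ?L)" using \<mu>(2) by (rule closed_in_pair_lebesgue_fun)
  have "emeasure (\<mu> \<Otimes>\<^sub>M ?L) E = (\<integral>\<^sup>+ x. emeasure \<mu> ((\<lambda>y. (y, x)) -` E) \<partial>?L)"
    by (rule P.emeasure_pair_measure_alt2[OF E])
  also have "\<dots> = (\<integral>\<^sup>+ x. emeasure \<mu> (translate K (- x)) \<partial>?L)"
    by (intro nn_integral_cong arg_cong[where f = "emeasure \<mu>"]) (auto simp: E_def)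
  also have "\<dots> = 0" using \<mu>(3) by simp
  finally have "0 = emeasure (\<mu> \<Otimes>\<^sub>M ?L) E" ..
  also have "\<dots> = (\<integral>\<^sup>+ y. emeasure ?L (Pair y -` E) \<partial>\<mu>)"
    by (rule L.emeasure_pair_measure_alt[OF E])
  also have "\<dots> = (\<integral>\<^sup>+ y. emeasure ?L (translate K (- y)) \<partial>\<mu>)"
    by (intro nn_integral_cong arg_cong[where f = "emeasure ?L"]) (auto simp: E_def add.commute)
  also have "\<dots> = emeasure ?L K"
    using M.emeasure_space_1 by (simp add: emeasure_lebesgue_fun_translate[OF fin Kb])
  finally show ?thesis ..
qed

text \<open>By Fubini \<open>E\<close> has measure equal to the product of those of \<open>K\<close>
  and \<open>L\<close>, so some \<open>S z\<close>, the intersection of \<open>K\<close> with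
  \<open>z - L\<close>, has positive measure. Differences of points of \<open>S z\<close> fill a
  neighbourhood of 0, and \<open>z + (b - a) = b + (z - a)\<close> is a sum of the required
  kind.\<close>

lemma closed_sum_interior:
  fixes K L :: "('i::countable \<Rightarrow> real) set"
  assumes fin: "finite (UNIV :: 'i set)"
    and K: "closed K" "\<not> haar_null K" and L: "closed L" "\<not> haar_null L"
  shows "interior {a + b |a b. a \<in> K \<and> b \<in> L} \<noteq> {}"
proof -
  let ?M = "lebesgue_fun :: ('i \<Rightarrow> real) measure"
  interpret M: sigma_finite_measure ?M by (rule sigma_finite_lebesgue_fun[OF fin])
  interpret P: pair_sigma_finite ?M ?M ..
  have Kb: "K \<in> sets borel" and Lb: "L \<in> sets borel" using K(1) L(1) by simp_all
  have pos: "emeasure ?M K \<noteq> 0" "emeasure ?M L \<noteq> 0"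
    using lebesgue_null_imp_haar_null[OF fin Kb] lebesgue_null_imp_haar_null[OF fin Lb] K(2) L(2) by blast+
  define E where "E = {z :: ('i \<Rightarrow> real) \<times> ('i \<Rightarrow> real). fst z \<in> K \<and> snd z - fst z \<in> L}"
  have "E = fst -` K \<inter> (\<lambda>z. snd z - fst z) -` L" by (auto simp: E_def)
  also have "closed \<dots>" by (intro closed_Int closed_vimage K(1) L(1) continuous_intros)
  finally have E: "E \<in> sets (?M \<Otimes>\<^sub>M ?M)" using sets_lebesgue_fun by (rule closed_in_pair_lebesgue_fun)
  define S where "S z = K \<inter> (\<lambda>x. z - x) -` L" for z
  have S: "closed (S z)" for z
    unfolding S_def by (intro closed_Int closed_vimage K(1) L(1) continuous_intros)
  have "emeasure (?M \<Otimes>\<^sub>M ?M) E = (\<integral>\<^sup>+ x. emeasure ?M (Pair x -` E) \<partial>?M)"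
    by (rule M.emeasure_pair_measure_alt[OF E])
  also have "\<dots> = (\<integral>\<^sup>+ x. emeasure ?M L * indicator K x \<partial>?M)"
  proof (rule nn_integral_cong)
    fix x
    have "Pair x -` E = (if x \<in> K then translate L x else {})" by (auto simp: E_def)
    then show "emeasure ?M (Pair x -` E) = emeasure ?M L * indicator K x"
      by (simp add: emeasure_lebesgue_fun_translate[OF fin Lb])
  qed
  also have "\<dots> = emeasure ?M L * emeasure ?M K"
    using Kb by (intro nn_integral_cmult_indicator) (simp add: sets_lebesgue_fun)
  finally have "emeasure (?M \<Otimes>\<^sub>M ?M) E \<noteq> 0" using pos by simp
  moreover have "emeasure (?M \<Otimes>\<^sub>M ?M) E = (\<integral>\<^sup>+ z. emeasure ?M ((\<lambda>x. (x, z)) -` E) \<partial>?M)"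
    by (rule P.emeasure_pair_measure_alt2[OF E])
  moreover have "(\<lambda>x. (x, z)) -` E = S z" for z by (auto simp: E_def S_def)
  ultimately have "(\<integral>\<^sup>+ z. emeasure ?M (S z) \<partial>?M) \<noteq> 0" by simp
  then obtain z where "emeasure ?M (S z) \<noteq> 0"
    by (metis (no_types, lifting) nn_integral_0_iff_AE nn_integral_cong nn_integral_const mult_zero_left)
  then have "\<not> haar_null (S z)" using closed_haar_null_imp_lebesgue_null[OF fin S] by blast
  then have "0 \<in> interior {b - a |a b. a \<in> S z \<and> b \<in> S z}"
    using S by (intro not_haar_null_differences) auto
  then have "z \<in> (\<lambda>y. y - z) -` interior {b - a |a b. a \<in> S z \<and> b \<in> S z}" (is "_ \<in> ?V") by simp
  moreover have "open ?V" by (intro open_vimage open_interior continuous_intros)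
  moreover have "?V \<subseteq> {a + b |a b. a \<in> K \<and> b \<in> L}"
  proof
    fix v assume "v \<in> ?V"
    then obtain a b where ab: "v - z = b - a" "a \<in> S z" "b \<in> S z" using interior_subset by blast
    have "v = b + (z - a)" using ab(1) by (simp add: algebra_simps)
    then show "v \<in> {a + b |a b. a \<in> K \<and> b \<in> L}" using ab(2,3) by (auto simp: S_def)
  qed
  ultimately show ?thesis using interior_maximal by blast
qed

lemma sigma_closed_HN_subset:
  assumes "B \<in> sigma_closed_HN" "A \<subseteq> B"
  shows "A \<in> sigma_closed_HN"
proof -
  obtain \<K> where \<K>: "countable \<K>" "\<forall>K\<in>\<K>. closed K \<and> haar_null K" "B \<subseteq> \<Union>\<K>"
    using assms(1) by (auto simp: sigma_closed_HN_def)
  have "A \<subseteq> \<Union>\<K>" using assms(2) \<K>(3) by (rule subset_trans)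
  then show ?thesis using \<K>(1,2) by (auto simp: sigma_closed_HN_def intro!: exI[of _ \<K>])
qed

lemma sigma_closed_HN_Union:
  assumes "countable \<A>" "\<A> \<subseteq> (sigma_closed_HN :: 'a::polish_vector_space set set)"
  shows "\<Union>\<A> \<in> sigma_closed_HN"
proof -
  have "\<forall>A\<in>\<A>. \<exists>\<K>. countable \<K> \<and> (\<forall>K\<in>\<K>. closed K \<and> haar_null K) \<and> A \<subseteq> \<Union>\<K>"
    using assms(2) by (auto simp: sigma_closed_HN_def)
  from bchoice[OF this] obtain k
    where k: "\<forall>A\<in>\<A>. countable (k A) \<and> (\<forall>K\<in>k A. closed K \<and> haar_null K) \<and> A \<subseteq> \<Union>(k A)" ..
  have "countable (\<Union>A\<in>\<A>. k A)" using assms(1) k by (intro countable_UN) auto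
  moreover have "\<Union>\<A> \<subseteq> \<Union>(\<Union>A\<in>\<A>. k A)" using k by blast
  ultimately show ?thesis using k unfolding sigma_closed_HN_def
    by (intro CollectI exI[of _ "\<Union>A\<in>\<A>. k A"]) auto
qed

subsection \<open>Finite dimension\<close>

text \<open>
  On the kernel \<open>P\<close> of a closed set projecting onto \<open>A\<close>, sums of two pieces are somewhere dense, so
  \<open>A + A\<close> is comeager in an open set and \<open>A + A + A + A\<close> contains an open set.
\<close>

lemma borel_not_sigma_closed_HN_class_B:
  fixes A :: "('i::countable \<Rightarrow> real) set"
  assumes fin: "finite (UNIV :: 'i set)" and A: "A \<in> sets borel" "A \<notin> sigma_closed_HN"
  shows "A \<in> class_B"
  unfolding class_B_def
proof (intro CollectI allI impI, elim conjE)
  fix f :: "('i \<Rightarrow> real) \<Rightarrow> real"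
  assume f: "Modules.additive f" "bdd_above (f ` A)"
  obtain M where M: "\<And>a. a \<in> A \<Longrightarrow> f a \<le> M" using f(2) unfolding bdd_above_def by auto
  obtain C :: "(('i \<Rightarrow> real) \<times> (nat \<Rightarrow> real)) set" where C: "closed C" "A = fst ` C"
    using borel_imp_closed_projection[OF A(1)] unfolding closed_projection_def by blast
  obtain P where P: "closed P" "P \<subseteq> C" "P \<noteq> {}"
    "\<And>Y. open Y \<Longrightarrow> Y \<inter> P \<noteq> {} \<Longrightarrow> fst ` (Y \<inter> P) \<notin> sigma_closed_HN"
  proof (rule positive_kernel[of C fst sigma_closed_HN])
    show "fst ` C \<notin> sigma_closed_HN" using A(2) C(2) by simp
  qed (use C(1) sigma_closed_HN_subset sigma_closed_HN_Union in blast)+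
  have PA: "fst p \<in> A" if "p \<in> P" for p using that P(2) C(2) by blast
  \<comment> \<open>A Haar-null closure would by itself cover the piece and put it into
    \<open>sigma_closed_HN\<close>.\<close>
  have piece: "\<not> haar_null (closure (fst ` (Y \<inter> P)))" if "open Y" "Y \<inter> P \<noteq> {}" for Y
  proof
    assume "haar_null (closure (fst ` (Y \<inter> P)))"
    then have "fst ` (Y \<inter> P) \<in> sigma_closed_HN" unfolding sigma_closed_HN_def
      by (intro CollectI exI[of _ "{closure (fst ` (Y \<inter> P))}"]) (simp add: closure_subset)
    then show False using P(4)[OF that] by simp
  qed
  define h where "h z = fst (fst z) + fst (snd z)"
    for z :: "(('i \<Rightarrow> real) \<times> (nat \<Rightarrow> real)) \<times> (('i \<Rightarrow> real) \<times> (nat \<Rightarrow> real))"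
  have ch: "continuous_on (P \<times> P) h" unfolding h_def by (intro continuous_intros)
  have dense: "interior (closure (h ` (Y \<inter> P \<times> P))) \<noteq> {}" if Y: "open Y" "Y \<inter> P \<times> P \<noteq> {}" for Y
  proof -
    obtain p q where pq: "(p, q) \<in> Y" "p \<in> P" "q \<in> P" using Y(2) by blast
    obtain U V where UV: "open U" "open V" "(p, q) \<in> U \<times> V" "U \<times> V \<subseteq> Y"
      by (rule open_prod_elim[OF Y(1) pq(1)]) 
    let ?K = "closure (fst ` (U \<inter> P))" and ?L = "closure (fst ` (V \<inter> P))"
    have "{a + b |a b. a \<in> ?K \<and> b \<in> ?L} \<subseteq> closure (h ` (Y \<inter> P \<times> P))"
    proof
      fix c assume "c \<in> {a + b |a b. a \<in> ?K \<and> b \<in> ?L}"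
      then obtain a b where ab: "c = a + b" "a \<in> ?K" "b \<in> ?L" by blast
      obtain s where s: "\<And>n. s n \<in> fst ` (U \<inter> P)" "s \<longlonglongrightarrow> a" using ab(2) unfolding closure_sequential by auto
      obtain t where t: "\<And>n. t n \<in> fst ` (V \<inter> P)" "t \<longlonglongrightarrow> b" using ab(3) unfolding closure_sequential by auto
      have "s n + t n \<in> h ` (Y \<inter> P \<times> P)" for n
      proof -
        obtain u v where "u \<in> U \<inter> P" "s n = fst u" "v \<in> V \<inter> P" "t n = fst v" using s(1) t(1) by blast
        then show ?thesis using UV(4) by (intro image_eqI[of _ h "(u, v)"]) (auto simp: h_def)
      qed
      moreover have "(\<lambda>n. s n + t n) \<longlonglongrightarrow> c" unfolding ab(1) by (rule tendsto_add[OF s(2) t(2)])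
      ultimately show "c \<in> closure (h ` (Y \<inter> P \<times> P))"
        unfolding closure_sequential by (intro exI[of _ "\<lambda>n. s n + t n"]) simp
    qed
    moreover have "interior {a + b |a b. a \<in> ?K \<and> b \<in> ?L} \<noteq> {}"
      using UV pq by (intro closed_sum_interior[OF fin] closed_closure piece) auto
    ultimately show ?thesis using interior_mono by blast
  qed
  let ?R = "h ` (P \<times> P)"
  let ?W = "interior (closure ?R)"
  have mW: "meager (?W - ?R)"
    by (rule somewhere_dense_image_comeager[OF closed_Times[OF P(1) P(1)] ch dense])
  have fR: "f r \<le> 2 * M" if "r \<in> ?R" for r
  proof -
    obtain p q where "p \<in> P" "q \<in> P" "r = fst p + fst q" using \<open>r \<in> ?R\<close> by (auto simp: h_def)
    then show ?thesis using M[OF PA[of p]] M[OF PA[of q]] by (simp add: additive.add[OF f(1)])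
  qed
  have "?W \<noteq> {}" using dense[OF open_UNIV] P(3) by auto
  then obtain w where w: "w \<in> ?W" by blast
  \<comment> \<open>For \<open>v\<close> in this translate of \<open>?W\<close>, the sets
    \<open>?W\<close> and \<open>v - ?W\<close> share the point \<open>v - w\<close>.\<close>
  let ?V = "(\<lambda>v. v - w) -` ?W"
  have "f v \<le> 4 * M" if v: "v \<in> ?V" for v
  proof -
    let ?i = "\<lambda>z. v - z"
    have ci: "continuous_on UNIV ?i" by (intro continuous_intros)
    have "open (?W \<inter> ?i -` ?W)" by (intro open_Int open_vimage open_interior ci)
    moreover have "v - w \<in> ?W \<inter> ?i -` ?W" using v w by simp
    ultimately have "\<not> meager (?W \<inter> ?i -` ?W)" using nonmeager_open by blast
    moreover have "meager ((?W - ?R) \<union> ?i -` (?W - ?R))"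
      by (intro meager_Un mW meager_vimage_involution[OF ci]) simp
    \<comment> \<open>Pettis' argument: \<open>?R\<close> and \<open>v - ?R\<close> are both
      comeager in a nonempty open set, so they meet, and \<open>v\<close> is a sum of two points of
      \<open>?R\<close>.\<close>
    ultimately have "\<not> ?W \<inter> ?i -` ?W \<subseteq> (?W - ?R) \<union> ?i -` (?W - ?R)" using meager_subset by blast
    then obtain r where "r \<in> ?R" "v - r \<in> ?R" by blast
    then have "f r \<le> 2 * M" "f (v - r) \<le> 2 * M" using fR by blast+
    then show ?thesis by (simp add: additive.diff[OF f(1)])
  qed
  moreover have "open ?V" by (intro open_vimage open_interior continuous_intros)
  moreover have "w + w \<in> ?V" using w by simp
  ultimately show "continuous_on UNIV f" using additive_bdd_above_continuous[OF f(1)] by blast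
qed


subsection \<open>Infinite dimension\<close>

text \<open>\<open>gap_sum k\<close> is the total of the right ends of all slots below
  \<open>k\<close>, the recursion having \<open>gap\<close> inlined. Since \<open>gap k\<close>
  exceeds \<open>real k * gap_sum k\<close>, one value in slot \<open>k\<close> outweighs the sum of
  values from distinct lower slots, even with coefficients \<open>k\<close> times as large. The
  length \<open>k\<close> provides room for any bounded interval.\<close>

fun gap_sum :: "nat \<Rightarrow> real" where
  "gap_sum 0 = 0"
| "gap_sum (Suc k) = gap_sum k + (real k + 1) * (gap_sum k + 1) + real k"

definition gap :: "nat \<Rightarrow> real" where
  "gap k = (real k + 1) * (gap_sum k + 1)"

definition slot :: "nat \<Rightarrow> real set" where
  "slot k = {gap k <..< gap k + real k}"

lemma gap_sum_eq: "gap_sum k = (\<Sum>l<k. gap l + real l)"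
  by (induction k) (simp_all add: gap_def algebra_simps)

lemma gap_sum_nonneg: "0 \<le> gap_sum k"
  by (induction k) auto

lemma gap_pos: "0 < gap k"
  using gap_sum_nonneg[of k] by (simp add: gap_def)

lemma gap_less:
  assumes "l < k"
  shows "gap l + real l \<le> gap k"
proof -
  have "gap l + real l \<le> gap_sum k"
    unfolding gap_sum_eq using assms gap_pos by (intro member_le_sum) (auto simp: less_imp_le)
  also have "\<dots> \<le> gap k" using gap_sum_nonneg[of k] by (simp add: gap_def distrib_left distrib_right)
  finally show ?thesis .
qed

lemma slot_disjoint: "t \<in> slot k \<Longrightarrow> t \<in> slot l \<Longrightarrow> k = l"
  using gap_less[of k l] gap_less[of l k] by (cases k l rule: linorder_cases) (auto simp: slot_def)

text \<open>
  The coordinates of a point are enumerated by \<open>e\<close>. The slot containing the \<open>j\<close>-th coordinate encodes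
  a list of \<open>j + 1\<close> labels; the last label \<open>(d, k, i, r)\<close> makes \<open>r\<close> an approximation of the \<open>i\<close>-th
  coordinate of precision \<open>1 / k\<close>, and \<open>d\<close> is a dummy that makes slots of arbitrary length available.
\<close>

type_synonym label = "nat \<times> nat \<times> nat \<times> rat"

definition coded :: "(nat \<Rightarrow> 'i) \<Rightarrow> label list \<Rightarrow> ('i \<Rightarrow> real) set" where
  "coded e s = {x. \<forall>j<length s. x (e j) \<in> slot (to_nat (take (Suc j) s)) \<and>
     (case s ! j of (d, k, i, r) \<Rightarrow> i < j \<longrightarrow> \<bar>x (e i) - of_rat r\<bar> * real k < 1)}"

text \<open>\<open>coded\<close> ignores a label at position \<open>j\<close> unless its index is
  below \<open>j\<close>; \<open>Suc i < length s\<close> says that the last label really constrains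
  coordinate \<open>i\<close>.\<close>

definition precise :: "nat \<Rightarrow> nat \<Rightarrow> label list set" where
  "precise i m = {s. Suc i < length s \<and> (\<exists>d k r. s ! (length s - 1) = (d, k, i, r) \<and> m \<le> k)}"

text \<open>The first intersection supplies codes of every length, coherent because slots are
  disjoint. The second supplies labels of unbounded precision for every coordinate.\<close>

definition self_coding :: "(nat \<Rightarrow> 'i) \<Rightarrow> ('i \<Rightarrow> real) set" where
  "self_coding e = (\<Inter>n. \<Union>s\<in>{s. length s = n}. coded e s) \<inter> (\<Inter>i. \<Inter>m. \<Union>s\<in>precise i m. coded e s)"

lemma coded_cong:
  assumes "\<And>j. j < length s \<Longrightarrow> x (e j) = y (e j)" "x \<in> coded e s"
  shows "y \<in> coded e s"
  unfolding coded_def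
proof (intro CollectI allI impI)
  fix j assume j: "j < length s"
  obtain d k i r where l: "s ! j = (d, k, i, r)" by (metis surj_pair)
  have "x (e j) \<in> slot (to_nat (take (Suc j) s))" "i < j \<Longrightarrow> \<bar>x (e i) - of_rat r\<bar> * real k < 1"
    using assms(2) j l by (auto simp: coded_def)
  then show "y (e j) \<in> slot (to_nat (take (Suc j) s)) \<and>
     (case s ! j of (d, k, i, r) \<Rightarrow> i < j \<longrightarrow> \<bar>y (e i) - of_rat r\<bar> * real k < 1)"
    using assms(1)[of j] assms(1)[of i] j l by auto
qed

lemma coded_snoc:
  "x \<in> coded e (s @ [(d, k, i, r)]) \<longleftrightarrow> x \<in> coded e s \<and>
     x (e (length s)) \<in> slot (to_nat (s @ [(d, k, i, r)])) \<and>
     (i < length s \<longrightarrow> \<bar>x (e i) - of_rat r\<bar> * real k < 1)"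
  by (auto simp: coded_def less_Suc_eq nth_append all_conj_distrib)

lemma coded_slot: "x \<in> coded e s \<Longrightarrow> length s = Suc n \<Longrightarrow> x (e n) \<in> slot (to_nat s)"
  by (auto simp: coded_def dest!: spec[of _ n])

lemma coded_take: "x \<in> coded e s \<Longrightarrow> x \<in> coded e (take n s)"
  by (auto simp: coded_def min_def)

text \<open>The slot of one coordinate encodes the whole list up to it, so the last slot alone
  decides the prefix.\<close>

lemma coded_prefix:
  assumes "x \<in> coded e s" "x \<in> coded e t" "length s \<le> length t"
  shows "s = take (length s) t"
proof (cases "length s")
  case (Suc n)
  have "x (e n) \<in> slot (to_nat s)" by (rule coded_slot[OF assms(1) Suc])
  moreover have "x (e n) \<in> slot (to_nat (take (length s) t))"
    by (rule coded_slot[OF coded_take[OF assms(2)]]) (use assms(3) Suc in simp)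
  ultimately have "to_nat s = to_nat (take (length s) t)" by (rule slot_disjoint)
  then show ?thesis by simp
qed simp

lemma open_coded: "open (coded e s)"
proof -
  have "coded e s = (\<Inter>j\<in>{..<length s}. {x. x (e j) \<in> slot (to_nat (take (Suc j) s))} \<inter>
     {x. case s ! j of (d, k, i, r) \<Rightarrow> i < j \<longrightarrow> \<bar>x (e i) - of_rat r\<bar> * real k < 1})"
    by (rule set_eqI) (simp only: coded_def mem_Collect_eq INT_iff Int_iff lessThan_iff Ball_def)
  also have "open \<dots>"
  proof (intro open_INT open_Int ballI open_coordinate)
    show "open (slot k)" for k by (simp add: slot_def)
    fix j
    obtain d k i r where l: "s ! j = (d, k, i, r)" by (metis surj_pair)
    have "open {x :: 'a \<Rightarrow> real. \<bar>x (e i) - of_rat r\<bar> * real k < 1}"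
      by (intro open_Collect_less continuous_intros continuous_on_product_coordinates)
    then show "open {x :: 'a \<Rightarrow> real. case s ! j of (d, k, i, r) \<Rightarrow> i < j \<longrightarrow> \<bar>x (e i) - of_rat r\<bar> * real k < 1}"
      by (cases "i < j") (simp_all add: l)
  qed simp
  finally show ?thesis .
qed

text \<open>Varying the dummy \<open>d\<close> gives infinitely many distinct codes, so a slot of
  any required length exists whatever the meaningful part of the label is.\<close>

lemma to_nat_snoc_unbounded: "\<exists>d. b \<le> real (to_nat (s @ [(d::nat, k::nat, i::nat, r::rat)]))"
proof (rule ccontr)
  assume "\<not> ?thesis"
  then have "real (to_nat (s @ [(d, k, i, r)])) < b" for d by (simp add: not_le)
  then have "to_nat (s @ [(d, k, i, r)]) \<le> nat \<lceil>b\<rceil>" for d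
    by (meson less_le nat_ceiling_le_eq of_nat_ceiling of_nat_le_iff order_trans)
  then have "range (\<lambda>d. to_nat (s @ [(d, k, i, r)])) \<subseteq> {..nat \<lceil>b\<rceil>}" by blast
  then have "finite (range (\<lambda>d. to_nat (s @ [(d, k, i, r)])))" by (rule finite_subset) simp
  moreover have "inj (\<lambda>d. to_nat (s @ [(d, k, i, r)]))" by (auto intro!: injI)
  ultimately show False using finite_imageD infinite_UNIV_nat by blast
qed

text \<open>Labels are appended one at a time: each approximates a coordinate already fixed, and the
  new coordinate is the midpoint of the slot just named. Running through all pairs of a coordinate
  and a precision secures the second intersection in \<open>self_coding\<close>.\<close>

lemma self_coding_extend:
  fixes e :: "nat \<Rightarrow> 'i"
  assumes e: "bij e" and x: "x \<in> coded e s"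
  obtains z where "z \<in> self_coding e" "\<And>j. j < length s \<Longrightarrow> z (e j) = x (e j)"
proof -
  let ?N = "length s"
  define val where "val L i = (if i < ?N then x (e i) else
      gap (to_nat (take (Suc i) L)) + real (to_nat (take (Suc i) L)) / 2)" for L :: "label list" and i
  have ex: "\<exists>d r. \<bar>val L i - of_rat r\<bar> * real m < 1 \<and> 1 \<le> real (to_nat (L @ [(d, m, i, r)]))" for L i m
  proof -
    obtain q where "q \<in> \<rat>" "val L i < q" "q < val L i + 1 / (real m + 1)"
      using Rats_dense_in_real[of "val L i" "val L i + 1 / (real m + 1)"] by auto
    then obtain r where r: "val L i < of_rat r" "of_rat r < val L i + 1 / (real m + 1)"
      by (auto elim!: Rats_cases)
    have "\<bar>val L i - of_rat r\<bar> * real m \<le> 1 / (real m + 1) * real m"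
      using r by (intro mult_right_mono) auto
    also have "\<dots> < 1" by (simp add: field_simps)
    finally show ?thesis using to_nat_snoc_unbounded[of 1 L m i r] by blast
  qed
  \<comment> \<open>The pair \<open>(i, m)\<close> is dictated by the number of labels appended so
    far. The code must be at least 1 because slot 0 is empty.\<close>
  define good where "good L L' \<longleftrightarrow> (\<exists>d i m r. prod_decode (length L - ?N) = (i, m) \<and> L' = L @ [(d, m, i, r)] \<and>
      \<bar>val L i - of_rat r\<bar> * real m < 1 \<and> 1 \<le> real (to_nat L'))" for L L' :: "label list"
  have "\<exists>L'. good L L'" for L
  proof -
    obtain i m where "prod_decode (length L - ?N) = (i, m)" by fastforce
    then show ?thesis using ex[of L i m] unfolding good_def by blast
  qed
  then have "\<exists>step. \<forall>L. good L (step L)" by (intro choice) simp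
  then obtain step where step: "\<And>L. good L (step L)" by blast
  define L where "L k = (step ^^ k) s" for k
  have L0: "L 0 = s" by (simp add: L_def)
  have LS: "good (L k) (L (Suc k))" for k using step by (simp add: L_def)
  have len: "length (L k) = ?N + k" for k
  proof (induction k)
    case (Suc k)
    then show ?case using LS[of k] by (auto simp: good_def)
  qed (simp add: L0)
  have pre: "take (length (L k)) (L (k + j)) = L k" for k j
  proof (induction j)
    case (Suc j)
    have "take (length (L (k + j))) (L (k + Suc j)) = L (k + j)" using LS[of "k + j"] by (auto simp: good_def)
    then have "take (length (L k)) (L (k + Suc j)) = take (length (L k)) (L (k + j))"
      by (metis le_add1 len min.absorb1 add_le_cancel_left take_take)
    then show ?case using Suc by simp
  qed simp
  define z0 where "z0 i = val (L (Suc i)) i" for i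
  have take_L: "take (Suc i) (L k) = take (Suc i) (L k')" if lt: "i < ?N + k" and le: "k \<le> k'" for i k k'
  proof -
    obtain j where "k' = k + j" using le le_Suc_ex by blast
    then have "take (Suc i) (L k') = take (Suc i) (take (length (L k)) (L k'))" using lt len by simp
    then show ?thesis using pre[of k j] \<open>k' = k + j\<close> by simp
  qed
  have val_L: "val (L k) i = z0 i" if "i < ?N + k" for i k
  proof (cases "k \<le> Suc i")
    case True
    then show ?thesis using take_L[OF that True] by (simp add: val_def z0_def)
  next
    case False
    then show ?thesis using take_L[of i "Suc i" k] by (simp add: val_def z0_def)
  qed
  define z where "z i = z0 (inv e i)" for i
  have ze: "z (e j) = z0 j" for j using e by (simp add: z_def bij_is_inj inv_f_f)
  have zx: "z (e j) = x (e j)" if "j < ?N" for j using that by (simp add: ze z0_def val_def)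
  have zc: "z \<in> coded e (L k)" for k
  proof (induction k)
    case 0
    show ?case unfolding L0 by (rule coded_cong[OF _ x]) (simp add: zx)
  next
    case (Suc k)
    obtain d i m r where g: "L (Suc k) = L k @ [(d, m, i, r)]" "\<bar>val (L k) i - of_rat r\<bar> * real m < 1"
      "1 \<le> real (to_nat (L (Suc k)))" using LS[of k] unfolding good_def by blast
    have "z (e (?N + k)) = val (L (Suc k)) (?N + k)" unfolding ze by (rule val_L[symmetric]) simp
    also have "\<dots> = gap (to_nat (L (Suc k))) + real (to_nat (L (Suc k))) / 2"
      using len[of "Suc k"] by (simp add: val_def)
    finally have "z (e (length (L k))) \<in> slot (to_nat (L (Suc k)))"
      using g(3) by (simp add: slot_def len)
    moreover have "i < length (L k) \<longrightarrow> \<bar>z (e i) - of_rat r\<bar> * real m < 1"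
      using g(2) val_L[of i k] by (auto simp: ze len)
    ultimately show ?case using Suc coded_snoc[of z e "L k" d m i r] unfolding g(1) by simp
  qed
  have "z \<in> self_coding e" unfolding self_coding_def
  proof (intro IntI INT_I)
    fix n
    have "z \<in> coded e (take n (L n))" by (rule coded_take[OF zc])
    then show "z \<in> (\<Union>s\<in>{s. length s = n}. coded e s)" using len[of n]
      by (intro UN_I[of "take n (L n)"]) auto
  next
    fix i m
    \<comment> \<open>Asking for precision \<open>m + Suc i\<close> instead of \<open>m\<close>
      forces \<open>i < k\<close>, so the label comes late enough to constrain coordinate
      \<open>i\<close>.\<close>
    define k where "k = prod_encode (i, m + Suc i)"
    have k: "i < k" "prod_decode (length (L k) - ?N) = (i, m + Suc i)"
      using le_prod_encode_2[of "m + Suc i" i] by (auto simp: k_def len)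
    obtain d r where "L (Suc k) = L k @ [(d, m + Suc i, i, r)]" using LS[of k] k(2) unfolding good_def by auto
    then have "L (Suc k) \<in> precise i m" using k(1) len[of k] by (auto simp: precise_def nth_append)
    then show "z \<in> (\<Union>s\<in>precise i m. coded e s)" using zc by blast
  qed
  then show ?thesis using that zx by blast
qed

text \<open>This makes the set completely metrizable, so that Baire's theorem applies inside
  it.\<close>

lemma self_coding_gdelta: "gdelta_in euclidean (self_coding e)"
proof -
  let ?T = "range (\<lambda>n. \<Union>s\<in>{s. length s = n}. coded e s) \<union> (\<Union>i. range (\<lambda>m. \<Union>s\<in>precise i m. coded e s))"
  have "gdelta_in euclidean (\<Inter>?T)"
  proof (rule gdelta_in_Inter)
    fix S assume "S \<in> ?T"
    then have "open S" by (auto intro!: open_UN open_coded)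
    then show "gdelta_in euclidean S" by (simp add: open_imp_gdelta_in)
  qed auto
  moreover have "\<Inter>?T = self_coding e"
  proof (intro equalityI subsetI)
    fix x assume x: "x \<in> \<Inter>?T"
    show "x \<in> self_coding e" unfolding self_coding_def
    proof (intro IntI INT_I)
      show "x \<in> (\<Union>s\<in>{s. length s = n}. coded e s)" for n by (rule InterD[OF x]) blast
      show "x \<in> (\<Union>s\<in>precise i m. coded e s)" for i m by (rule InterD[OF x]) blast
    qed
  qed (auto simp: self_coding_def)
  ultimately show ?thesis by simp
qed

lemma self_coding_borel: "self_coding (e :: nat \<Rightarrow> 'i::countable) \<in> sets borel"
proof -
  have "(\<Inter>n. \<Union>s\<in>{s. length s = n}. coded e s) \<in> sets borel"
    by (rule sets.countable_INT') (auto intro!: borel_open open_coded)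
  moreover have i: "(\<Inter>m. \<Union>s\<in>precise i m. coded e s) \<in> sets borel" for i
    by (rule sets.countable_INT') (auto intro!: borel_open open_coded)
  have "(\<Inter>i. \<Inter>m. \<Union>s\<in>precise i m. coded e s) \<in> sets borel"
    by (rule sets.countable_INT') (use i in auto)
  ultimately show ?thesis unfolding self_coding_def by (rule sets.Int)
qed

lemma self_coding_prefix:
  assumes "x \<in> self_coding e"
  obtains s where "length s = n" "x \<in> coded e s"
proof -
  have "x \<in> (\<Union>s\<in>{s. length s = n}. coded e s)" using assms by (simp add: self_coding_def)
  then show ?thesis using that by blast
qed

text \<open>The labels of unbounded precision make a point of the set determined by its codes.\<close>

lemma self_coding_eqI:
  fixes e :: "nat \<Rightarrow> 'i"
  assumes e: "bij e" and x: "x \<in> self_coding e" and same: "\<And>s. x \<in> coded e s \<Longrightarrow> y \<in> coded e s"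
  shows "x = y"
proof -
  have "x (e i) = y (e i)" for i
  proof (rule ccontr)
    let ?\<delta> = "\<bar>x (e i) - y (e i)\<bar>"
    assume "x (e i) \<noteq> y (e i)"
    then obtain m where m: "2 < real m * ?\<delta>" using reals_Archimedean3[of ?\<delta>] by auto
    have "x \<in> (\<Union>s\<in>precise i m. coded e s)" using x by (simp add: self_coding_def)
    then obtain s where s: "s \<in> precise i m" "x \<in> coded e s" by blast
    obtain d k r where l: "Suc i < length s" "s ! (length s - 1) = (d, k, i, r)" "m \<le> k"
      using s(1) by (auto simp: precise_def)
    have "\<bar>w (e i) - of_rat r\<bar> * real k < 1" if "w \<in> coded e s" for w
      using that l by (auto simp: coded_def dest!: spec[of _ "length s - 1"])
    from this[OF s(2)] this[OF same[OF s(2)]]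
    have "(\<bar>x (e i) - of_rat r\<bar> + \<bar>y (e i) - of_rat r\<bar>) * real k < 2" by (simp add: distrib_right)
    moreover have "?\<delta> * real k \<le> (\<bar>x (e i) - of_rat r\<bar> + \<bar>y (e i) - of_rat r\<bar>) * real k"
      by (intro mult_right_mono) auto
    moreover have "real m * ?\<delta> \<le> ?\<delta> * real k" using l(3) by (simp add: mult.commute mult_right_mono)
    ultimately show False using m by linarith
  qed
  then show ?thesis using e by (metis bij_pointE ext)
qed

text \<open>Take for \<open>c x n\<close> the code of the prefix of length \<open>Suc n\<close>.
  Each code remembers its whole prefix, so two points once separated have different codes ever
  after; prefixes of different lengths have different codes, which therefore tend to
  infinity.\<close>

lemma self_coding_eventually_codes:
  fixes e :: "nat \<Rightarrow> 'i"
  assumes e: "bij e"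
  shows "\<exists>c. \<forall>x\<in>self_coding e. (\<forall>n. x (e n) \<in> slot (c x n)) \<and>
    (\<forall>b. \<forall>\<^sub>F n in sequentially. b \<le> real (c x n)) \<and>
    (\<forall>y\<in>self_coding e. x \<noteq> y \<longrightarrow> (\<forall>\<^sub>F n in sequentially. c x n \<noteq> c y n))"
proof -
  define pr where "pr x n = (SOME s. length s = n \<and> x \<in> coded e s)" for x n
  have pr: "length (pr x n) = n" "x \<in> coded e (pr x n)" if x: "x \<in> self_coding e" for x n
  proof -
    have "\<exists>s. length s = n \<and> x \<in> coded e s" using x by (auto simp: self_coding_def)
    from someI_ex[OF this] show "length (pr x n) = n" "x \<in> coded e (pr x n)" by (simp_all add: pr_def)
  qed
  show ?thesis
  proof (intro exI[of _ "\<lambda>x n. to_nat (pr x (Suc n))"] ballI conjI allI impI)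
    fix x :: "'i \<Rightarrow> real" assume x: "x \<in> self_coding e"
    show "x (e n) \<in> slot (to_nat (pr x (Suc n)))" for n
      by (rule coded_slot[OF pr(2)[OF x] pr(1)[OF x]])
    have "inj (\<lambda>n. to_nat (pr x (Suc n)))"
    proof (rule injI)
      fix m n assume "to_nat (pr x (Suc m)) = to_nat (pr x (Suc n))"
      then have "length (pr x (Suc m)) = length (pr x (Suc n))" by simp
      then show "m = n" using pr(1)[OF x] by simp
    qed
    then have fin: "finite ((\<lambda>n. to_nat (pr x (Suc n))) -` {..nat \<lceil>b\<rceil>})" for b :: real
      by (intro finite_vimageI) auto
    show "\<forall>\<^sub>F n in sequentially. b \<le> real (to_nat (pr x (Suc n)))" for b
      unfolding cofinite_eq_sequentially[symmetric] eventually_cofinite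
    proof (rule finite_subset[OF _ fin[of b]], rule subsetI)
      fix n assume "n \<in> {n. \<not> b \<le> real (to_nat (pr x (Suc n)))}"
      then have "real (to_nat (pr x (Suc n))) < b" by simp
      then show "n \<in> (\<lambda>n. to_nat (pr x (Suc n))) -` {..nat \<lceil>b\<rceil>}" by simp linarith
    qed
    fix y :: "'i \<Rightarrow> real" assume y: "y \<in> self_coding e" "x \<noteq> y"
    then obtain s where s: "x \<in> coded e s" "y \<notin> coded e s" using self_coding_eqI[OF e x] by blast
    show "\<forall>\<^sub>F n in sequentially. to_nat (pr x (Suc n)) \<noteq> to_nat (pr y (Suc n))"
      unfolding eventually_sequentially
    proof (intro exI allI impI notI)
      fix n assume n: "length s \<le> n" and "to_nat (pr x (Suc n)) = to_nat (pr y (Suc n))"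
      then have eq: "pr x (Suc n) = pr y (Suc n)" by simp
      have "s = take (length s) (pr x (Suc n))"
        by (rule coded_prefix[OF s(1) pr(2)[OF x]]) (use n pr(1)[OF x] in simp)
      then have "y \<in> coded e s" using coded_take[OF pr(2)[OF y(1), of "Suc n"], of "length s"] eq by simp
      then show False using s(2) by simp
    qed
  qed
qed

text \<open>
  In a vanishing linear combination, some late coordinate of the point with the highest slot there
  dominates all the other terms.
\<close>

lemma independent_self_coding:
  fixes e :: "nat \<Rightarrow> 'i"
  assumes e: "bij e"
  shows "independent (self_coding e :: ('i \<Rightarrow> real) set)"
proof
  assume "dependent (self_coding e :: ('i \<Rightarrow> real) set)"
  then obtain t u where t: "finite t" "t \<subseteq> self_coding e" "(\<Sum>v\<in>t. u v *\<^sub>R v) = (0 :: 'i \<Rightarrow> real)"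
    "\<exists>v\<in>t. u v \<noteq> 0" unfolding real_vector.dependent_explicit by blast
  obtain c where "\<forall>x\<in>self_coding e. (\<forall>n. x (e n) \<in> slot (c x n)) \<and>
    (\<forall>b. \<forall>\<^sub>F n in sequentially. b \<le> real (c x n)) \<and>
    (\<forall>y\<in>self_coding e. x \<noteq> y \<longrightarrow> (\<forall>\<^sub>F n in sequentially. c x n \<noteq> c y n))"
    using self_coding_eventually_codes[OF e] ..
  then have c: "\<And>x n. x \<in> self_coding e \<Longrightarrow> x (e n) \<in> slot (c x n)"
    "\<And>x b. x \<in> self_coding e \<Longrightarrow> \<forall>\<^sub>F n in sequentially. b \<le> real (c x n)"
    "\<And>x y. x \<in> self_coding e \<Longrightarrow> y \<in> self_coding e \<Longrightarrow> x \<noteq> y \<Longrightarrow> \<forall>\<^sub>F n in sequentially. c x n \<noteq> c y n"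
    by blast+
  define t' where "t' = {v \<in> t. u v \<noteq> 0}"
  have t': "finite t'" "t' \<noteq> {}" "\<And>v. v \<in> t' \<Longrightarrow> v \<in> self_coding e" "\<And>v. v \<in> t' \<Longrightarrow> u v \<noteq> 0"
    using t by (auto simp: t'_def)
  define B where "B = (\<Sum>v\<in>t'. \<bar>u v\<bar>)"
  have ub: "\<bar>u v\<bar> \<le> B" if "v \<in> t'" for v
    unfolding B_def using that t'(1) by (intro member_le_sum) auto
  \<comment> \<open>The bound is required of every \<open>v\<close> because the point with the
    highest slot depends on \<open>n\<close>.\<close>
  have "\<forall>\<^sub>F n in sequentially. \<forall>v\<in>t'. B / \<bar>u v\<bar> \<le> real (c v n) \<and> (\<forall>w\<in>t'. v \<noteq> w \<longrightarrow> c v n \<noteq> c w n)"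
    using t'(1,3) c(2,3)
    by (intro eventually_ball_finite eventually_conj ballI)
      (auto intro: eventually_mono[OF c(3)] eventually_mono[OF always_eventually])
  then obtain n where n: "\<And>v. v \<in> t' \<Longrightarrow> B / \<bar>u v\<bar> \<le> real (c v n)"
    "\<And>v w. v \<in> t' \<Longrightarrow> w \<in> t' \<Longrightarrow> v \<noteq> w \<Longrightarrow> c v n \<noteq> c w n"
    unfolding eventually_sequentially by blast
  have inj: "inj_on (\<lambda>v. c v n) t'" using n(2) by (auto intro: inj_onI)
  have "Max ((\<lambda>v. c v n) ` t') \<in> (\<lambda>v. c v n) ` t'" using t'(1,2) by (intro Max_in) auto
  then obtain w where w: "w \<in> t'" "c w n = Max ((\<lambda>v. c v n) ` t')" by auto
  have less: "c v n < c w n" if "v \<in> t' - {w}" for v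
  proof -
    have "c v n \<le> c w n" using that t'(1) w(2) by simp
    then show ?thesis using n(2)[of v w] that w(1) by force
  qed
  have "(\<Sum>v\<in>t. u v * v (e n)) = 0"
  proof -
    have "(\<Sum>v\<in>t. u v *\<^sub>R v) i = (\<Sum>v\<in>t. u v * v i)" for i
      using t(1) by (induction t) (auto simp: scaleR_fun_def)
    then show ?thesis using fun_cong[OF t(3), of "e n"] by simp
  qed
  moreover have "(\<Sum>v\<in>t. u v * v (e n)) = (\<Sum>v\<in>t'. u v * v (e n))"
    unfolding t'_def using t(1) by (intro sum.mono_neutral_right) auto
  ultimately have "u w * w (e n) = - (\<Sum>v\<in>t' - {w}. u v * v (e n))"
    using sum.remove[OF t'(1) w(1), of "\<lambda>v. u v * v (e n)"] by simp
  then have "\<bar>u w\<bar> * \<bar>w (e n)\<bar> = \<bar>\<Sum>v\<in>t' - {w}. u v * v (e n)\<bar>" by (simp flip: abs_mult)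
  also have "\<dots> \<le> (\<Sum>v\<in>t' - {w}. \<bar>u v * v (e n)\<bar>)" by (rule sum_abs)
  also have "\<dots> \<le> (\<Sum>v\<in>t' - {w}. B * (gap (c v n) + real (c v n)))"
  proof (rule sum_mono)
    fix v assume v: "v \<in> t' - {w}"
    have "v (e n) \<in> slot (c v n)" using v t'(3) c(1) by blast
    then have "\<bar>v (e n)\<bar> \<le> gap (c v n) + real (c v n)" using gap_pos[of "c v n"] by (auto simp: slot_def)
    then show "\<bar>u v * v (e n)\<bar> \<le> B * (gap (c v n) + real (c v n))"
      unfolding abs_mult using ub[of v] v by (intro mult_mono) auto
  qed
  also have "\<dots> = B * (\<Sum>v\<in>t' - {w}. gap (c v n) + real (c v n))" by (simp add: sum_distrib_left)
  also have "\<dots> \<le> B * gap_sum (c w n)"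
  proof (rule mult_left_mono)
    \<comment> \<open>Distinct points occupy distinct slots below that of \<open>w\<close>, so no
      right end is counted twice.\<close>
    have "(\<Sum>v\<in>t' - {w}. gap (c v n) + real (c v n)) = (\<Sum>l\<in>(\<lambda>v. c v n) ` (t' - {w}). gap l + real l)"
      by (rule sum.reindex_cong[OF _ refl refl, symmetric]) (use inj in \<open>auto intro: inj_on_subset\<close>)
    also have "\<dots> \<le> (\<Sum>l<c w n. gap l + real l)"
      using less gap_pos by (intro sum_mono2) (auto simp: less_imp_le add_nonneg_nonneg)
    finally show "(\<Sum>v\<in>t' - {w}. gap (c v n) + real (c v n)) \<le> gap_sum (c w n)" by (simp add: gap_sum_eq)
    show "0 \<le> B" unfolding B_def by (rule sum_nonneg) simp
  qed
  also have "\<dots> \<le> (\<bar>u w\<bar> * real (c w n)) * gap_sum (c w n)"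
    using n(1)[OF w(1)] t'(4)[OF w(1)] gap_sum_nonneg by (intro mult_right_mono) (simp_all add: field_simps)
  also have "\<dots> < \<bar>u w\<bar> * gap (c w n)"
  proof -
    have "real (c w n) * gap_sum (c w n) < gap (c w n)"
      using gap_sum_nonneg[of "c w n"] by (simp add: gap_def distrib_left distrib_right)
    then show ?thesis using t'(4)[OF w(1)] by (simp add: mult.assoc)
  qed
  also have "\<dots> \<le> \<bar>u w\<bar> * \<bar>w (e n)\<bar>"
    using c(1)[OF t'(3)[OF w(1)], of n] by (intro mult_left_mono) (auto simp: slot_def)
  finally show False by simp
qed

text \<open>
  Near each of its points the set is dense in translates of arbitrarily large compact cubes (in
  all but finitely many coordinates), because slots of any length can be appended with void labels.
\<close>

lemma self_coding_absorbs_compact: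
  fixes e :: "nat \<Rightarrow> 'i::countable" and f :: "cantor \<Rightarrow> 'i \<Rightarrow> real"
  assumes e: "bij e" and f: "continuous_on UNIV f"
    and U: "open U" "x \<in> U" "x \<in> self_coding e"
  obtains a n v where "\<And>b. b \<in> cylinder a n \<Longrightarrow> f b - v \<in> closure (self_coding e \<inter> U)"
proof -
  obtain X where X: "\<And>i. open (X i)" "\<And>i. x i \<in> X i" "finite {i. X i \<noteq> UNIV}"
    "\<And>y. (\<And>i. y i \<in> X i) \<Longrightarrow> y \<in> U" using open_contains_cube[OF U(1,2)] by metis
  have inv: "e (inv e i) = i" "inv e (e j) = j" for i j
    using e by (simp_all add: bij_is_surj surj_f_inv_f bij_is_inj inv_f_f)
  have "finite (inv e ` {i. X i \<noteq> UNIV})" using X(3) by simp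
  then obtain N where "\<forall>k\<in>inv e ` {i. X i \<noteq> UNIV}. k < N"
    unfolding finite_nat_set_iff_bounded ..
  then have N0: "\<And>k. k \<in> inv e ` {i. X i \<noteq> UNIV} \<Longrightarrow> k < N" by blast
  have inU: "y \<in> U" if "\<And>j. j < N \<Longrightarrow> y (e j) \<in> X (e j)" for y
  proof (rule X(4))
    fix i show "y i \<in> X i"
      using that[of "inv e i"] N0[of "inv e i"] inv(1)[of i] by (cases "X i = UNIV") auto
  qed
  obtain s where s: "length s = N" "x \<in> coded e s" using self_coding_prefix[OF U(3), of N] .
  obtain X' where X': "\<And>i. open (X' i)" "\<And>i. x i \<in> X' i"
    "\<And>y. (\<And>i. y i \<in> X' i) \<Longrightarrow> y \<in> coded e s" using open_contains_cube[OF open_coded s(2)] by metis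
  have incoded: "y \<in> coded e s" if "\<And>j. j < N \<Longrightarrow> y (e j) \<in> X' (e j)" for y
  proof (rule coded_cong[of s "\<lambda>i. if inv e i < N then y i else x i"])
    show "(\<lambda>i. if inv e i < N then y i else x i) \<in> coded e s"
    proof (rule X'(3))
      fix i show "(if inv e i < N then y i else x i) \<in> X' i"
        using that[of "inv e i"] X'(2) inv(1) by auto
    qed
  qed (simp add: inv s(1))
  have cf: "continuous_on UNIV (\<lambda>b. f b i)" for i using f by (rule continuous_on_product_then_coordinatewise)
  fix a0 :: cantor
  \<comment> \<open>Near \<open>a0\<close> the map \<open>f\<close> moves the first \<open>N\<close>
    coordinates so little that the shifted \<open>x\<close> stays within both cubes.\<close>
  define W where "W = (\<Inter>j\<in>{..<N}. (\<lambda>b. x (e j) + (f b (e j) - f a0 (e j))) -` (X (e j) \<inter> X' (e j)))"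
  have "open W" unfolding W_def
    by (intro open_INT ballI open_vimage open_Int X(1) X'(1) continuous_intros cf) simp
  moreover have "a0 \<in> W" using X(2) X'(2) by (simp add: W_def)
  ultimately obtain n where n: "cylinder a0 n \<subseteq> W" using open_contains_cylinder by metis
  have "\<forall>i. \<exists>B. \<forall>b. \<bar>f b i\<bar> \<le> B"
  proof
    fix i
    have "compact (range (\<lambda>b. f b i))" by (rule compact_continuous_image[OF cf compact_UNIV_cantor])
    then have "bounded (range (\<lambda>b. f b i))" by (rule compact_imp_bounded)
    then show "\<exists>B. \<forall>b. \<bar>f b i\<bar> \<le> B" by (auto simp: bounded_iff)
  qed
  from choice[OF this] obtain B where B: "\<And>i b. \<bar>f b i\<bar> \<le> B i" by blast
  \<comment> \<open>Precision 0 makes the label void, and a slot longer than \<open>2 * B\<close>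
    contains its midpoint shifted by any value of \<open>f\<close> at that coordinate.\<close>
  have "\<forall>L :: label list. \<exists>L'. \<exists>d. L' = L @ [(d, 0, 0, 0)] \<and> 2 * B (e (length L)) + 1 \<le> real (to_nat L')"
  proof
    fix L :: "label list"
    show "\<exists>L'. \<exists>d. L' = L @ [(d, 0, 0, 0)] \<and> 2 * B (e (length L)) + 1 \<le> real (to_nat L')"
      using to_nat_snoc_unbounded[of "2 * B (e (length L)) + 1" L 0 0 0] by blast
  qed
  from choice[OF this] obtain step :: "label list \<Rightarrow> label list"
    where step: "\<And>L. \<exists>d. step L = L @ [(d, 0, 0, 0)] \<and> 2 * B (e (length L)) + 1 \<le> real (to_nat (step L))"
    by blast
  define L where "L k = (step ^^ k) s" for k
  have L0: "L 0 = s" by (simp add: L_def)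
  have LS: "\<exists>d. L (Suc k) = L k @ [(d, 0, 0, 0)] \<and> 2 * B (e (length (L k))) + 1 \<le> real (to_nat (L (Suc k)))" for k
    using step[of "L k"] by (simp add: L_def)
  have len: "length (L k) = N + k" for k
  proof (induction k)
    case (Suc k)
    then show ?case using LS[of k] by auto
  qed (simp add: L0 s(1))
  \<comment> \<open>Subtracting \<open>v\<close> takes \<open>f a0\<close> to \<open>x\<close> on
    the first \<open>N\<close> coordinates and recentres the later ones at slot midpoints.\<close>
  define v0 where "v0 j = (if j < N then f a0 (e j) - x (e j)
      else - (gap (to_nat (L (Suc (j - N)))) + real (to_nat (L (Suc (j - N)))) / 2))" for j
  define v where "v i = v0 (inv e i)" for i
  have ve: "v (e j) = v0 j" for j by (simp add: v_def inv)
  show ?thesis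
  proof (rule that[of a0 n v])
    fix b assume "b \<in> cylinder a0 n"
    then have b: "x (e j) + (f b (e j) - f a0 (e j)) \<in> X (e j) \<inter> X' (e j)" if "j < N" for j
      using n that by (auto simp: W_def)
    let ?y = "f b - v"
    have y1: "?y (e j) \<in> X (e j) \<inter> X' (e j)" if "j < N" for j
      using b[OF that] that by (simp add: ve v0_def algebra_simps)
    have yc: "?y \<in> coded e (L k)" for k
    proof (induction k)
      case 0
      show ?case unfolding L0 by (rule incoded) (use y1 in blast)
    next
      case (Suc k)
      obtain d where d: "L (Suc k) = L k @ [(d, 0, 0, 0)]"
        "2 * B (e (length (L k))) + 1 \<le> real (to_nat (L (Suc k)))" using LS[of k] by blast
      let ?c = "to_nat (L (Suc k))"
      have "?y (e (N + k)) = f b (e (N + k)) + (gap ?c + real ?c / 2)" by (simp add: ve v0_def)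
      moreover have "\<bar>f b (e (N + k))\<bar> < real ?c / 2" using B[of b "e (N + k)"] d(2) by (simp add: len)
      ultimately have "?y (e (length (L k))) \<in> slot ?c"
        unfolding slot_def len greaterThanLessThan_iff by linarith
      then show ?case using Suc unfolding d(1) coded_snoc by (simp add: fun_diff_def)
    qed
    \<comment> \<open>Void labels alone do not put \<open>?y\<close> into the set, so
      \<open>?y\<close> is only approximated: its initial coordinates are continued afresh with
      precise labels.\<close>
    have "\<forall>k. \<exists>z. z \<in> self_coding e \<and> (\<forall>j<N + k. z (e j) = ?y (e j))"
    proof
      fix k
      obtain z where "z \<in> self_coding e" "\<And>j. j < length (L k) \<Longrightarrow> z (e j) = ?y (e j)"
        using self_coding_extend[OF e yc[of k]] by metis
      then show "\<exists>z. z \<in> self_coding e \<and> (\<forall>j<N + k. z (e j) = ?y (e j))" by (auto simp: len)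
    qed
    from choice[OF this] obtain z
      where z: "\<forall>k. z k \<in> self_coding e \<and> (\<forall>j<N + k. z k (e j) = ?y (e j))" ..
    have "z k \<in> U" for k
    proof (rule inU)
      fix j assume "j < N"
      then show "z k (e j) \<in> X (e j)" using z y1[of j] by simp
    qed
    moreover have "z \<longlonglongrightarrow> ?y"
      unfolding tendsto_fun_componentwise
    proof
      fix i
      have "z k i = ?y i" if "k \<ge> Suc (inv e i)" for k using z inv(1)[of i] that by (metis less_le_trans lessI trans_less_add2)
      then show "(\<lambda>k. z k i) \<longlonglongrightarrow> ?y i"
        by (intro tendsto_eventually) (auto simp: eventually_sequentially)
    qed
    ultimately show "?y \<in> closure (self_coding e \<inter> U)"
      unfolding closure_sequential using z by blast
  qed
qed

lemma self_coding_nonempty: "bij e \<Longrightarrow> self_coding e \<noteq> {}"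
  using self_coding_extend[of e 0 "[]"] by (auto simp: coded_def)

text \<open>By Baire's theorem inside the set, one closed \<open>K\<close> of a countable cover
  contains a relatively open part. Its closure absorbs a translated image of a cylinder under the
  witness \<open>f\<close> of \<open>K\<close>, so some preimage contains a nonmeager
  cylinder.\<close>

lemma self_coding_not_sigma_closed_HM:
  fixes e :: "nat \<Rightarrow> 'i::countable"
  assumes e: "bij e"
  shows "(self_coding e :: ('i \<Rightarrow> real) set) \<notin> sigma_closed_HM"
proof
  let ?A = "self_coding e :: ('i \<Rightarrow> real) set"
  assume "?A \<in> sigma_closed_HM"
  then obtain \<K> where \<K>: "countable \<K>" "\<forall>K\<in>\<K>. closed K \<and> haar_meager K" "?A \<subseteq> \<Union>\<K>"
    by (auto simp: sigma_closed_HM_def)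
  have "completely_metrizable_space (top_of_set ?A)"
    by (rule completely_metrizable_space_gdelta_in[OF completely_metrizable_space_euclidean self_coding_gdelta])
  moreover have "top_of_set ?A interior_of \<Union>((\<inter>) ?A ` \<K>) \<noteq> {}"
  proof -
    have "\<Union>((\<inter>) ?A ` \<K>) = ?A" using \<K>(3) by blast
    then show ?thesis using self_coding_nonempty[OF e]
      by (metis interior_of_topspace topspace_euclidean_subtopology)
  qed
  moreover have "closedin (top_of_set ?A) T" if "T \<in> (\<inter>) ?A ` \<K>" for T
    using that \<K>(2) by (auto intro: closedin_closed_Int)
  ultimately have "\<not> (\<forall>T\<in>(\<inter>) ?A ` \<K>. top_of_set ?A interior_of T = {})"
    using Baire_category_alt[of "top_of_set ?A" "(\<inter>) ?A ` \<K>"] \<K>(1) by (metis countable_image)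
  then obtain T where "T \<in> (\<inter>) ?A ` \<K>" "top_of_set ?A interior_of T \<noteq> {}" by blast
  then obtain K x where K: "K \<in> \<K>" "x \<in> top_of_set ?A interior_of (?A \<inter> K)" by blast
  then obtain V where "openin (top_of_set ?A) V" "x \<in> V" "V \<subseteq> ?A \<inter> K" by (auto simp: interior_of_def)
  then obtain U where U: "open U" "x \<in> U" "x \<in> ?A" "?A \<inter> U \<subseteq> K" unfolding openin_open by blast
  have cK: "closed K" and hK: "haar_meager K" using \<K>(2) K(1) by auto
  obtain f :: "cantor \<Rightarrow> 'i \<Rightarrow> real" where f: "continuous_on UNIV f" "\<And>x. meager (f -` translate K x)"
    using hK unfolding haar_meager_def by blast
  obtain a n v where v: "\<And>b. b \<in> cylinder a n \<Longrightarrow> f b - v \<in> closure (?A \<inter> U)"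
    using self_coding_absorbs_compact[OF e f(1) U(1-3)] by metis
  have "closure (?A \<inter> U) \<subseteq> K" by (rule closure_minimal[OF U(4) cK])
  then have "cylinder a n \<subseteq> f -` translate K v" using v by (auto simp: subset_eq)
  then have "meager (cylinder a n)" by (rule meager_subset[OF f(2)])
  then show False using nonmeager_open_cantor[OF open_cylinder[of a n]] cylinder_self[of a n] by blast
qed

text \<open>Independence yields a linear functional that is 1 at \<open>p\<close> and 0 elsewhere on
  the set. Its continuity would isolate \<open>p\<close> in the set, yet the closure of the part
  near \<open>p\<close> contains a translated image of a cylinder under an injective-on-flips map,
  hence more than one point.\<close>

lemma self_coding_not_class_C:
  fixes e :: "nat \<Rightarrow> 'i::countable"
  assumes e: "bij e"
  shows "(self_coding e :: ('i \<Rightarrow> real) set) \<notin> class_C"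
proof
  let ?A = "self_coding e :: ('i \<Rightarrow> real) set"
  assume C: "?A \<in> class_C"
  obtain p where p: "p \<in> ?A" using self_coding_nonempty[OF e] by blast
  obtain g where "linear g \<and> (\<forall>y\<in>?A. g y = (of_bool (y = p) :: real))"
    using linear_independent_extend[OF independent_self_coding[OF e], of "\<lambda>y. of_bool (y = p) :: real"] ..
  then have g: "linear g" "\<forall>y\<in>?A. g y = of_bool (y = p)" by simp_all
  have "bounded (g ` ?A)" unfolding bounded_iff using g(2) by (intro exI[of _ 1]) auto
  moreover have "Modules.additive g" using linear_add[OF g(1)] by unfold_locales
  ultimately have cg: "continuous_on UNIV g" using C by (simp add: class_C_def)
  define U where "U = g -` {1/2<..}"
  have U: "open U" "p \<in> U" unfolding U_def using cg g(2) p by (auto intro: open_vimage)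
  have "?A \<inter> U \<subseteq> {p}" using g(2) by (auto simp: U_def of_bool_def split: if_splits)
  then have cl: "closure (?A \<inter> U) \<subseteq> {p}" by (rule closure_minimal) simp
  \<comment> \<open>Every term is nonzero, so each flip of a zero changes the subset sum.\<close>
  define x where "x n = (\<lambda>i::'i. (1/2::real)^n)" for n
  have "rapid x" by (simp add: rapid_def x_def)
  note sm = rapid_summable[OF this]
  obtain a n v where v: "\<And>b. b \<in> cylinder a n \<Longrightarrow> subset_sum x b - v \<in> closure (?A \<inter> U)"
    using self_coding_absorbs_compact[OF e continuous_subset_sum[of x, OF sm] U p] by metis
  let ?b = "a(n := False)"
  have "subset_sum x ?b - v = p" "subset_sum x (flip n ?b) - v = p"
    using v[of ?b] v[of "flip n ?b"] cl by (auto simp: cylinder_def flip_def)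
  then have "subset_sum x (flip n ?b) = subset_sum x ?b" by (metis diff_add_cancel)
  moreover have "subset_sum x (flip n ?b) = subset_sum x ?b + x n" by (rule subset_sum_flip[OF sm]) simp
  ultimately have "x n = 0" by simp
  then show False by (simp add: x_def fun_eq_iff)
qed

theorem corollary2:
  shows
    "(sets borel \<inter> (HT \<union> NF) :: ('i::countable \<Rightarrow> real) set set) \<subseteq> HN \<inter> HM
   \<and> ((sigma_closed_HN :: ('i \<Rightarrow> real) set set) \<subseteq> HN \<inter> sigma_closed_HM
      \<and> (HN \<inter> sigma_closed_HM :: ('i \<Rightarrow> real) set set) \<subseteq> sigma_closed_HM
      \<and> (sigma_closed_HM :: ('i \<Rightarrow> real) set set) \<subseteq> Meager_sets)
   \<and> (Pow UNIV - HT :: ('i \<Rightarrow> real) set set) \<subseteq> class_C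
   \<and> ((Pow UNIV - NF :: ('i \<Rightarrow> real) set set) \<subseteq> class_A
      \<and> (class_A :: ('i \<Rightarrow> real) set set) = class_B
      \<and> (class_B :: ('i \<Rightarrow> real) set set) \<subseteq> class_C)
   \<and> (finite (UNIV :: 'i set) \<longrightarrow>
        (sets borel - sigma_closed_HN :: ('i \<Rightarrow> real) set set) \<subseteq> class_A
        \<and> (class_A :: ('i \<Rightarrow> real) set set) = class_B
        \<and> (class_B :: ('i \<Rightarrow> real) set set) \<subseteq> class_C)
   \<and> (infinite (UNIV :: 'i set) \<longrightarrow>
        \<not> ((sets borel \<inter> HT \<inter> NF) - sigma_closed_HM :: ('i \<Rightarrow> real) set set) \<subseteq> class_C)"
proof (intro conjI impI)
  show "(sets borel \<inter> (HT \<union> NF) :: ('i \<Rightarrow> real) set set) \<subseteq> HN \<inter> HM"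
  proof
    fix A :: "('i \<Rightarrow> real) set" assume "A \<in> sets borel \<inter> (HT \<union> NF)"
    then have "haar_null A" "haar_meager A"
      using borel_haar_thin[of A] borel_null_finite[of A] by (auto simp: HT_def NF_def)
    then show "A \<in> HN \<inter> HM" by (auto simp: HN_def HM_def)
  qed
  show "(sigma_closed_HN :: ('i \<Rightarrow> real) set set) \<subseteq> HN \<inter> sigma_closed_HM"
    using sigma_closed_HN_subset_HN sigma_closed_HN_subset_sigma_closed_HM by (rule Int_greatest)
  show "(sigma_closed_HM :: ('i \<Rightarrow> real) set set) \<subseteq> Meager_sets"
    by (rule sigma_closed_HM_subset_Meager)
  show HT: "(Pow UNIV - HT :: ('i \<Rightarrow> real) set set) \<subseteq> class_C"
    using not_haar_thin_class_C by (auto simp: HT_def)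
  show AB: "(class_A :: ('i \<Rightarrow> real) set set) = class_B"
    by (rule equalityI[OF class_A_subset_class_B class_B_subset_class_A])
  then show "(class_A :: ('i \<Rightarrow> real) set set) = class_B" .
  show "(class_B :: ('i \<Rightarrow> real) set set) \<subseteq> class_C" "(class_B :: ('i \<Rightarrow> real) set set) \<subseteq> class_C"
    by (rule class_B_subset_class_C)+
  have NF: "A \<in> class_B" if "A \<notin> NF" for A :: "('i \<Rightarrow> real) set"
    using not_null_finite_class_B[of A] that by (simp add: NF_def)
  then show "(Pow UNIV - NF :: ('i \<Rightarrow> real) set set) \<subseteq> class_A" unfolding AB by blast
  show "(sets borel - sigma_closed_HN :: ('i \<Rightarrow> real) set set) \<subseteq> class_A" if "finite (UNIV :: 'i set)"
    unfolding AB using borel_not_sigma_closed_HN_class_B[OF that] by blast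
  show "\<not> (sets borel \<inter> HT \<inter> NF - sigma_closed_HM :: ('i \<Rightarrow> real) set set) \<subseteq> class_C"
    if "infinite (UNIV :: 'i set)"
  proof
    assume sub: "(sets borel \<inter> HT \<inter> NF - sigma_closed_HM :: ('i \<Rightarrow> real) set set) \<subseteq> class_C"
    have e: "bij (from_nat_into (UNIV :: 'i set))"
      by (rule bij_betw_from_nat_into[OF countableI_type that])
    let ?A = "self_coding (from_nat_into (UNIV :: 'i set)) :: ('i \<Rightarrow> real) set"
    have C: "?A \<notin> class_C" by (rule self_coding_not_class_C[OF e])
    \<comment> \<open>Sets outside \<open>HT\<close> or outside \<open>NF\<close> lie in
      \<open>class_C\<close>, so avoiding \<open>class_C\<close> gives both memberships.\<close>
    then have "?A \<in> HT" "?A \<in> NF" using HT NF[of ?A] class_B_subset_class_C by auto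
    then have "?A \<in> class_C"
      using sub self_coding_borel self_coding_not_sigma_closed_HM[OF e] by blast
    then show False using C by simp
  qed
qed simp_all

end
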